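(* Let $T$ be a nontrivial finite metric tree of length $L=|T|$, let $0<R\le L$, and let $\beta$ be a finite positive Borel measure on $[0,R]$, extended by zero to $\mathbb R_{\ge0}$. The following statements are equivalent. (i) There is a probability measure $\nu$ on $\mathcal C(T,0)$ such that $E_\nu\le\beta$. (ii) There is a fractional marked-ball cover $\xi$ on $X_{T,R}=T\times[0,R]$ such that $\pi_*\xi\le\beta$. (iii) Every finite positive Borel measure $\sigma$ on $T$ satisfies $$\sigma(T)\le\int_{[0,R]}M_\sigma(s)\,d\beta(s).$$ Moreover, it is enough in (iii) to test finite positive atomic measures; that is, (i)–(iii) are also equivalent to the statement that every finite positive atomic measure $\sigma$ on $T$ satisfies the inequality in (iii).
   Context: A finite metric tree is the metric realization of a finite combinatorial tree whose edges have positive lengths; it is nontrivial if it is not a single point. $|T|$ is the total edge length, $d_T$ the path metric, and $B_T(v,s)=\{x\in T: d_T(x,v)\le s\}$. For $m\ge1$, a tuple $\mathbf r=(r_1,\dots,r_m)\in\mathbb R_{\ge0}^m$ is a cover of $T$ if there are $v_1,\dots,v_m\in T$ with $T\subseteq\bigcup_i B_T(v_i,r_i)$; $\mathcal C_m(T)$ is the set of such tuples, $\mathcal C(T)=\bigsqcup_{m\ge1}\mathcal C_m(T)$ with the disjoint-union Borel structure, and $\mathcal C(T,0)=\{\mathbf r\in\mathcal C(T):\sum_i r_i\le|T|\}$. For a finite Borel measure $\nu$ on $\mathcal C(T)$, $E_\nu(A)=\int|\{i:r_i\in A\}|\,d\nu(\mathbf r)$ for Borel $A\subseteq\mathbb R_{\ge0}$.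 For positive Borel measures, $\mu\le\mu'$ means $\mu(A)\le\mu'(A)$ for all Borel $A$. On $X_{T,R}=T\times[0,R]$ let $\pi(v,s)=s$. A fractional marked-ball cover of $T$ on $X_{T,R}$ is a finite positive Borel measure $\xi$ on $X_{T,R}$ with $\xi(\{(v,s):d_T(x,v)\le s\})\ge1$ for every $x\in T$; $\pi_*\xi$ is its radius measure. For a finite positive Borel measure $\sigma$ on $T$, $M_\sigma(s)=\max_{v\in T}\sigma(B_T(v,s))$ for $s\ge0$ (the maximum is attained, and $M_\sigma$ is nondecreasing). A finite positive Borel measure on $T$ is atomic if it has the form $\sum_{i=1}^n a_i\delta_{x_i}$ with $a_i\ge0$. *)

theory Defs
  imports "HOL-Probability.Probability"
begin

section \<open>Finite combinatorial trees\<close>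

text \<open>A simple graph has vertex set \<open>V\<close> and a set \<open>E\<close> of two-element subsets of \<open>V\<close>.\<close>

definition graph_cycle :: "'v set set \<Rightarrow> 'v list \<Rightarrow> bool" where
  "graph_cycle E vs \<longleftrightarrow> 3 \<le> length vs \<and> distinct vs \<and>
     (\<forall>i<length vs. {vs ! i, vs ! (Suc i mod length vs)} \<in> E)"

definition finite_tree :: "'v set \<Rightarrow> 'v set set \<Rightarrow> bool" where
  "finite_tree V E \<longleftrightarrow>
     finite V \<and> V \<noteq> {} \<and>
     (\<forall>e\<in>E. \<exists>u\<in>V. \<exists>v\<in>V. u \<noteq> v \<and> e = {u, v}) \<and>
     (\<forall>u\<in>V. \<forall>v\<in>V. (u, v) \<in> {(a, b). {a, b} \<in> E}\<^sup>*) \<and>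
     (\<nexists>vs. graph_cycle E vs)"


section \<open>Metric realization\<close>

text \<open>Points of the realization are given by barycentric coordinates: nonnegative functions
  on the vertices of total mass one, supported on a single vertex or a single edge.\<close>

definition cell_points :: "'v set \<Rightarrow> ('v \<Rightarrow> real) set" where
  "cell_points c = {x. (\<forall>v. 0 \<le> x v) \<and> (\<forall>v. v \<notin> c \<longrightarrow> x v = 0) \<and> (\<Sum>v\<in>c. x v) = 1}"

definition realization :: "'v set \<Rightarrow> 'v set set \<Rightarrow> ('v \<Rightarrow> real) set" where
  "realization V E = (\<Union>v\<in>V. cell_points {v}) \<union> (\<Union>e\<in>E. cell_points e)"

text \<open>An edge \<open>{u, v}\<close> is identified with a segment of length \<open>len {u, v}\<close>. For two points
  \<open>x\<close>, \<open>y\<close> of it, \<open>\<bar>x u - y u\<bar> = \<bar>x v - y v\<bar>\<close>; averaging avoids choosing an endpoint.\<close>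

definition segment_dist :: "('v set \<Rightarrow> real) \<Rightarrow> 'v set \<Rightarrow> ('v \<Rightarrow> real) \<Rightarrow> ('v \<Rightarrow> real) \<Rightarrow> real" where
  "segment_dist len e x y = len e * ((\<Sum>v\<in>e. \<bar>x v - y v\<bar>) / 2)"

text \<open>\<open>broken_line E len x y l\<close>: some finite concatenation of segments, each contained in one
  edge, leads from \<open>x\<close> to \<open>y\<close> and has total length \<open>l\<close>.\<close>

inductive broken_line ::
  "'v set set \<Rightarrow> ('v set \<Rightarrow> real) \<Rightarrow> ('v \<Rightarrow> real) \<Rightarrow> ('v \<Rightarrow> real) \<Rightarrow> real \<Rightarrow> bool"
  for E len where
  refl: "broken_line E len x x 0"
| step: "broken_line E len x y l \<Longrightarrow> e \<in> E \<Longrightarrow> y \<in> cell_points e \<Longrightarrow> z \<in> cell_points e \<Longrightarrow>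
    broken_line E len x z (l + segment_dist len e y z)"

definition path_dist ::
  "'v set set \<Rightarrow> ('v set \<Rightarrow> real) \<Rightarrow> ('v \<Rightarrow> real) \<Rightarrow> ('v \<Rightarrow> real) \<Rightarrow> real" where
  "path_dist E len x y = Inf {l. broken_line E len x y l}"

text \<open>\<open>T\<close>, with the metric of the ambient type restricted to it, is (isometric to) the metric
  realization of the finite tree \<open>(V, E)\<close> with edge lengths \<open>len\<close>. The ambient space plays no
  other role: balls, measures and topology below are those of \<open>T\<close>.\<close>

definition finite_metric_tree ::
  "'v set \<Rightarrow> 'v set set \<Rightarrow> ('v set \<Rightarrow> real) \<Rightarrow> 'a::metric_space set \<Rightarrow> bool" where
  "finite_metric_tree V E len T \<longleftrightarrow>
     finite_tree V E \<and> (\<forall>e\<in>E. 0 < len e) \<and>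
     (\<exists>\<phi>. bij_betw \<phi> (realization V E) T \<and>
        (\<forall>x\<in>realization V E. \<forall>y\<in>realization V E. dist (\<phi> x) (\<phi> y) = path_dist E len x y))"

definition nontrivial :: "'a set \<Rightarrow> bool" where
  "nontrivial T \<longleftrightarrow> (\<nexists>p. T = {p})"

definition total_length :: "'v set set \<Rightarrow> ('v set \<Rightarrow> real) \<Rightarrow> real" where
  "total_length E len = (\<Sum>e\<in>E. len e)"

definition tree_ball :: "'a::metric_space set \<Rightarrow> 'a \<Rightarrow> real \<Rightarrow> 'a set" where
  "tree_ball T v s = {x\<in>T. dist x v \<le> s}"


section \<open>Borel measures\<close>

abbreviation borel_on :: "'a::topological_space set \<Rightarrow> 'a measure" where
  "borel_on S \<equiv> restrict_space borel S"

definition finite_borel_measure_on :: "'a::topological_space set \<Rightarrow> 'a measure \<Rightarrow> bool" where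
  "finite_borel_measure_on S \<mu> \<longleftrightarrow> sets \<mu> = sets (borel_on S) \<and> finite_measure \<mu>"

text \<open>Extension by zero from a subset of the half-line is push-forward along the inclusion.\<close>

definition zero_extension :: "real measure \<Rightarrow> real measure" where
  "zero_extension \<beta> = distr \<beta> (borel_on {0..}) (\<lambda>s. s)"

definition atomic_measure_on :: "'a::topological_space set \<Rightarrow> 'a measure \<Rightarrow> bool" where
  "atomic_measure_on S \<sigma> \<longleftrightarrow> sets \<sigma> = sets (borel_on S) \<and>
     (\<exists>(n::nat) (a :: nat \<Rightarrow> real) (x :: nat \<Rightarrow> 'a). (\<forall>i<n. 0 \<le> a i \<and> x i \<in> S) \<and>
        (\<forall>A\<in>sets \<sigma>. emeasure \<sigma> A = (\<Sum>i<n. ennreal (a i) * emeasure (return (borel_on S) (x i)) A)))"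


section \<open>Covers\<close>

text \<open>An \<open>m\<close>-tuple is an extensional function on \<open>{..<m}\<close>; the disjoint union over \<open>m\<close> consists of
  the pairs \<open>(m, r)\<close>.\<close>

definition covers_of_size :: "'a::metric_space set \<Rightarrow> nat \<Rightarrow> (nat \<Rightarrow> real) set" where
  "covers_of_size T m =
     {r \<in> {..<m} \<rightarrow>\<^sub>E {0..}. \<exists>v \<in> {..<m} \<rightarrow> T. T \<subseteq> (\<Union>i<m. tree_ball T (v i) (r i))}"

definition covers :: "'a::metric_space set \<Rightarrow> (nat \<times> (nat \<Rightarrow> real)) set" where
  "covers T = (SIGMA m:{1..}. covers_of_size T m)"

text \<open>Disjoint-union Borel structure: a set is measurable iff each of its slices is a Borel subset
  of \<open>covers_of_size T m\<close>, the Borel structure of \<open>\<real>\<^sup>m\<close> being the product one. The family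
  below is already a \<open>\<sigma>\<close>-algebra.\<close>

definition covers_space :: "'a::metric_space set \<Rightarrow> (nat \<times> (nat \<Rightarrow> real)) measure" where
  "covers_space T = sigma (covers T)
     {A. A \<subseteq> covers T \<and> (\<forall>m\<ge>1. {r. (m, r) \<in> A} \<in>
        sets (restrict_space (\<Pi>\<^sub>M i\<in>{..<m}. (borel :: real measure)) (covers_of_size T m)))}"

text \<open>Covers with sum of radii at most \<open>l\<close>. With \<open>l\<close> the total length of the tree this is
  \<open>\<C>(T, 0)\<close>.\<close>

definition bounded_covers :: "'a::metric_space set \<Rightarrow> real \<Rightarrow> (nat \<times> (nat \<Rightarrow> real)) set" where
  "bounded_covers T l = {(m, r) \<in> covers T. (\<Sum>i<m. r i) \<le> l}"

definition radius_intensity :: "(nat \<times> (nat \<Rightarrow> real)) measure \<Rightarrow> real set \<Rightarrow> ennreal" where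
  "radius_intensity \<nu> A = (\<integral>\<^sup>+ (m, r). of_nat (card {i\<in>{..<m}. r i \<in> A}) \<partial>\<nu>)"

definition fractional_marked_ball_cover ::
  "'a::metric_space set \<Rightarrow> real \<Rightarrow> ('a \<times> real) measure \<Rightarrow> bool" where
  "fractional_marked_ball_cover T R \<xi> \<longleftrightarrow>
     finite_borel_measure_on (T \<times> {0..R}) \<xi> \<and>
     (\<forall>x\<in>T. 1 \<le> emeasure \<xi> {(v, s) \<in> T \<times> {0..R}. dist x v \<le> s})"

definition radius_measure :: "real \<Rightarrow> ('a \<times> real) measure \<Rightarrow> real measure" where
  "radius_measure R \<xi> = distr \<xi> (borel_on {0..R}) snd"

text \<open>On a finite metric tree this supremum is a maximum.\<close>

definition max_ball_mass :: "'a::metric_space set \<Rightarrow> 'a measure \<Rightarrow> real \<Rightarrow> ennreal" where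
  "max_ball_mass T \<sigma> s = (SUP v\<in>T. emeasure \<sigma> (tree_ball T v s))"

end

theory Submission
  imports Defs "HOL-Library.Transitive_Closure_Table"
begin

text \<open>
  Statement (iii) is the linear programming dual of (i) and (ii). If balls \<open>B(v\<^sub>i, r\<^sub>i)\<close> cover
  \<open>T\<close>, then \<open>\<sigma>(T) \<le> \<Sum>\<^sub>i M\<^sub>\<sigma>(r\<^sub>i)\<close>; averaging over a random cover gives (i) \<open>\<Longrightarrow>\<close> (iii)
  (\<open>mass_le_of_random_cover\<close>). For a fractional cover the same estimate is Fubini's theorem
  (\<open>mass_le_of_fractional_cover\<close>). The content is that testing atomic measures already yields
  both (i) and (ii). They come from one object, a random \<^emph>\<open>marked\<close> cover: a probability measure on
  finite tuples of pairs (centre, radius). The law of its radii is \<open>\<nu>\<close> and its intensity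
  is \<open>\<xi>\<close>, so that no measurable selection of centres is required.

  \<^emph>\<open>Integrality.\<close> Removing an edge \<open>e\<close> splits the tree, and \<open>f\<^sub>e(x) \<in> [0, 1]\<close> measures how far \<open>x\<close>
  has crossed \<open>e\<close> away from a root. In these coordinates the path metric is
  \<open>\<Sum>\<^sub>e len(e) \<bar>f\<^sub>e(x) - f\<^sub>e(y)\<bar>\<close>, and the sides cut off by edges form a laminar family, which implies
  the four-point condition. List the points of a finite net by decreasing distance to the root and
  the balls \<open>B(v, s)\<close> by increasing \<open>s - d(v, root)\<close>. By the four-point condition the incidence
  matrix has no submatrix with rows \<open>(1, 1)\<close>, \<open>(1, 0)\<close> (\<open>ball_exchange\<close>). For such matrices a greedy
  packing and a selection of tight columns in reverse order have the same value
  (\<open>integral_covering_duality\<close>). A packing for the cost \<open>c\<close> is an atomic measure \<open>\<sigma>\<close> with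
  \<open>M\<^sub>\<sigma> \<le> c\<close>, so the hypothesis says that for every cost \<open>c\<close> some honest cover costs at most
  \<open>\<integral> c d\<beta>\<close>. The minimax theorem \<open>finite_minimax\<close> converts this into a random cover of the net
  whose radius intensity is bounded by \<open>\<beta>\<close>, up to the mesh.

  \<^emph>\<open>Total radius.\<close> A ball of radius \<open>r\<close> centred at distance \<open>r\<close> above a deepest point removes
  length at least \<open>r\<close> from the tree, and a tree of length \<open>l\<close> fits into a ball of radius \<open>l / 2\<close>.
  Hence, if the radii add up to more than \<open>|T|\<close>, the smallest ball can be dropped after recentring
  the others (\<open>short_subcover\<close>).

  \<^emph>\<open>Limit.\<close> As the mesh tends to zero, the random covers live on a disjoint union of compact sets
  indexed by the number of balls. The mean number of balls is at most the mass of \<open>\<beta>\<close>, so the laws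
  are tight. Coding points by ternary expansions moves the problem to the real line, where Helly's
  selection theorem produces a limit (\<open>tight_sequence_on_disjoint_union\<close>); covering is a closed
  condition and survives (\<open>exact_random_cover\<close>).
\<close>

section \<open>Integral covering duality for greedy incidence matrices\<close>

definition column_weight :: "(nat \<Rightarrow> 'j \<Rightarrow> bool) \<Rightarrow> (nat \<Rightarrow> real) \<Rightarrow> 'j \<Rightarrow> nat \<Rightarrow> real" where
  "column_weight A y j n = (\<Sum>i<n. if A i j then y i else 0)"

lemma column_weight_Suc: "column_weight A y j (Suc n) = column_weight A y j n + (if A n j then y n else 0)"
  by (simp add: column_weight_def)

lemma column_weight_mono: "(\<And>i. 0 \<le> y i) \<Longrightarrow> m \<le> n \<Longrightarrow> column_weight A y j m \<le> column_weight A y j n"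
  unfolding column_weight_def by (intro sum_mono2) auto

lemma column_weight_cong: "(\<And>i. i < n \<Longrightarrow> y i = y' i) \<Longrightarrow> column_weight A y j n = column_weight A y' j n"
  unfolding column_weight_def by (intro sum.cong) auto

text \<open>Rows are processed in order and each receives the largest weight that keeps all columns within
their capacity, so the row becomes blocked by a column that is already full at that moment.\<close>

lemma greedy_packing:
  fixes c :: "'j \<Rightarrow> real"
  assumes J: "finite J" and c: "\<And>j. j \<in> J \<Longrightarrow> 0 \<le> c j"
    and ex: "\<And>i. i < n \<Longrightarrow> \<exists>j\<in>J. A i j"
  shows "\<exists>y. (\<forall>i. 0 \<le> y i) \<and> (\<forall>j\<in>J. column_weight A y j n \<le> c j) \<and>
     (\<forall>i<n. \<exists>j\<in>J. A i j \<and> column_weight A y j (Suc i) = c j)"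
  using ex
proof (induction n)
  case 0
  show ?case using c by (intro exI[of _ "\<lambda>_. 0"]) (auto simp: column_weight_def)
next
  case (Suc n)
  then obtain y where y0: "\<And>i. 0 \<le> y i" and feas: "\<And>j. j \<in> J \<Longrightarrow> column_weight A y j n \<le> c j"
    and tight: "\<And>i. i < n \<Longrightarrow> \<exists>j\<in>J. A i j \<and> column_weight A y j (Suc i) = c j"
    by (metis less_SucI)
  define C where "C = {j\<in>J. A n j}"
  have C: "finite C" "C \<noteq> {}" using J Suc.prems[of n] by (auto simp: C_def)
  \<comment> \<open>the largest weight that row \<open>n\<close> can still receive\<close>
  define slack where "slack = Min ((\<lambda>j. c j - column_weight A y j n) ` C)"
  have slack_le: "slack \<le> c j - column_weight A y j n" if "j \<in> C" for j
    unfolding slack_def using that C by (intro Min_le) auto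
  obtain j0 where j0: "j0 \<in> C" "slack = c j0 - column_weight A y j0 n"
  proof -
    have "slack \<in> (\<lambda>j. c j - column_weight A y j n) ` C"
      unfolding slack_def using C by (intro Min_in) auto
    then show ?thesis using that by auto
  qed
  have slack0: "0 \<le> slack" using j0 feas by (auto simp: C_def)
  define y' where "y' = y(n := slack)"
  have old: "column_weight A y' j k = column_weight A y j k" if "k \<le> n" for j k
    using that by (intro column_weight_cong) (auto simp: y'_def)
  have y'n: "y' n = slack" by (simp add: y'_def)
  have "column_weight A y' j (Suc n) \<le> c j" if "j \<in> J" for j
    using that slack_le[of j] feas[of j] by (auto simp: column_weight_Suc old C_def y'n)
  moreover have "\<exists>j\<in>J. A i j \<and> column_weight A y' j (Suc i) = c j" if "i < Suc n" for i
  proof (cases "i = n")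
    case True
    then show ?thesis using j0 by (intro bexI[of _ j0]) (auto simp: column_weight_Suc old C_def y'n)
  next
    case False
    then show ?thesis using tight[of i] that old[of "Suc i"] by auto
  qed
  moreover have "0 \<le> y' i" for i using y0 slack0 by (simp add: y'_def)
  ultimately show ?case by (intro exI[of _ y'] conjI allI ballI impI)
qed

text \<open>Columns are inspected by decreasing key and kept unless they clash with one already kept; a rejected
column therefore clashes with a kept column of larger key.\<close>

lemma dominating_independent_subset:
  fixes \<kappa> :: "'j \<Rightarrow> real"
  assumes "finite J" and sym: "\<And>j j'. clash j j' \<Longrightarrow> clash j' j"
  shows "\<exists>S\<subseteq>J. (\<forall>j\<in>S. \<forall>j'\<in>S. clash j j' \<longrightarrow> j = j') \<and>
    (\<forall>j\<in>J - S. \<exists>j'\<in>S. \<kappa> j \<le> \<kappa> j' \<and> clash j j')"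
  using assms(1)
proof (induction J rule: finite_ranking_induct[where f="\<lambda>j. - \<kappa> j"])
  case empty
  then show ?case by auto
next
  case (insert x J)
  then obtain S where S: "S \<subseteq> J" "\<forall>j\<in>S. \<forall>j'\<in>S. clash j j' \<longrightarrow> j = j'"
    "\<forall>j\<in>J - S. \<exists>j'\<in>S. \<kappa> j \<le> \<kappa> j' \<and> clash j j'" by blast
  have ge: "\<kappa> x \<le> \<kappa> j" if "j \<in> S" for j using insert(2) S(1) that by fastforce
  show ?case
  proof (cases "\<exists>j\<in>S. clash x j")
    case True
    then show ?thesis using S ge by (intro exI[of _ S]) auto
  next
    case False
    then show ?thesis using S sym by (intro exI[of _ "insert x S"]) blast
  qed
qed

text \<open>Hoffman, Kolen and Sakarovitch: for a matrix in standard greedy form the weighted covering problem has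
an integral optimum. Select among the columns filled by the greedy packing so that no row of positive
weight is met twice; then the cost of the selection is at most the packed weight. A row whose
blocking column was rejected is covered by the larger column that caused the rejection: the two
share an earlier row, and the greedy form propagates membership to later rows.\<close>

theorem integral_covering_duality:
  fixes A :: "nat \<Rightarrow> 'j \<Rightarrow> bool" and c \<kappa> :: "'j \<Rightarrow> real"
  assumes J: "finite J" and c: "\<And>j. j \<in> J \<Longrightarrow> 0 \<le> c j"
    and ex: "\<And>i. i < n \<Longrightarrow> \<exists>j\<in>J. A i j"
    and greedy: "\<And>i k j j'. i < k \<Longrightarrow> k < n \<Longrightarrow> j \<in> J \<Longrightarrow> j' \<in> J \<Longrightarrow> \<kappa> j \<le> \<kappa> j' \<Longrightarrow>
      A i j \<Longrightarrow> A i j' \<Longrightarrow> A k j \<Longrightarrow> A k j'"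
  obtains y S where "\<And>i. 0 \<le> y i" "\<And>j. j \<in> J \<Longrightarrow> (\<Sum>i<n. if A i j then y i else 0) \<le> c j"
    "S \<subseteq> J" "\<And>i. i < n \<Longrightarrow> \<exists>j\<in>S. A i j" "(\<Sum>j\<in>S. c j) \<le> (\<Sum>i<n. y i)"
proof -
  have "\<exists>y. (\<forall>i. 0 \<le> y i) \<and> (\<forall>j\<in>J. column_weight A y j n \<le> c j) \<and>
     (\<forall>i<n. \<exists>j\<in>J. A i j \<and> column_weight A y j (Suc i) = c j)"
    by (rule greedy_packing) (use J c ex in auto)
  then obtain y where y: "\<forall>i. 0 \<le> y i" "\<forall>j\<in>J. column_weight A y j n \<le> c j"
     "\<forall>i<n. \<exists>j\<in>J. A i j \<and> column_weight A y j (Suc i) = c j" by (elim exE conjE)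
  have y0: "\<And>i. 0 \<le> y i" and feas: "\<And>j. j \<in> J \<Longrightarrow> column_weight A y j n \<le> c j"
    and tight: "\<And>i. i < n \<Longrightarrow> \<exists>j\<in>J. A i j \<and> column_weight A y j (Suc i) = c j"
    using y by simp_all
  \<comment> \<open>\<open>J'\<close> collects the full columns; two columns clash if a row of positive weight lies in both\<close>
  define J' where "J' = {j\<in>J. column_weight A y j n = c j}"
  define clash where "clash j j' \<longleftrightarrow> (\<exists>k<n. 0 < y k \<and> A k j \<and> A k j')" for j j'
  have "finite J'" using J by (auto simp: J'_def)
  have "\<exists>S\<subseteq>J'. (\<forall>j\<in>S. \<forall>j'\<in>S. clash j j' \<longrightarrow> j = j') \<and>
    (\<forall>j\<in>J' - S. \<exists>j'\<in>S. \<kappa> j \<le> \<kappa> j' \<and> clash j j')"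
    by (rule dominating_independent_subset) (use \<open>finite J'\<close> in \<open>auto simp: clash_def\<close>)
  then obtain S where S: "S \<subseteq> J'" and SS: "\<forall>j\<in>S. \<forall>j'\<in>S. clash j j' \<longrightarrow> j = j'"
    "\<forall>j\<in>J' - S. \<exists>j'\<in>S. \<kappa> j \<le> \<kappa> j' \<and> clash j j'" by (elim exE conjE)
  have ind: "\<And>j j'. j \<in> S \<Longrightarrow> j' \<in> S \<Longrightarrow> clash j j' \<Longrightarrow> j = j'"
    and dom: "\<And>j. j \<in> J' \<Longrightarrow> j \<notin> S \<Longrightarrow> \<exists>j'\<in>S. \<kappa> j \<le> \<kappa> j' \<and> clash j j'"
    using SS by simp_all
  have finS: "finite S" using S \<open>finite J'\<close> finite_subset by blast
  have "\<exists>j\<in>S. A i j" if i: "i < n" for i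
  proof -
    obtain j where j: "j \<in> J" "A i j" "column_weight A y j (Suc i) = c j" using tight i by blast
    have jJ': "j \<in> J'"
      using column_weight_mono[of y "Suc i" n A j] y0 i feas[OF j(1)] j by (auto simp: J'_def)
    show ?thesis
    proof (cases "j \<in> S")
      case False
      then obtain j' k where j': "j' \<in> S" "\<kappa> j \<le> \<kappa> j'" and k: "k < n" "0 < y k" "A k j" "A k j'"
        using dom[OF jJ'] by (auto simp: clash_def)
      \<comment> \<open>the blocking column of \<open>i\<close> was full at time \<open>i\<close>, so it meets no later row of positive weight\<close>
      have "k \<le> i"
      proof (rule ccontr)
        assume "\<not> k \<le> i"
        then have "column_weight A y j (Suc i) + y k \<le> column_weight A y j (Suc k)"
          using column_weight_mono[of y "Suc i" k A j] y0 k by (simp add: column_weight_Suc)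
        also have "\<dots> \<le> column_weight A y j n" using column_weight_mono[of y "Suc k" n A j] y0 k by simp
        also have "\<dots> \<le> c j" by (rule feas[OF j(1)])
        finally show False using j(3) k by simp
      qed
      then show ?thesis
        using greedy[of k i j j'] j j' k i S by (cases "k = i") (auto simp: J'_def)
    qed (use j in blast)
  qed
  moreover have "(\<Sum>j\<in>S. c j) \<le> (\<Sum>i<n. y i)"
  proof -
    have "(\<Sum>j\<in>S. c j) = (\<Sum>j\<in>S. column_weight A y j n)"
      using S by (intro sum.cong) (auto simp: J'_def)
    also have "\<dots> = (\<Sum>i<n. \<Sum>j\<in>S. if A i j then y i else 0)"
      unfolding column_weight_def by (rule sum.swap)
    also have "\<dots> \<le> (\<Sum>i<n. y i)"
    proof (rule sum_mono)
      fix i assume i: "i \<in> {..<n}"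
      show "(\<Sum>j\<in>S. if A i j then y i else 0) \<le> y i"
      proof (cases "0 < y i \<and> (\<exists>j\<in>S. A i j)")
        case True
        then obtain j where j: "j \<in> S" "A i j" by blast
        have uniq: "j' = j" if "j' \<in> S" "A i j'" for j'
        proof (rule ind)
          show "clash j' j" using that j True i by (auto simp: clash_def)
        qed (use that j in auto)
        have "(\<Sum>j'\<in>S. if A i j' then y i else 0) = (\<Sum>j'\<in>S. if j' = j then y i else 0)"
        proof (rule sum.cong[OF HOL.refl])
          fix j' assume "j' \<in> S"
          then show "(if A i j' then y i else 0) = (if j' = j then y i else 0)"
            using uniq j(2) by metis
        qed
        then show ?thesis using finS j by simp
      next
        case False
        then have "(\<Sum>j\<in>S. if A i j then y i else 0) = 0"
          using y0[of i] by (intro sum.neutral) auto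
        then show ?thesis using y0[of i] by simp
      qed
    qed
    finally show ?thesis .
  qed
  ultimately show thesis
    using y0 feas S unfolding column_weight_def by (intro that[of y S]) (auto simp: J'_def)
qed

section \<open>A finite minimax theorem\<close>

lemma compact_simplex:
  fixes X :: "'s set"
  assumes "finite X"
  shows "compact {\<mu>::'s \<Rightarrow> real. (\<forall>s. 0 \<le> \<mu> s) \<and> (\<forall>s. s \<notin> X \<longrightarrow> \<mu> s = 0) \<and> (\<Sum>s\<in>X. \<mu> s) = 1}" (is "compact ?D")
proof -
  define I where "I s = (if s \<in> X then {0..1::real} else {0})" for s
  have "compactin (product_topology (\<lambda>_. euclidean) UNIV) (PiE UNIV I)"
    by (subst compactin_PiE) (auto simp: I_def)
  then have 1: "compact (PiE UNIV I)"
    by (simp add: euclidean_product_topology)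
  have c: "continuous_on UNIV (\<lambda>\<mu>::'s \<Rightarrow> real. \<mu> s)" for s by (rule continuous_on_product_coordinates)
  have "closed {\<mu>::'s \<Rightarrow> real. (\<Sum>s\<in>X. \<mu> s) = 1}"
    by (intro closed_Collect_eq continuous_intros c)
  moreover have "?D = PiE UNIV I \<inter> {\<mu>. (\<Sum>s\<in>X. \<mu> s) = 1}"
  proof (intro set_eqI iffI)
    fix \<mu> assume D: "\<mu> \<in> ?D"
    have "\<mu> s \<le> 1" if "s \<in> X" for s
      using member_le_sum[of s X \<mu>] that D assms by auto
    then show "\<mu> \<in> PiE UNIV I \<inter> {\<mu>. (\<Sum>s\<in>X. \<mu> s) = 1}" using D by (auto simp: I_def)
  next
    fix \<mu> assume D: "\<mu> \<in> PiE UNIV I \<inter> {\<mu>. (\<Sum>s\<in>X. \<mu> s) = 1}"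
    then have "\<And>s. \<mu> s \<in> I s" by auto
    then have "0 \<le> \<mu> s \<and> (s \<notin> X \<longrightarrow> \<mu> s = 0)" for s
      unfolding I_def by (metis atLeastAtMost_iff order_refl singletonD)
    then show "\<mu> \<in> ?D" using D by auto
  qed
  ultimately show ?thesis using 1 by (simp add: compact_Int_closed)
qed

text \<open>Minimize the sum of the squared excesses over \<open>b\<close> on the simplex. At a minimizer the positive parts
\<open>g\<close> of the excesses serve as test vector; moving towards the \<open>s\<close> that passes the test for \<open>g\<close> decreases
the sum unless \<open>g = 0\<close>.\<close>

theorem finite_minimax:
  fixes N :: "'s \<Rightarrow> 't \<Rightarrow> real" and b :: "'t \<Rightarrow> real"
  assumes X: "finite X" "X \<noteq> {}" and G: "finite G"
    and test: "\<And>c. (\<And>t. 0 \<le> c t) \<Longrightarrow> \<exists>s\<in>X. (\<Sum>t\<in>G. c t * N s t) \<le> (\<Sum>t\<in>G. c t * b t)"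
  obtains \<mu> where "\<And>s. 0 \<le> \<mu> s" "(\<Sum>s\<in>X. \<mu> s) = 1"
    "\<And>t. t \<in> G \<Longrightarrow> (\<Sum>s\<in>X. \<mu> s * N s t) \<le> b t"
proof -
  define D where "D = {\<mu>::'s \<Rightarrow> real. (\<forall>s. 0 \<le> \<mu> s) \<and> (\<forall>s. s \<notin> X \<longrightarrow> \<mu> s = 0) \<and> (\<Sum>s\<in>X. \<mu> s) = 1}"
  define e where "e \<mu> t = (\<Sum>s\<in>X. \<mu> s * N s t)" for \<mu> t
  define F where "F \<mu> = (\<Sum>t\<in>G. (max 0 (e \<mu> t - b t))\<^sup>2)" for \<mu>
  have c: "continuous_on UNIV (\<lambda>\<mu>::'s \<Rightarrow> real. \<mu> s)" for s by (rule continuous_on_product_coordinates)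
  have "continuous_on UNIV F" unfolding F_def e_def by (intro continuous_intros c)
  then have "continuous_on D F" using continuous_on_subset by blast
  moreover obtain s0 where s0: "s0 \<in> X" using X by blast
  have "(\<lambda>s. if s = s0 then 1 else 0) \<in> D" using s0 X by (auto simp: D_def)
  moreover have "compact D" unfolding D_def by (rule compact_simplex[OF X(1)])
  ultimately obtain \<mu> where \<mu>: "\<mu> \<in> D" and min: "\<And>\<mu>'. \<mu>' \<in> D \<Longrightarrow> F \<mu> \<le> F \<mu>'"
    using continuous_attains_inf[of D F] by blast
  define g where "g t = max 0 (e \<mu> t - b t)" for t
  obtain s where s: "s \<in> X" "(\<Sum>t\<in>G. g t * N s t) \<le> (\<Sum>t\<in>G. g t * b t)"
    using test[of g] by (auto simp: g_def)
  define d where "d t = N s t - e \<mu> t" for t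
  define Q where "Q = (\<Sum>t\<in>G. (d t)\<^sup>2)"
  have slope: "(\<Sum>t\<in>G. g t * d t) \<le> - F \<mu>"
  proof -
    have "(\<Sum>t\<in>G. g t * d t) = (\<Sum>t\<in>G. g t * N s t) - (\<Sum>t\<in>G. g t * e \<mu> t)"
      by (simp add: d_def algebra_simps sum_subtractf)
    also have "\<dots> \<le> (\<Sum>t\<in>G. g t * b t) - (\<Sum>t\<in>G. g t * e \<mu> t)" using s by simp
    also have "\<dots> = (\<Sum>t\<in>G. g t * (b t - e \<mu> t))" by (simp add: algebra_simps sum_subtractf)
    also have "\<dots> = (\<Sum>t\<in>G. - (g t)\<^sup>2)"
      by (intro sum.cong) (auto simp: g_def max_def power2_eq_square algebra_simps)
    finally show ?thesis by (simp add: F_def g_def sum_negf)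
  qed
  \<comment> \<open>a step of length \<open>l\<close> towards the vertex \<open>s\<close> of the simplex changes \<open>F\<close> by at most \<open>- 2 l F + l\<^sup>2 Q\<close>\<close>
  have key: "2 * F \<mu> \<le> l * Q" if l: "0 < l" "l \<le> 1" for l
  proof -
    define \<mu>' where "\<mu>' s' = (1 - l) * \<mu> s' + l * (if s' = s then 1 else 0)" for s'
    have "(\<Sum>s'\<in>X. \<mu>' s') = (1 - l) * (\<Sum>s'\<in>X. \<mu> s') + l * (\<Sum>s'\<in>X. if s' = s then 1 else 0)"
      by (simp add: \<mu>'_def sum.distrib sum_distrib_left)
    then have "(\<Sum>s'\<in>X. \<mu>' s') = 1" using \<mu> s X by (simp add: D_def)
    then have "\<mu>' \<in> D" using \<mu> s l by (auto simp: D_def \<mu>'_def)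
    have e': "e \<mu>' t = e \<mu> t + l * d t" for t
    proof -
      have "e \<mu>' t = (\<Sum>s'\<in>X. (1 - l) * (\<mu> s' * N s' t) + l * (if s' = s then N s' t else 0))"
        unfolding e_def \<mu>'_def by (intro sum.cong) (auto simp: algebra_simps)
      also have "\<dots> = (1 - l) * e \<mu> t + l * (\<Sum>s'\<in>X. if s' = s then N s' t else 0)"
        unfolding e_def by (simp add: sum.distrib sum_distrib_left)
      finally show ?thesis using s X by (simp add: d_def algebra_simps)
    qed
    have "F \<mu> \<le> F \<mu>'" by (rule min) fact
    also have "\<dots> \<le> (\<Sum>t\<in>G. (g t + l * d t)\<^sup>2)"
      unfolding F_def
    proof (rule sum_mono)
      fix t
      define a h where "a = e \<mu> t - b t" and "h = l * d t"
      have "(max 0 (a + h))\<^sup>2 \<le> (max 0 a + h)\<^sup>2"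
      proof (cases "a + h \<le> 0 \<or> 0 \<le> a")
        case False
        then show ?thesis by (auto simp: max_def intro!: power_mono)
      qed (auto simp: max_def)
      then show "(max 0 (e \<mu>' t - b t))\<^sup>2 \<le> (g t + l * d t)\<^sup>2"
        by (simp add: e' a_def h_def g_def algebra_simps)
    qed
    also have "\<dots> = F \<mu> + 2 * l * (\<Sum>t\<in>G. g t * d t) + l\<^sup>2 * Q"
      unfolding F_def Q_def g_def[symmetric]
      by (simp add: power2_sum power_mult_distrib sum.distrib sum_distrib_left algebra_simps)
    also have "\<dots> \<le> F \<mu> + 2 * l * (- F \<mu>) + l\<^sup>2 * Q"
      using slope l by (intro add_mono mult_left_mono) auto
    finally have "l * (2 * F \<mu>) \<le> l * (l * Q)" by (simp add: power2_eq_square algebra_simps)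
    then show ?thesis using l by simp
  qed
  have "F \<mu> \<le> 0"
  proof (rule field_le_epsilon)
    fix \<epsilon> :: real assume \<epsilon>: "0 < \<epsilon>"
    have Q0: "0 \<le> Q" by (simp add: Q_def sum_nonneg)
    define l where "l = min 1 (\<epsilon> / (Q + 1))"
    have l: "0 < l" "l \<le> 1" using \<epsilon> Q0 by (auto simp: l_def)
    have "l * Q \<le> \<epsilon> / (Q + 1) * Q" using Q0 by (intro mult_right_mono) (auto simp: l_def)
    also have "\<dots> \<le> \<epsilon>" using Q0 \<epsilon> by (simp add: field_simps)
    finally have "2 * F \<mu> \<le> \<epsilon>" using key[OF l] by simp
    then show "F \<mu> \<le> 0 + \<epsilon>" using \<epsilon> by simp
  qed
  then have "F \<mu> = 0" by (simp add: F_def antisym sum_nonneg)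
  then have "\<And>t. t \<in> G \<Longrightarrow> e \<mu> t \<le> b t"
    using G by (auto simp: F_def sum_nonneg_eq_0_iff max_def split: if_splits)
  then show thesis using that[of \<mu>] \<mu> by (auto simp: D_def e_def)
qed

section \<open>The rooted combinatorial tree\<close>

definition adjacent :: "'v set set \<Rightarrow> ('v \<times> 'v) set" where
  "adjacent F = {(a, b). {a, b} \<in> F}"

lemma adjacent_rtrancl_sym: "(a, b) \<in> (adjacent F)\<^sup>* \<Longrightarrow> (b, a) \<in> (adjacent F)\<^sup>*"
  by (rule symD[OF sym_rtrancl]) (auto simp: adjacent_def sym_def insert_commute)

locale rooted_tree =
  fixes V :: "'v set" and E :: "'v set set" and root :: 'v
  assumes finite_tree: "finite_tree V E" and root: "root \<in> V"
begin

lemma finite_V: "finite V"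
  and connected: "u \<in> V \<Longrightarrow> v \<in> V \<Longrightarrow> (u, v) \<in> (adjacent E)\<^sup>*"
  and acyclic: "\<not> graph_cycle E vs"
  using finite_tree unfolding finite_tree_def adjacent_def by auto

lemma edge_ends: "e \<in> E \<Longrightarrow> \<exists>u v. u \<in> V \<and> v \<in> V \<and> u \<noteq> v \<and> e = {u, v}"
  using finite_tree unfolding finite_tree_def by blast

lemma edge_in_V: "{u, v} \<in> E \<Longrightarrow> u \<in> V \<and> v \<in> V \<and> u \<noteq> v"
  using edge_ends[of "{u, v}"] by (auto simp: doubleton_eq_iff)

lemma finite_E: "finite E"
proof (rule finite_subset)
  show "E \<subseteq> Pow V" using edge_ends by blast
qed (simp add: finite_V)

text \<open>A detour around the edge can be taken without repeated vertices and closes up to a cycle.\<close>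

lemma edge_is_bridge:
  assumes e: "{a, b} \<in> E"
  shows "(a, b) \<notin> (adjacent (E - {{a, b}}))\<^sup>*"
proof
  assume "(a, b) \<in> (adjacent (E - {{a, b}}))\<^sup>*"
  define r where "r x y \<longleftrightarrow> {x, y} \<in> E - {{a, b}}" for x y
  have "r = (\<lambda>x y. (x, y) \<in> adjacent (E - {{a, b}}))"
    by (auto simp: r_def adjacent_def fun_eq_iff)
  then have "r\<^sup>*\<^sup>* a b"
    using \<open>(a, b) \<in> _\<close> by (simp add: rtranclp_rtrancl_eq)
  then obtain xs0 where "rtrancl_path r a xs0 b" by (auto simp: rtranclp_eq_rtrancl_path)
  then obtain xs where xs: "rtrancl_path r a xs b" "distinct (a # xs)"
    by (rule rtrancl_path_distinct)
  have ab: "a \<noteq> b" using edge_in_V[OF e] by simp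
  then have ne: "xs \<noteq> []" using xs(1) by (auto elim: rtrancl_path.cases)
  have last: "last xs = b" using rtrancl_path_last[OF xs(1) ne] .
  have nth: "r ((a # xs) ! i) (xs ! i)" if "i < length xs" for i
    using rtrancl_path_nth[OF xs(1) that] .
  have len: "2 \<le> length xs"
  proof (rule ccontr)
    assume "\<not> 2 \<le> length xs"
    moreover have "length xs \<noteq> 0" using ne by simp
    ultimately have 1: "length xs = 1" by linarith
    then have "xs ! 0 = b" using last ne by (simp add: last_conv_nth)
    then have "r a b" using nth[of 0] 1 by simp
    then show False by (simp add: r_def)
  qed
  have "{(a # xs) ! i, (a # xs) ! (Suc i mod length (a # xs))} \<in> E" if "i < length (a # xs)" for i
  proof (cases "i = length xs")
    case True
    then have "(a # xs) ! i = b" using last ne by (simp add: last_conv_nth nth_Cons')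
    then show ?thesis using True e by (simp add: insert_commute)
  next
    case False
    then show ?thesis using nth[of i] that by (simp add: r_def)
  qed
  then have "graph_cycle E (a # xs)" using xs(2) len by (simp add: graph_cycle_def)
  then show False using acyclic by blast
qed

definition side :: "'v set \<Rightarrow> 'v set" where
  "side e = {v \<in> V. (root, v) \<notin> (adjacent (E - {e}))\<^sup>*}"

lemma side_subset: "side e \<subseteq> V" by (auto simp: side_def)
lemma finite_side: "finite (side e)" using finite_subset[OF side_subset finite_V] .
lemma root_notin_side: "root \<notin> side e" by (simp add: side_def)

lemma side_other_edge:
  assumes "{a, b} \<in> E" "{a, b} \<noteq> e"
  shows "a \<in> side e \<longleftrightarrow> b \<in> side e"
proof -
  have "(a, b) \<in> adjacent (E - {e})" "(b, a) \<in> adjacent (E - {e})"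
    using assms by (auto simp: adjacent_def insert_commute)
  then show ?thesis using edge_in_V[OF assms(1)]
    unfolding side_def by (auto intro: rtrancl_into_rtrancl)
qed

lemma reach_avoiding_edge:
  assumes "(root, v) \<in> (adjacent E)\<^sup>*" and R: "R = (adjacent (E - {{a, b}}))\<^sup>*"
  shows "(root, v) \<in> R \<or> ((root, a) \<in> R \<or> (root, b) \<in> R) \<and> ((a, v) \<in> R \<or> (b, v) \<in> R)"
  using assms(1)
proof (induction rule: rtrancl_induct)
  case base
  then show ?case by (simp add: R)
next
  case (step u w)
  show ?case
  proof (cases "{u, w} = {a, b}")
    case True
    then show ?thesis using step(3) by (auto simp: doubleton_eq_iff R)
  next
    case False
    then have "(u, w) \<in> adjacent (E - {{a, b}})" using step(2) by (simp add: adjacent_def)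
    then show ?thesis using step(3) unfolding R by (meson rtrancl.rtrancl_into_rtrancl)
  qed
qed

lemma side_ends:
  assumes "{a, b} \<in> E"
  shows "a \<in> side {a, b} \<longleftrightarrow> b \<notin> side {a, b}"
proof -
  let ?R = "(adjacent (E - {{a, b}}))\<^sup>*"
  have V: "a \<in> V" "b \<in> V" using edge_in_V[OF assms] by auto
  have "(root, a) \<in> ?R \<or> (root, b) \<in> ?R"
    using reach_avoiding_edge[OF connected[OF root V(1)], of ?R a b] by blast
  moreover have "\<not> ((root, a) \<in> ?R \<and> (root, b) \<in> ?R)"
    using edge_is_bridge[OF assms] adjacent_rtrancl_sym by (meson rtrancl_trans)
  ultimately show ?thesis using V by (auto simp: side_def)
qed

lemma oriented_edge:
  assumes "e \<in> E"
  obtains a b where "a \<in> V" "b \<in> V" "a \<noteq> b" "e = {a, b}" "a \<notin> side e" "b \<in> side e"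
proof -
  obtain u v where uv: "u \<in> V" "v \<in> V" "u \<noteq> v" "e = {u, v}" using edge_ends[OF assms] by blast
  show thesis
  proof (cases "v \<in> side e")
    case True
    then show thesis using that[of u v] uv side_ends[of u v] assms by auto
  next
    case False
    then show thesis using that[of v u] uv side_ends[of u v] assms by (auto simp: insert_commute)
  qed
qed

lemma side_connected:
  assumes "{a, b} \<in> E" "b \<in> side {a, b}" "v \<in> side {a, b}"
  shows "(b, v) \<in> (adjacent (E - {{a, b}}))\<^sup>*"
proof -
  let ?R = "(adjacent (E - {{a, b}}))\<^sup>*"
  have v: "v \<in> V" "(root, v) \<notin> ?R" using assms(3) by (auto simp: side_def)
  have "a \<notin> side {a, b}" using side_ends assms by blast
  then have "(root, a) \<in> ?R" using edge_in_V[OF assms(1)] by (simp add: side_def)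
  then have "(a, v) \<notin> ?R" using v by (meson rtrancl_trans)
  then show ?thesis using reach_avoiding_edge[OF connected[OF root v(1)], of ?R a b] v(2) by blast
qed

text \<open>The side of \<open>e\<close> is connected without using \<open>e\<close>, and so is its complement. Whichever of the two avoids \<open>e'\<close>
lies entirely on one side of \<open>e'\<close>.\<close>

lemma sides_laminar:
  assumes e: "e \<in> E" and e': "e' \<in> E" and ne: "e \<noteq> e'"
  shows "side e \<inter> side e' = {} \<or> side e \<subseteq> side e' \<or> side e' \<subseteq> side e"
proof -
  obtain a b where ab: "e = {a, b}" "b \<in> side e" using oriented_edge[OF e] by metis
  obtain a' b' where ab': "e' = {a', b'}" using oriented_edge[OF e'] by metis
  have iff: "a' \<in> side e \<longleftrightarrow> b' \<in> side e" using side_other_edge[of a' b' e] e' ab' ne by auto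
  show ?thesis
  proof (cases "a' \<in> side e")
    case False
    have "v \<in> side e \<and> (v \<in> side e' \<longleftrightarrow> b \<in> side e')" if "(b, v) \<in> (adjacent (E - {e}))\<^sup>*" for v
      using that
    proof (induction rule: rtrancl_induct)
      case base
      then show ?case using ab by simp
    next
      case (step u w)
      then have uw: "{u, w} \<in> E" "{u, w} \<noteq> e" by (auto simp: adjacent_def)
      have "{u, w} \<noteq> e'" using step(3) False iff ab' by (auto simp: doubleton_eq_iff)
      then show ?case using side_other_edge[OF uw] side_other_edge[OF uw(1), of e'] step(3) by blast
    qed
    moreover have "(b, v) \<in> (adjacent (E - {e}))\<^sup>*" if "v \<in> side e" for v
      using side_connected[of a b v] e ab that by simp
    ultimately have "v \<in> side e' \<longleftrightarrow> b \<in> side e'" if "v \<in> side e" for v using that by blast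
    then show ?thesis by (cases "b \<in> side e'") auto
  next
    case True
    have "w \<notin> side e \<and> w \<notin> side e'" if "(root, w) \<in> (adjacent (E - {e}))\<^sup>*" for w
      using that
    proof (induction rule: rtrancl_induct)
      case base
      then show ?case using root_notin_side by simp
    next
      case (step u w)
      then have uw: "{u, w} \<in> E" "{u, w} \<noteq> e" by (auto simp: adjacent_def)
      have "{u, w} \<noteq> e'" using step(3) True iff ab' by (auto simp: doubleton_eq_iff)
      then show ?case using side_other_edge[OF uw] side_other_edge[OF uw(1), of e'] step(3) by blast
    qed
    then have "side e' \<subseteq> side e" using side_subset by (auto simp: side_def)
    then show ?thesis by blast
  qed
qed

text \<open>The barycentric mass beyond \<open>e\<close>: it is \<open>0\<close> on the root side, \<open>1\<close> on the far side, and the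
linear parameter on \<open>e\<close> itself.\<close>

definition coord :: "'v set \<Rightarrow> ('v \<Rightarrow> real) \<Rightarrow> real" where
  "coord e x = (\<Sum>v\<in>side e. x v)"

definition vertex :: "'v \<Rightarrow> 'v \<Rightarrow> real" where
  "vertex v = (\<lambda>u. if u = v then 1 else 0)"

lemma cell_pointsD:
  assumes "x \<in> cell_points {a, b}" "a \<noteq> b"
  shows "0 \<le> x a" "0 \<le> x b" "x a + x b = 1" "\<And>v. v \<noteq> a \<Longrightarrow> v \<noteq> b \<Longrightarrow> x v = 0"
  using assms by (auto simp: cell_points_def)

lemma vertex_in_cell: "finite c \<Longrightarrow> v \<in> c \<Longrightarrow> vertex v \<in> cell_points c"
  by (auto simp: cell_points_def vertex_def)

lemma cell_singleton: "cell_points {v} = {vertex v}"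
  by (auto simp: cell_points_def vertex_def)

lemma realization_cases:
  assumes "x \<in> realization V E"
  obtains v where "v \<in> V" "x = vertex v" | e where "e \<in> E" "x \<in> cell_points e"
  using assms by (auto simp: realization_def cell_singleton)

lemma vertex_in_realization: "v \<in> V \<Longrightarrow> vertex v \<in> realization V E"
  by (auto simp: realization_def cell_singleton)

lemma cell_in_realization: "e \<in> E \<Longrightarrow> x \<in> cell_points e \<Longrightarrow> x \<in> realization V E"
  by (auto simp: realization_def)

lemma coord_vertex: "coord e (vertex v) = (if v \<in> side e then 1 else 0)"
  using finite_side by (simp add: coord_def vertex_def)

lemma coord_cell:
  assumes "x \<in> cell_points {a, b}" "a \<noteq> b"
  shows "coord e x = (if a \<in> side e then x a else 0) + (if b \<in> side e then x b else 0)"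
proof -
  have "coord e x = (\<Sum>v\<in>side e \<inter> {a, b}. x v)"
    unfolding coord_def using cell_pointsD(4)[OF assms] finite_side by (intro sum.mono_neutral_right) auto
  also have "\<dots> = (\<Sum>v\<in>{a, b}. if v \<in> side e then x v else 0)"
    by (simp add: sum.inter_restrict[symmetric] Int_commute)
  finally show ?thesis using assms(2) by simp
qed

lemma coord_other_edge:
  assumes "g \<in> E" "x \<in> cell_points g" "g \<noteq> e" "v \<in> g"
  shows "coord e x = (if v \<in> side e then 1 else 0)"
proof -
  obtain a b where ab: "a \<noteq> b" "g = {a, b}" using edge_ends[OF assms(1)] by blast
  have "a \<in> side e \<longleftrightarrow> b \<in> side e" using side_other_edge[of a b e] assms ab by auto
  then show ?thesis
    using coord_cell[of x a b e] cell_pointsD(3)[of x a b] assms ab by auto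
qed

lemma coord_own_edge:
  assumes "{a, b} \<in> E" "a \<notin> side {a, b}" "b \<in> side {a, b}" "x \<in> cell_points {a, b}"
  shows "coord {a, b} x = x b"
  using coord_cell[of x a b "{a, b}"] edge_in_V[OF assms(1)] assms by auto

lemma coord_bounds:
  assumes "x \<in> realization V E"
  shows "0 \<le> coord e x" "coord e x \<le> 1"
proof -
  have "0 \<le> coord e x \<and> coord e x \<le> 1"
    using assms
  proof (cases rule: realization_cases)
    case (1 v)
    then show ?thesis by (simp add: coord_vertex)
  next
    case (2 g)
    obtain a b where ab: "a \<noteq> b" "g = {a, b}" using edge_ends[OF 2(1)] by blast
    then show ?thesis using coord_cell[of x a b e] cell_pointsD[of x a b] 2 by auto
  qed
  then show "0 \<le> coord e x" "coord e x \<le> 1" by auto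
qed

lemma coord_root: "coord e (vertex root) = 0"
  by (simp add: coord_vertex root_notin_side)

lemma coord_pos:
  assumes "x \<in> realization V E" "0 < coord e x"
  obtains v where "v \<in> side e" "0 < x v"
proof -
  have "\<exists>v\<in>side e. 0 < x v"
  proof (rule ccontr)
    assume "\<not> ?thesis"
    then have "coord e x \<le> 0" unfolding coord_def by (intro sum_nonpos) (auto simp: not_less)
    then show False using assms by simp
  qed
  then show thesis using that by blast
qed

text \<open>A point with mass on the smaller side has its whole cell on the larger one: the two ends of \<open>e\<close> lie on
the same side of \<open>e'\<close>, and the root end of \<open>e\<close> is outside \<open>side e\<close>.\<close>

lemma coord_nested:
  assumes E: "e \<in> E" "e' \<in> E" "e \<noteq> e'" and sub: "side e' \<subseteq> side e"
    and x: "x \<in> realization V E" "0 < coord e' x"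
  shows "coord e x = 1"
proof -
  obtain v where v: "v \<in> side e'" "0 < x v" using coord_pos[OF x] .
  show ?thesis using x(1)
  proof (cases rule: realization_cases)
    case (1 w)
    then have "w = v" using v by (auto simp: vertex_def split: if_splits)
    then show ?thesis using 1 v sub by (auto simp: coord_vertex)
  next
    case (2 g)
    have vg: "v \<in> g" using 2 v(2) by (auto simp: cell_points_def)
    have "g \<noteq> e"
    proof
      assume ge: "g = e"
      obtain a b where ab: "a \<noteq> b" "e = {a, b}" "a \<notin> side e" "b \<in> side e" using oriented_edge[OF E(1)] by metis
      have "a \<in> side e' \<longleftrightarrow> b \<in> side e'" using side_other_edge[of a b e'] ab E by auto
      then show False using ab vg v(1) ge sub by auto
    qed
    then show ?thesis using coord_other_edge[OF 2(1,2) _ vg] v sub by auto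
  qed
qed

lemma coord_disjoint:
  assumes E: "e \<in> E" "e' \<in> E" "e \<noteq> e'" and disj: "side e \<inter> side e' = {}"
    and x: "x \<in> realization V E" and pos: "0 < coord e x"
  shows "coord e' x = 0"
proof (rule ccontr)
  assume "coord e' x \<noteq> 0"
  then have pos': "0 < coord e' x" using coord_bounds[OF x, of e'] by simp
  obtain v where v: "v \<in> side e" "0 < x v" using coord_pos[OF x pos] .
  obtain v' where v': "v' \<in> side e'" "0 < x v'" using coord_pos[OF x pos'] .
  show False using x
  proof (cases rule: realization_cases)
    case (1 w)
    then show False using v v' disj by (auto simp: vertex_def split: if_splits)
  next
    case (2 g)
    obtain a b where ab: "a \<noteq> b" "g = {a, b}" using edge_ends[OF 2(1)] by blast
    have g: "v \<in> g" "v' \<in> g" using 2 v v' by (auto simp: cell_points_def)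
    have "v \<noteq> v'" using v v' disj by blast
    then have gv: "g = {v, v'}" using g ab by auto
    show False
    proof (cases "g = e")
      case False
      then show False using side_other_edge[of v v' e] gv 2 v v' disj by auto
    next
      case True
      then show False using side_other_edge[of v v' e'] gv 2 v v' disj E by auto
    qed
  qed
qed

end

section \<open>The path metric as an l1-distance\<close>

locale weighted_tree = rooted_tree V E root for V :: "'v set" and E root +
  fixes len :: "'v set \<Rightarrow> real"
  assumes len_pos: "e \<in> E \<Longrightarrow> 0 < len e"
begin

definition l1_dist :: "('v \<Rightarrow> real) \<Rightarrow> ('v \<Rightarrow> real) \<Rightarrow> real" where
  "l1_dist x y = (\<Sum>e\<in>E. len e * \<bar>coord e x - coord e y\<bar>)"

lemma l1_dist_sym: "l1_dist x y = l1_dist y x"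
  by (simp add: l1_dist_def abs_minus_commute)

lemma l1_dist_nonneg: "0 \<le> l1_dist x y"
  unfolding l1_dist_def by (intro sum_nonneg mult_nonneg_nonneg abs_ge_zero less_imp_le[OF len_pos])

lemma l1_dist_triangle: "l1_dist x z \<le> l1_dist x y + l1_dist y z"
proof -
  have "l1_dist x z \<le> (\<Sum>e\<in>E. len e * (\<bar>coord e x - coord e y\<bar> + \<bar>coord e y - coord e z\<bar>))"
    unfolding l1_dist_def using len_pos by (intro sum_mono mult_left_mono) (auto intro: less_imp_le)
  then show ?thesis by (simp add: l1_dist_def sum.distrib distrib_left)
qed

lemma l1_dist_additive:
  assumes "\<And>e. e \<in> E \<Longrightarrow> coord e x = coord e y \<or> coord e y = coord e z"
  shows "l1_dist x z = l1_dist x y + l1_dist y z"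
  unfolding l1_dist_def sum.distrib[symmetric]
proof (rule sum.cong)
  fix e assume "e \<in> E"
  then show "len e * \<bar>coord e x - coord e z\<bar> =
      len e * \<bar>coord e x - coord e y\<bar> + len e * \<bar>coord e y - coord e z\<bar>"
    using assms[of e] by auto
qed simp

lemma l1_dist_cell:
  assumes "e \<in> E" "x \<in> cell_points e" "y \<in> cell_points e"
  shows "l1_dist x y = segment_dist len e x y"
proof -
  obtain a b where ab: "a \<noteq> b" "e = {a, b}" "a \<notin> side e" "b \<in> side e" using oriented_edge[OF assms(1)] by metis
  have "l1_dist x y = (\<Sum>g\<in>{e}. len g * \<bar>coord g x - coord g y\<bar>)"
    unfolding l1_dist_def
  proof (rule sum.mono_neutral_right)
    show "\<forall>g\<in>E - {e}. len g * \<bar>coord g x - coord g y\<bar> = 0"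
    proof
      fix g assume "g \<in> E - {e}"
      then have "e \<noteq> g" "a \<in> e" using ab by auto
      then have "coord g x = coord g y"
        using coord_other_edge[OF assms(1,2), of g a] coord_other_edge[OF assms(1,3), of g a] by simp
      then show "len g * \<bar>coord g x - coord g y\<bar> = 0" by simp
    qed
  qed (use assms finite_E in auto)
  also have "\<dots> = len e * \<bar>x b - y b\<bar>"
    using coord_own_edge[of a b x] coord_own_edge[of a b y] assms ab by simp
  also have "\<bar>x b - y b\<bar> = (\<bar>x a - y a\<bar> + \<bar>x b - y b\<bar>) / 2"
    using cell_pointsD(3)[of x a b] cell_pointsD(3)[of y a b] assms ab by simp
  finally show ?thesis using ab by (simp add: segment_dist_def)
qed

text \<open>A segment inside one edge changes only the coordinate of that edge, so its length is its
\<open>l1\<close>-displacement.\<close>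

lemma l1_dist_le_broken_line: "broken_line E len x y l \<Longrightarrow> l1_dist x y \<le> l"
proof (induction rule: broken_line.induct)
  case (refl x)
  then show ?case by (simp add: l1_dist_def)
next
  case (step x y l e z)
  then show ?case using l1_dist_triangle[of x z y] l1_dist_cell[of e y z] by simp
qed

lemma broken_line_trans:
  assumes "broken_line E len y z m" "broken_line E len x y l"
  shows "broken_line E len x z (l + m)"
  using assms
proof (induction rule: broken_line.induct)
  case (refl x)
  then show ?case by simp
next
  case (step y' y m e z)
  then show ?case using broken_line.step[of E len x y "l + m" e z] by (simp add: add.assoc)
qed

lemma broken_line_sym: "broken_line E len x y l \<Longrightarrow> broken_line E len y x l"
proof (induction rule: broken_line.induct)
  case (refl x)
  then show ?case by (rule broken_line.refl)
next
  case (step x y l e z)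
  have "broken_line E len z y (0 + segment_dist len e z y)"
    using step by (intro broken_line.step broken_line.refl)
  moreover have "segment_dist len e z y = segment_dist len e y z"
    by (simp add: segment_dist_def abs_minus_commute)
  ultimately have "broken_line E len z y (segment_dist len e y z)" by simp
  from broken_line_trans[OF step(5) this] show ?case by (simp add: add.commute)
qed

text \<open>The two facts about a pair of points that are propagated together along paths: the \<open>l1\<close>-distance is
the length of an actual broken line, and that line contains points at every intermediate distance.\<close>

definition joined :: "('v \<Rightarrow> real) \<Rightarrow> ('v \<Rightarrow> real) \<Rightarrow> bool" where
  "joined x y \<longleftrightarrow> broken_line E len x y (l1_dist x y) \<and>
     (\<forall>s. 0 \<le> s \<longrightarrow> s \<le> l1_dist x y \<longrightarrow>
        (\<exists>z\<in>realization V E. l1_dist x z = s \<and> l1_dist z y = l1_dist x y - s))"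

lemma joined_sym:
  assumes "joined x y"
  shows "joined y x"
  unfolding joined_def
proof (intro conjI allI impI)
  show "broken_line E len y x (l1_dist y x)"
    using assms broken_line_sym l1_dist_sym[of x y] by (simp add: joined_def)
  fix s assume "0 \<le> s" "s \<le> l1_dist y x"
  then have "0 \<le> l1_dist x y - s" "l1_dist x y - s \<le> l1_dist x y" using l1_dist_sym[of x y] by auto
  then have "\<exists>z\<in>realization V E. l1_dist x z = l1_dist x y - s \<and> l1_dist z y = l1_dist x y - (l1_dist x y - s)"
    using assms unfolding joined_def by blast
  then obtain z where "z \<in> realization V E" "l1_dist x z = l1_dist x y - s" "l1_dist z y = s" by auto
  then show "\<exists>z\<in>realization V E. l1_dist y z = s \<and> l1_dist z x = l1_dist y x - s"
    using l1_dist_sym by (intro bexI[of _ z]) simp_all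
qed

lemma joined_trans:
  assumes xy: "joined x y" and yz: "joined y z" and add: "l1_dist x z = l1_dist x y + l1_dist y z"
  shows "joined x z"
  unfolding joined_def
proof (intro conjI allI impI)
  show "broken_line E len x z (l1_dist x z)"
    using broken_line_trans[of y z "l1_dist y z" x "l1_dist x y"] xy yz by (simp add: joined_def add)
  fix s assume s: "0 \<le> s" "s \<le> l1_dist x z"
  show "\<exists>w\<in>realization V E. l1_dist x w = s \<and> l1_dist w z = l1_dist x z - s"
  proof (cases "s \<le> l1_dist x y")
    case True
    then obtain w where w: "w \<in> realization V E" "l1_dist x w = s" "l1_dist w y = l1_dist x y - s"
      using xy s by (auto simp: joined_def)
    then show ?thesis
      using l1_dist_triangle[of w z y] l1_dist_triangle[of x z w] add by (intro bexI[of _ w]) auto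
  next
    case False
    then obtain w where w: "w \<in> realization V E" "l1_dist y w = s - l1_dist x y"
        "l1_dist w z = l1_dist y z - (s - l1_dist x y)"
      using yz s add unfolding joined_def
      by (smt (verit, best))
    then show ?thesis
      using l1_dist_triangle[of x w y] l1_dist_triangle[of x z w] add by (intro bexI[of _ w]) auto
  qed
qed

lemma joined_cell:
  assumes e: "e \<in> E" and x: "x \<in> cell_points e" and y: "y \<in> cell_points e"
  shows "joined x y"
  unfolding joined_def
proof (intro conjI allI impI)
  show "broken_line E len x y (l1_dist x y)"
    using broken_line.step[OF broken_line.refl e x y] l1_dist_cell[OF e x y] by simp
  fix s assume s: "0 \<le> s" "s \<le> l1_dist x y"
  define t where "t = s / l1_dist x y"
  have t: "0 \<le> t" "t \<le> 1" "t * l1_dist x y = s"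
    using s by (auto simp: t_def divide_le_eq_1)
  define z where "z v = (1 - t) * x v + t * y v" for v
  have z: "z \<in> cell_points e"
    using x y t unfolding cell_points_def z_def
    by (simp add: sum.distrib sum_distrib_left[symmetric])
  have cz: "coord g z = (1 - t) * coord g x + t * coord g y" for g
    by (simp add: coord_def z_def sum.distrib sum_distrib_left)
  have "coord g x - coord g z = t * (coord g x - coord g y)" for g by (simp add: cz algebra_simps)
  then have "l1_dist x z = t * l1_dist x y"
    using t by (simp add: l1_dist_def sum_distrib_left abs_mult mult_ac)
  moreover have "coord g z - coord g y = (1 - t) * (coord g x - coord g y)" for g by (simp add: cz algebra_simps)
  then have "l1_dist z y = (1 - t) * l1_dist x y"
    using t by (simp add: l1_dist_def sum_distrib_left abs_mult mult_ac)
  ultimately show "\<exists>w\<in>realization V E. l1_dist x w = s \<and> l1_dist w y = l1_dist x y - s"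
    using z t cell_in_realization[OF e] by (intro bexI[of _ z]) (auto simp: algebra_simps)
qed

lemma side_constant_on_path:
  assumes "rtrancl_path (\<lambda>x y. {x, y} \<in> E) z zs y" "x \<in> e" "x \<notin> set (z # zs)"
  shows "z \<in> side e \<longleftrightarrow> y \<in> side e"
  using assms
proof (induction rule: rtrancl_path.induct)
  case (base z)
  then show ?case by simp
next
  case (step z w ws y)
  then have "{z, w} \<noteq> e" by auto
  then show ?case using step side_other_edge[of z w e] by auto
qed

text \<open>On a path without repeated vertices each edge is crossed at most once, so no coordinate changes twice.\<close>

lemma joined_path:
  assumes "rtrancl_path (\<lambda>x y. {x, y} \<in> E) x xs y" "distinct (x # xs)" "x \<in> V"
  shows "joined (vertex x) (vertex y)"
  using assms
proof (induction rule: rtrancl_path.induct)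
  case (base x)
  have "broken_line E len (vertex x) (vertex x) 0" by (rule broken_line.refl)
  then show ?case
    using base l1_dist_nonneg vertex_in_realization[of x]
    by (auto simp: joined_def l1_dist_def intro!: bexI[of _ "vertex x"])
next
  case (step x z zs y)
  have z: "z \<in> V" using edge_in_V[OF step(1)] by simp
  have "joined (vertex x) (vertex z)"
    using step(1) by (intro joined_cell[of "{x, z}"] vertex_in_cell) auto
  moreover have "joined (vertex z) (vertex y)" using step z by auto
  moreover have "l1_dist (vertex x) (vertex y) = l1_dist (vertex x) (vertex z) + l1_dist (vertex z) (vertex y)"
  proof (rule l1_dist_additive)
    fix e assume "e \<in> E"
    show "coord e (vertex x) = coord e (vertex z) \<or> coord e (vertex z) = coord e (vertex y)"
    proof (cases "e = {x, z}")
      case True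
      then have "z \<in> side e \<longleftrightarrow> y \<in> side e"
        using side_constant_on_path[OF step(2), of x e] step(4) by auto
      then show ?thesis by (simp add: coord_vertex)
    next
      case False
      then show ?thesis using side_other_edge[OF step(1), of e] by (simp add: coord_vertex)
    qed
  qed
  ultimately show ?case by (rule joined_trans)
qed

lemma joined_vertices:
  assumes "v \<in> V" "w \<in> V"
  shows "joined (vertex v) (vertex w)"
proof -
  let ?r = "\<lambda>x y. {x, y} \<in> E"
  have "?r\<^sup>*\<^sup>* v w" using connected[OF assms] by (simp add: rtrancl_def adjacent_def)
  then obtain xs0 where "rtrancl_path ?r v xs0 w" by (auto simp: rtranclp_eq_rtrancl_path)
  then obtain xs where "rtrancl_path ?r v xs w" "distinct (v # xs)" by (rule rtrancl_path_distinct)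
  then show ?thesis using assms(1) by (rule joined_path)
qed

lemma joined_from_vertices:
  assumes y: "y \<in> realization V E" and joined: "\<And>v. v \<in> V \<Longrightarrow> joined (vertex v) y"
    and x: "x \<in> realization V E"
  shows "joined x y"
  using x
proof (cases rule: realization_cases)
  case (1 v)
  then show ?thesis using joined by simp
next
  case (2 e)
  obtain a b where ab: "a \<in> V" "b \<in> V" "a \<noteq> b" "e = {a, b}" "a \<notin> side e" "b \<in> side e"
    using oriented_edge[OF 2(1)] .
  show ?thesis
  proof (cases "y \<in> cell_points e")
    case True
    then show ?thesis using joined_cell 2 by blast
  next
    case False
    \<comment> \<open>outside its own edge a coordinate is \<open>0\<close> or \<open>1\<close>; the line leaves \<open>e\<close> through the end with that value\<close>
    have "coord e y = 0 \<or> coord e y = 1"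
      using y
    proof (cases rule: realization_cases)
      case (1 v)
      then show ?thesis by (simp add: coord_vertex)
    next
      case (2 g)
      then have ne: "g \<noteq> e" using False by auto
      obtain v where "v \<in> g" using edge_ends[OF 2(1)] by blast
      then show ?thesis using coord_other_edge[OF 2 ne] by auto
    qed
    then have "\<exists>c\<in>{a, b}. coord e (vertex c) = coord e y" using ab by (auto simp: coord_vertex)
    then obtain c where c: "c \<in> e" "c \<in> V" "coord e (vertex c) = coord e y" using ab by auto
    have cell: "vertex c \<in> cell_points e" using c ab by (intro vertex_in_cell) auto
    have "l1_dist x y = l1_dist x (vertex c) + l1_dist (vertex c) y"
    proof (rule l1_dist_additive)
      fix g assume "g \<in> E"
      show "coord g x = coord g (vertex c) \<or> coord g (vertex c) = coord g y"
        using coord_other_edge[OF 2 _ c(1), of g] c by (cases "e = g") (auto simp: coord_vertex)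
    qed
    then show ?thesis
      using joined_trans[OF joined_cell[OF 2 cell] joined[OF c(2)]] by blast
  qed
qed

lemma joined_realization:
  assumes "x \<in> realization V E" "y \<in> realization V E"
  shows "joined x y"
proof (rule joined_from_vertices[OF assms(2) _ assms(1)])
  fix v assume v: "v \<in> V"
  have "joined y (vertex v)"
    by (rule joined_from_vertices[OF vertex_in_realization[OF v] joined_vertices[OF _ v] assms(2)])
  then show "joined (vertex v) y" by (rule joined_sym)
qed

theorem path_dist_eq_l1_dist:
  assumes "x \<in> realization V E" "y \<in> realization V E"
  shows "path_dist E len x y = l1_dist x y"
  unfolding path_dist_def
proof (rule cInf_eq_minimum)
  show "l1_dist x y \<in> {l. broken_line E len x y l}"
    using joined_realization[OF assms] by (simp add: joined_def)
  fix l assume "l \<in> {l. broken_line E len x y l}"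
  then show "l1_dist x y \<le> l" by (simp add: l1_dist_le_broken_line)
qed

end

section \<open>Metric trees as subsets of a finite l1-product\<close>

text \<open>What the covering argument uses of a metric tree: an isometry to a subset of a weighted finite
\<open>l1\<close>-product whose coordinates are laminar, a root with all coordinates zero, geodesics and compactness.
The laminarity condition says that of two edges either no point lies beyond both, or one is fully crossed
before the other is entered.\<close>

locale tree_coordinates =
  fixes T :: "'a::metric_space set" and E :: "'e set" and len :: "'e \<Rightarrow> real"
    and f :: "'e \<Rightarrow> 'a \<Rightarrow> real" and \<rho> :: 'a
  assumes finite_E: "finite E" and len_pos: "e \<in> E \<Longrightarrow> 0 < len e"
    and root: "\<rho> \<in> T" "e \<in> E \<Longrightarrow> f e \<rho> = 0"
    and f_bounds: "e \<in> E \<Longrightarrow> x \<in> T \<Longrightarrow> 0 \<le> f e x" "e \<in> E \<Longrightarrow> x \<in> T \<Longrightarrow> f e x \<le> 1"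
    and dist_l1: "x \<in> T \<Longrightarrow> y \<in> T \<Longrightarrow> dist x y = (\<Sum>e\<in>E. len e * \<bar>f e x - f e y\<bar>)"
    and laminar: "e \<in> E \<Longrightarrow> e' \<in> E \<Longrightarrow> e \<noteq> e' \<Longrightarrow>
      (\<forall>x\<in>T. f e x = 0 \<or> f e' x = 0) \<or> (\<forall>x\<in>T. 0 < f e' x \<longrightarrow> f e x = 1) \<or>
      (\<forall>x\<in>T. 0 < f e x \<longrightarrow> f e' x = 1)"
    and geodesic: "x \<in> T \<Longrightarrow> y \<in> T \<Longrightarrow> 0 \<le> s \<Longrightarrow> s \<le> dist x y \<Longrightarrow>
      \<exists>z\<in>T. dist x z = s \<and> dist z y = dist x y - s"
    and compact_T: "compact T"
begin

text \<open>The Gromov product with respect to the root, that is, the depth of the branching point of \<open>x\<close>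
and \<open>y\<close>.\<close>

definition gromov :: "'a \<Rightarrow> 'a \<Rightarrow> real" where
  "gromov x y = (\<Sum>e\<in>E. len e * min (f e x) (f e y))"

lemma dist_root: "x \<in> T \<Longrightarrow> dist x \<rho> = (\<Sum>e\<in>E. len e * f e x)"
  using root f_bounds by (subst dist_l1) (auto intro!: sum.cong)

lemma gromov_eq:
  assumes "x \<in> T" "y \<in> T"
  shows "dist x y = dist x \<rho> + dist y \<rho> - 2 * gromov x y"
proof -
  have "dist x \<rho> + dist y \<rho> - 2 * gromov x y =
      (\<Sum>e\<in>E. len e * f e x + len e * f e y - 2 * (len e * min (f e x) (f e y)))"
    by (simp add: dist_root assms gromov_def sum.distrib sum_subtractf sum_distrib_left)
  also have "\<dots> = (\<Sum>e\<in>E. len e * \<bar>f e x - f e y\<bar>)"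
    by (intro sum.cong) (auto simp: min_def abs_if algebra_simps)
  finally show ?thesis using dist_l1 assms by simp
qed

lemma gromov_sym: "gromov x y = gromov y x"
  by (simp add: gromov_def min.commute)

text \<open>The branching points of \<open>x, y\<close> and of \<open>z, y\<close> both lie on the segment from the root to \<open>y\<close>.\<close>

lemma meets_comparable:
  assumes T: "x \<in> T" "y \<in> T" "z \<in> T"
  shows "(\<forall>e\<in>E. min (f e x) (f e y) \<le> min (f e z) (f e y)) \<or>
    (\<forall>e\<in>E. min (f e z) (f e y) \<le> min (f e x) (f e y))"
proof (rule ccontr)
  assume "\<not> ?thesis"
  then obtain e e' where e: "e \<in> E" "min (f e z) (f e y) < min (f e x) (f e y)"
    and e': "e' \<in> E" "min (f e' x) (f e' y) < min (f e' z) (f e' y)"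
    by (meson not_le)
  have ne: "e \<noteq> e'" using e e' by auto
  have pos: "0 < f e x" "0 < f e y" "0 < f e' z" "0 < f e' y"
    using e e' f_bounds T by (smt (verit))+
  have z: "f e z < 1" "f e' x < 1" using e e' f_bounds T by (smt (verit))+
  have y: "f e z < f e y" "f e' x < f e' y" using e e' by (smt (verit))+
  from laminar[OF e(1) e'(1) ne] show False
    using pos z T by fastforce
qed

lemma gromov_ultrametric:
  assumes T: "x \<in> T" "y \<in> T" "z \<in> T"
  shows "min (gromov x y) (gromov y z) \<le> gromov x z"
proof -
  have *: "(\<And>e. e \<in> E \<Longrightarrow> a e \<le> b e) \<Longrightarrow> (\<Sum>e\<in>E. len e * a e) \<le> (\<Sum>e\<in>E. len e * b e)" for a b
    using len_pos by (intro sum_mono mult_left_mono) (auto intro: less_imp_le)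
  from meets_comparable[OF T] show ?thesis
  proof
    assume "\<forall>e\<in>E. min (f e x) (f e y) \<le> min (f e z) (f e y)"
    then have "gromov x y \<le> gromov x z" unfolding gromov_def by (intro *) fastforce
    then show ?thesis by simp
  next
    assume "\<forall>e\<in>E. min (f e z) (f e y) \<le> min (f e x) (f e y)"
    then have "gromov y z \<le> gromov x z" unfolding gromov_def by (intro *) fastforce
    then show ?thesis by simp
  qed
qed

text \<open>Zero hyperbolicity, from the ultrametric inequality of the Gromov product.\<close>

lemma four_point:
  assumes T: "x \<in> T" "y \<in> T" "z \<in> T" "w \<in> T"
  shows "dist x y + dist z w \<le> max (dist x z + dist y w) (dist x w + dist y z)"
proof -
  have "min (gromov x z + gromov y w) (gromov x w + gromov y z) \<le> gromov x y + gromov z w"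
    using gromov_ultrametric[of x y z] gromov_ultrametric[of x z y] gromov_ultrametric[of y x z]
      gromov_ultrametric[of x y w] gromov_ultrametric[of x w y] gromov_ultrametric[of y x w]
      gromov_ultrametric[of x z w] gromov_ultrametric[of x w z] gromov_ultrametric[of z x w]
      gromov_ultrametric[of y z w] gromov_ultrametric[of y w z] gromov_ultrametric[of z y w] T
      gromov_sym[of y x] gromov_sym[of z x] gromov_sym[of w x] gromov_sym[of z y] gromov_sym[of w y]
      gromov_sym[of w z]
    by (smt (verit))
  then show ?thesis
    using gromov_eq[of x y] gromov_eq[of z w] gromov_eq[of x z] gromov_eq[of y w]
      gromov_eq[of x w] gromov_eq[of y z] T by (simp add: min_def max_def split: if_splits)
qed

text \<open>This is the greedy form of the incidence matrix. Among balls that contain \<open>p\<close>, the points no deeper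
than \<open>p\<close> that lie in a ball \<open>B(v, s)\<close> depend only on \<open>s - d(v, root)\<close> and increase with it. Two
four-point conditions with the root as fourth point suffice.\<close>

lemma ball_exchange:
  assumes T: "p \<in> T" "q \<in> T" "v \<in> T" "v' \<in> T"
    and deep: "dist q \<rho> \<le> dist p \<rho>" and key: "s - dist v \<rho> \<le> s' - dist v' \<rho>"
    and "dist p v \<le> s" "dist q v \<le> s" "dist p v' \<le> s'"
  shows "dist q v' \<le> s'"
proof -
  have "dist q v' + dist p \<rho> \<le> max (dist q p + dist v' \<rho>) (dist q \<rho> + dist v' p)"
    using four_point[of q v' p \<rho>] T root by simp
  moreover have "dist p q + dist v \<rho> \<le> max (dist p v + dist q \<rho>) (dist p \<rho> + dist q v)"
    using four_point[of p q v \<rho>] T root by simp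
  ultimately show ?thesis using assms(5-) by (simp add: dist_commute max_def split: if_splits)
qed

text \<open>The length of the subtree spanned by the root and \<open>U\<close>: of the edge \<open>e\<close> it contains the initial
fraction up to the furthest point of \<open>U\<close>. Inserting \<open>0\<close> makes the maximum meaningful for \<open>U = {}\<close>.\<close>

definition hull_length :: "'a set \<Rightarrow> real" where
  "hull_length U = (\<Sum>e\<in>E. len e * Max (insert 0 (f e ` U)))"

lemma hull_length_le:
  assumes "finite U" "U \<subseteq> T"
  shows "hull_length U \<le> (\<Sum>e\<in>E. len e)"
proof -
  have "len e * Max (insert 0 (f e ` U)) \<le> len e * 1" if "e \<in> E" for e
    using assms that f_bounds len_pos[OF that] by (intro mult_left_mono) auto
  then show ?thesis unfolding hull_length_def by (intro sum_mono) simp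
qed

text \<open>A point on a geodesic from \<open>p\<close> to the root: as its depth drops by exactly its distance to \<open>p\<close>, no
coordinate can increase on the way.\<close>

lemma point_above:
  assumes p: "p \<in> T" and r: "0 \<le> r" "r \<le> dist p \<rho>"
  obtains v where "v \<in> T" "dist p v = r" "\<And>e. e \<in> E \<Longrightarrow> f e v \<le> f e p"
proof -
  obtain v where v: "v \<in> T" "dist p v = r" "dist v \<rho> = dist p \<rho> - r"
    using geodesic[OF p root(1) r] by blast
  have "(\<Sum>e\<in>E. len e * (\<bar>f e p - f e v\<bar> - (f e p - f e v))) = dist p v - (dist p \<rho> - dist v \<rho>)"
    by (simp add: dist_root dist_l1 p v(1) sum_subtractf sum.distrib algebra_simps)
  also have "\<dots> = 0" using v by simp
  finally have "\<forall>e\<in>E. len e * (\<bar>f e p - f e v\<bar> - (f e p - f e v)) = 0"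
    using finite_E by (subst (asm) sum_nonneg_eq_0_iff) (auto simp: less_imp_le[OF len_pos])
  then have "f e v \<le> f e p" if "e \<in> E" for e using len_pos[OF that] that by force
  then show thesis using that v by blast
qed

text \<open>Centre the ball on the segment from the root to a deepest point \<open>p\<close>, at distance \<open>r\<close> from \<open>p\<close>. It then
contains every point of \<open>U\<close> above its centre \<open>v\<close>, so the segment from \<open>v\<close> to \<open>p\<close>, of length \<open>r\<close>,
disappears from the hull of the remaining points.\<close>

lemma remove_deep_ball:
  assumes U: "finite U" "U \<subseteq> T" and r: "0 \<le> r"
  obtains v where "v \<in> T"
    "{u\<in>U. r < dist u v} = {} \<or> hull_length {u\<in>U. r < dist u v} \<le> hull_length U - r"
proof (cases "U = {}")
  case True
  then show thesis using that[of \<rho>] root by simp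
next
  case False
  obtain p where p: "p \<in> U" "\<And>u. u \<in> U \<Longrightarrow> dist u \<rho> \<le> dist p \<rho>"
  proof -
    have "Max ((\<lambda>u. dist u \<rho>) ` U) \<in> (\<lambda>u. dist u \<rho>) ` U" using U False by (intro Max_in) auto
    then obtain p where "p \<in> U" "dist p \<rho> = Max ((\<lambda>u. dist u \<rho>) ` U)" by auto
    then show thesis using U by (intro that[of p]) auto
  qed
  have pT: "p \<in> T" using p U by auto
  show thesis
  proof (cases "r \<le> dist p \<rho>")
    case False
    then have "{u\<in>U. r < dist u \<rho>} = {}" using p by force
    then show thesis using that[of \<rho>] root by simp
  next
    case True
    obtain v where v: "v \<in> T" "dist p v = r" "\<And>e. e \<in> E \<Longrightarrow> f e v \<le> f e p"
      using point_above[OF pT r True] by metis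
    define U' where "U' = {u\<in>U. r < dist u v}"
    have U': "finite U'" "U' \<subseteq> T" "U' \<subseteq> U" using U by (auto simp: U'_def)
    have above: "dist u v = dist u \<rho> - dist v \<rho>" if "u \<in> T" "\<And>e. e \<in> E \<Longrightarrow> f e v \<le> f e u" for u
    proof -
      have "dist u v = (\<Sum>e\<in>E. len e * (f e u - f e v))"
        using that v(1) by (subst dist_l1) (auto intro!: sum.cong)
      then show ?thesis by (simp add: dist_root that(1) v(1) algebra_simps sum_subtractf)
    qed
    have pv: "r = dist p \<rho> - dist v \<rho>" using above[OF pT v(3)] v(2) by simp
    have not_above: "\<exists>e\<in>E. f e u < f e v" if "u \<in> U'" for u
    proof (rule ccontr)
      assume "\<not> ?thesis"
      then have "dist u v = dist u \<rho> - dist v \<rho>" using above[of u] that U' by force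
      then have "dist u v \<le> r" using pv p(2)[of u] that U' by auto
      then show False using that by (simp add: U'_def)
    qed
    \<comment> \<open>a remaining point does not reach beyond \<open>v\<close> on any edge of the segment from \<open>v\<close> to \<open>p\<close>\<close>
    have low: "f e u \<le> f e v" if u: "u \<in> U'" and e: "e \<in> E" and less: "f e v < f e p" for u e
    proof (rule ccontr)
      assume gt: "\<not> f e u \<le> f e v"
      obtain e' where e': "e' \<in> E" "f e' u < f e' v" using not_above[OF u] by blast
      have ne: "e' \<noteq> e" using gt e' by auto
      have uT: "u \<in> T" using u U' by auto
      have "0 < f e p" "0 < f e' p" "0 < f e' v" "0 < f e u" "f e' u < 1" "f e v < 1"
        using f_bounds[OF e v(1)] f_bounds[OF e pT] f_bounds[OF e'(1) uT] f_bounds[OF e'(1) v(1)]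
          e' gt less v(3)[OF e'(1)] by auto
      then show False using laminar[OF e'(1) e ne] pT uT v(1) by fastforce
    qed
    define m where "m e A = Max (insert 0 (f e ` A))" for e A
    have m_ge: "f e u \<le> m e A" if "finite A" "u \<in> A" for e u A
      unfolding m_def using that by (intro Max_ge) auto
    have m_le: "m e U' \<le> m e U - (f e p - f e v)" if e: "e \<in> E" for e
    proof (cases "f e v < f e p")
      case True
      have "m e U' \<le> f e v"
        unfolding m_def using low[OF _ e True] f_bounds(1)[OF e v(1)] U'(1) by auto
      then show ?thesis using m_ge[OF U(1) p(1), of e] by simp
    next
      case False
      then have "f e v = f e p" using v(3)[OF e] by simp
      moreover have "m e U' \<le> m e U" unfolding m_def using U U' by (intro Max_mono) auto
      ultimately show ?thesis by simp
    qed
    have "hull_length U' \<le> (\<Sum>e\<in>E. len e * (m e U - (f e p - f e v)))"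
      unfolding hull_length_def m_def[symmetric]
      by (intro sum_mono mult_left_mono m_le less_imp_le[OF len_pos])
    also have "\<dots> = hull_length U - r"
      by (simp add: hull_length_def m_def[symmetric] pv dist_root pT v(1) algebra_simps sum_subtractf sum.distrib)
    finally show thesis using that[OF v(1)] unfolding U'_def by blast
  qed
qed

text \<open>The midpoint of a diameter of \<open>U\<close> is at most half the diameter away from all of \<open>U\<close>, by the four-point
condition, and the diameter is at most the length of the hull.\<close>

lemma half_length_ball:
  assumes U: "finite U" "U \<subseteq> T" "U \<noteq> {}" and r: "hull_length U \<le> 2 * r"
  obtains c where "c \<in> T" "\<And>u. u \<in> U \<Longrightarrow> dist u c \<le> r"
proof -
  have "Max (case_prod dist ` (U \<times> U)) \<in> case_prod dist ` (U \<times> U)" using U by (intro Max_in) auto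
  then obtain p q where pq: "p \<in> U" "q \<in> U" "dist p q = Max (case_prod dist ` (U \<times> U))" by auto
  have diam: "dist u u' \<le> dist p q" if "u \<in> U" "u' \<in> U" for u u'
    unfolding pq(3) using U that by (intro Max_ge) auto
  have T: "p \<in> T" "q \<in> T" using pq U by auto
  obtain c where c: "c \<in> T" "dist p c = dist p q / 2" "dist c q = dist p q / 2"
    using geodesic[OF T, of "dist p q / 2"] by auto
  have "dist p q \<le> hull_length U"
    unfolding dist_l1[OF T] hull_length_def
  proof (intro sum_mono mult_left_mono less_imp_le[OF len_pos])
    fix e assume e: "e \<in> E"
    have "f e p \<le> Max (insert 0 (f e ` U))" "f e q \<le> Max (insert 0 (f e ` U))"
      using U pq by (intro Max_ge; simp)+
    then show "\<bar>f e p - f e q\<bar> \<le> Max (insert 0 (f e ` U))"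
      using f_bounds(1)[OF e T(1)] f_bounds(1)[OF e T(2)] by simp
  qed
  have "dist u c \<le> r" if u: "u \<in> U" for u
  proof -
    have "dist u c + dist p q \<le> max (dist u p + dist c q) (dist u q + dist c p)"
      using four_point[of u c p q] u U(2) T c by auto
    then show ?thesis
      using diam[OF u pq(1)] diam[OF u pq(2)] c \<open>dist p q \<le> hull_length U\<close> r
      by (simp add: dist_commute max_def split: if_splits)
  qed
  then show thesis using that c by blast
qed

text \<open>All balls but one are spent on removing length; the last one covers what is left, and for this its
radius counts twice.\<close>

lemma long_radii_cover:
  assumes "finite J" "j \<notin> J" "\<And>i. i \<in> insert j J \<Longrightarrow> 0 \<le> r i"
    and "finite U" "U \<subseteq> T" and "hull_length U \<le> (\<Sum>i\<in>J. r i) + 2 * r j"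
  shows "\<exists>c. (\<forall>i. c i \<in> T) \<and> (\<forall>u\<in>U. \<exists>i\<in>insert j J. dist u (c i) \<le> r i)"
  using assms
proof (induction J arbitrary: U rule: finite_induct)
  case empty
  show ?case
  proof (cases "U = {}")
    case True
    then show ?thesis using root by (intro exI[of _ "\<lambda>_. \<rho>"]) auto
  next
    case False
    obtain c where "c \<in> T" "\<And>u. u \<in> U \<Longrightarrow> dist u c \<le> r j"
      using half_length_ball[of U "r j"] empty False by auto
    then show ?thesis by (intro exI[of _ "\<lambda>_. c"]) auto
  qed
next
  case (insert x J)
  obtain v where v: "v \<in> T"
    "{u\<in>U. r x < dist u v} = {} \<or> hull_length {u\<in>U. r x < dist u v} \<le> hull_length U - r x"
    using remove_deep_ball[of U "r x"] insert.prems by auto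
  show ?case
  proof (cases "{u\<in>U. r x < dist u v} = {}")
    case True
    then have "\<forall>u\<in>U. dist u v \<le> r x" by force
    then show ?thesis using v by (intro exI[of _ "\<lambda>_. v"]) auto
  next
    case False
    then have "hull_length {u\<in>U. r x < dist u v} \<le> (\<Sum>i\<in>J. r i) + 2 * r j"
    proof -
      have "hull_length {u\<in>U. r x < dist u v} \<le> hull_length U - r x" using v(2) False by blast
      moreover have "(\<Sum>i\<in>insert x J. r i) = r x + (\<Sum>i\<in>J. r i)" using insert.hyps by simp
      ultimately show ?thesis using insert.prems(5) by simp
    qed
    then obtain c where c: "\<forall>i. c i \<in> T" "\<forall>u\<in>{u\<in>U. r x < dist u v}. \<exists>i\<in>insert j J. dist u (c i) \<le> r i"
      using insert.IH[of "{u\<in>U. r x < dist u v}"] insert.prems by auto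
    define c' where "c' = c(x := v)"
    have "\<exists>i\<in>insert j (insert x J). dist u (c' i) \<le> r i" if u: "u \<in> U" for u
    proof (cases "dist u v \<le> r x")
      case True
      then show ?thesis by (intro bexI[of _ x]) (auto simp: c'_def)
    next
      case False
      then obtain i where i: "i \<in> insert j J" "dist u (c i) \<le> r i" using c(2) u by force
      then have "i \<noteq> x" using insert by auto
      then show ?thesis using i by (intro bexI[of _ i]) (auto simp: c'_def)
    qed
    then show ?thesis using c v by (intro exI[of _ c']) (auto simp: c'_def)
  qed
qed

text \<open>Take a set of balls of minimal size that still covers after recentring. If it has at least two balls
and \<open>r\<^sub>i\<close> is the smallest radius, then \<open>r\<^sub>i + r\<^sub>j \<le> 2 r\<^sub>j\<close> for any other ball \<open>j\<close>. When the radii add up to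
more than the total length, the hypothesis of \<open>long_radii_cover\<close> therefore holds without the ball \<open>i\<close>,
contradicting minimality.\<close>

theorem short_subcover:
  fixes r :: "'i \<Rightarrow> real"
  assumes I: "finite I" "\<And>i. i \<in> I \<Longrightarrow> 0 \<le> r i" and P: "finite P" "P \<subseteq> T" "P \<noteq> {}"
    and c: "\<And>i. c i \<in> T" "\<And>p. p \<in> P \<Longrightarrow> \<exists>i\<in>I. dist p (c i) \<le> r i"
  obtains J c' where "J \<subseteq> I" "J \<noteq> {}" "\<And>i. c' i \<in> T" "\<And>p. p \<in> P \<Longrightarrow> \<exists>i\<in>J. dist p (c' i) \<le> r i"
    "(\<Sum>i\<in>J. r i) \<le> (\<Sum>e\<in>E. len e) \<or> card J = 1"
proof -
  define ok where "ok J \<longleftrightarrow> J \<subseteq> I \<and> (\<exists>c'. (\<forall>i. c' i \<in> T) \<and> (\<forall>p\<in>P. \<exists>i\<in>J. dist p (c' i) \<le> r i))" for J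
  have "ok I" using c by (auto simp: ok_def)
  then obtain J where J: "ok J" and min: "\<And>J'. ok J' \<Longrightarrow> card J \<le> card J'"
    using ex_has_least_nat[of ok I card] by blast
  have JI: "J \<subseteq> I" using J by (simp add: ok_def)
  then have finJ: "finite J" using I finite_subset by blast
  have ne: "J \<noteq> {}" using J P by (auto simp: ok_def)
  have "(\<Sum>i\<in>J. r i) \<le> (\<Sum>e\<in>E. len e) \<or> card J = 1"
  proof (rule ccontr)
    assume "\<not> ?thesis"
    then have long: "(\<Sum>e\<in>E. len e) < (\<Sum>i\<in>J. r i)" and "card J \<noteq> 1" by auto
    have "Min (r ` J) \<in> r ` J" using finJ ne by (intro Min_in) auto
    then obtain i where i: "i \<in> J" "r i = Min (r ` J)" by auto
    have "J - {i} \<noteq> {}" using \<open>card J \<noteq> 1\<close> i by (auto simp: card_Suc_eq dest!: subset_singletonD)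
    then obtain j where j: "j \<in> J" "j \<noteq> i" by blast
    have rij: "r i \<le> r j" unfolding i(2) using finJ j by (intro Min_le) auto
    define J0 where "J0 = J - {i, j}"
    have J0: "finite J0" "j \<notin> J0" "i \<notin> J0" "J = insert i (insert j J0)" using i j finJ by (auto simp: J0_def)
    have "(\<Sum>i\<in>J. r i) = r i + (r j + (\<Sum>k\<in>J0. r k))" unfolding J0(4) using J0(1-3) j by simp
    then have "hull_length P \<le> (\<Sum>k\<in>J0. r k) + 2 * r j" using hull_length_le[OF P(1,2)] long rij by simp
    then have "\<exists>c. (\<forall>i. c i \<in> T) \<and> (\<forall>u\<in>P. \<exists>i\<in>insert j J0. dist u (c i) \<le> r i)"
      using J0 JI I(2) P by (intro long_radii_cover) auto
    moreover have "insert j J0 \<subseteq> I" using J0 JI by auto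
    ultimately have "ok (insert j J0)" unfolding ok_def by blast
    then have "card J \<le> card (insert j J0)" by (rule min)
    then show False using J0 j by auto
  qed
  then show thesis using J ne that unfolding ok_def by metis
qed

lemma finite_net:
  assumes "0 < \<delta>"
  obtains P where "finite P" "P \<subseteq> T" "P \<noteq> {}" "\<And>x. x \<in> T \<Longrightarrow> \<exists>p\<in>P. dist x p < \<delta>"
proof -
  obtain P where P: "finite P" "P \<subseteq> T" "T \<subseteq> (\<Union>x\<in>P. ball x \<delta>)"
    using seq_compact_imp_totally_bounded[of T] compact_T assms compact_imp_seq_compact by blast
  have "\<exists>p\<in>P. dist x p < \<delta>" if "x \<in> T" for x
  proof -
    obtain p where "p \<in> P" "x \<in> ball p \<delta>" using P(3) \<open>x \<in> T\<close> by blast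
    then show ?thesis by (intro bexI[of _ p]) (auto simp: dist_commute)
  qed
  moreover have "P \<noteq> {}" using P(3) root by auto
  ultimately show thesis using that P by blast
qed

end

lemma (in rooted_tree) cell_parametrization:
  assumes "a \<noteq> b"
  shows "cell_points {a, b} = (\<lambda>t v. (1 - t) * vertex a v + t * vertex b v) ` {0..1}"
proof (intro set_eqI iffI)
  fix x :: "'v \<Rightarrow> real" assume x: "x \<in> cell_points {a, b}"
  note D = cell_pointsD[OF x assms]
  have "x = (\<lambda>v. (1 - x b) * vertex a v + x b * vertex b v)"
    using D assms by (auto simp: vertex_def fun_eq_iff)
  then show "x \<in> (\<lambda>t v. (1 - t) * vertex a v + t * vertex b v) ` {0..1}" using D by (intro image_eqI[of _ _ "x b"]) auto
qed (use assms in \<open>auto simp: cell_points_def vertex_def\<close>)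

text \<open>The coordinates are pulled back along the isometry. Each edge is the image of an interval under a Lipschitz map,
so the tree is a finite union of compact sets.\<close>

theorem finite_metric_tree_coordinates:
  assumes "finite_metric_tree V E len T"
  obtains f \<rho> where "tree_coordinates T E len f \<rho>"
proof -
  have ft: "finite_tree V E" and len: "\<And>e. e \<in> E \<Longrightarrow> 0 < len e" using assms by (auto simp: finite_metric_tree_def)
  obtain \<phi> where \<phi>: "bij_betw \<phi> (realization V E) T"
    "\<And>x y. x \<in> realization V E \<Longrightarrow> y \<in> realization V E \<Longrightarrow> dist (\<phi> x) (\<phi> y) = path_dist E len x y"
    using assms by (auto simp: finite_metric_tree_def)
  obtain root where root: "root \<in> V" using ft by (auto simp: finite_tree_def)
  interpret weighted_tree V E root len by unfold_locales (use ft root len in auto)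
  define \<psi> where "\<psi> = inv_into (realization V E) \<phi>"
  have \<psi>: "\<psi> p \<in> realization V E" "\<phi> (\<psi> p) = p" if "p \<in> T" for p
    using \<phi>(1) that unfolding \<psi>_def by (auto simp: bij_betw_def intro: inv_into_into f_inv_into_f)
  have \<phi>T: "\<phi> x \<in> T" if "x \<in> realization V E" for x using \<phi>(1) that by (auto simp: bij_betw_def)
  have \<psi>\<phi>: "\<psi> (\<phi> x) = x" if "x \<in> realization V E" for x
    using \<phi>(1) that unfolding \<psi>_def by (simp add: bij_betw_def)
  have d: "dist p q = l1_dist (\<psi> p) (\<psi> q)" if "p \<in> T" "q \<in> T" for p q
    using \<phi>(2)[of "\<psi> p" "\<psi> q"] path_dist_eq_l1_dist \<psi> that by simp
  have d\<phi>: "dist (\<phi> x) (\<phi> y) = l1_dist x y" if "x \<in> realization V E" "y \<in> realization V E" for x y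
    using d[of "\<phi> x" "\<phi> y"] \<phi>T \<psi>\<phi> that by simp
  have compact: "compact T"
  proof -
    have cell: "compact (\<phi> ` cell_points e)" if e: "e \<in> E" for e
    proof -
      obtain a b where ab: "a \<noteq> b" "e = {a, b}" using edge_ends[OF e] by blast
      define \<gamma> where "\<gamma> t = (\<lambda>v. (1 - t) * vertex a v + t * vertex b v)" for t
      have cell: "cell_points e = \<gamma> ` {0..1}" unfolding ab(2) \<gamma>_def by (rule cell_parametrization[OF ab(1)])
      have "dist (\<phi> (\<gamma> s)) (\<phi> (\<gamma> t)) \<le> len e * dist s t" if "s \<in> {0..1}" "t \<in> {0..1}" for s t
      proof -
        have st: "\<gamma> s \<in> cell_points e" "\<gamma> t \<in> cell_points e" using that cell by auto
        have "dist (\<phi> (\<gamma> s)) (\<phi> (\<gamma> t)) = segment_dist len e (\<gamma> s) (\<gamma> t)"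
          using d\<phi> l1_dist_cell[OF e st] cell_in_realization[OF e] st by simp
        also have "\<dots> = len e * \<bar>s - t\<bar>" using ab
          by (simp add: segment_dist_def \<gamma>_def vertex_def abs_minus_commute)
        finally show ?thesis by (simp add: dist_real_def)
      qed
      then have "(len e)-lipschitz_on {0..1} (\<lambda>t. \<phi> (\<gamma> t))"
        using len[OF e] by (intro lipschitz_onI) auto
      then have "continuous_on {0..1} (\<lambda>t. \<phi> (\<gamma> t))" by (rule lipschitz_on_continuous_on)
      then have "compact ((\<lambda>t. \<phi> (\<gamma> t)) ` {0..1})" by (intro compact_continuous_image) auto
      then show ?thesis by (simp add: cell image_image)
    qed
    have "T = \<phi> ` realization V E" using \<phi>(1) by (simp add: bij_betw_def)
    also have "\<dots> = (\<Union>v\<in>V. {\<phi> (vertex v)}) \<union> (\<Union>e\<in>E. \<phi> ` cell_points e)"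
      by (auto simp: realization_def cell_singleton)
    also have "compact \<dots>" using finite_V finite_E cell by (intro compact_Un compact_UN) auto
    finally show ?thesis .
  qed
  have "tree_coordinates T E len (\<lambda>e p. coord e (\<psi> p)) (\<phi> (vertex root))"
  proof
    fix e x assume "e \<in> E" "x \<in> T"
    then show "0 \<le> coord e (\<psi> x)" "coord e (\<psi> x) \<le> 1" using coord_bounds \<psi> by auto
  next
    fix e e' assume E: "e \<in> E" "e' \<in> E" "e \<noteq> e'"
    show "(\<forall>x\<in>T. coord e (\<psi> x) = 0 \<or> coord e' (\<psi> x) = 0) \<or>
       (\<forall>x\<in>T. 0 < coord e' (\<psi> x) \<longrightarrow> coord e (\<psi> x) = 1) \<or>
       (\<forall>x\<in>T. 0 < coord e (\<psi> x) \<longrightarrow> coord e' (\<psi> x) = 1)"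
    proof -
      consider "side e \<inter> side e' = {}" | "side e \<subseteq> side e'" | "side e' \<subseteq> side e"
        using sides_laminar[OF E] by blast
      then show ?thesis
      proof cases
        case 1
        have "coord e (\<psi> x) = 0 \<or> coord e' (\<psi> x) = 0" if "x \<in> T" for x
          using coord_disjoint[OF E 1 \<psi>(1)[OF that]] coord_bounds(1)[OF \<psi>(1)[OF that], of e] by fastforce
        then show ?thesis by blast
      next
        case 2
        then show ?thesis using coord_nested[OF E(2,1)] E(3) \<psi>(1) by blast
      next
        case 3
        then show ?thesis using coord_nested[OF E] \<psi>(1) by blast
      qed
    qed
  next
    fix x y s assume xy: "x \<in> T" "y \<in> T" and s: "0 \<le> s" "s \<le> dist x y"
    have "joined (\<psi> x) (\<psi> y)" using xy \<psi> by (intro joined_realization) auto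
    then obtain z where "z \<in> realization V E" "l1_dist (\<psi> x) z = s" "l1_dist z (\<psi> y) = dist x y - s"
      using s d[OF xy] by (auto simp: joined_def)
    then show "\<exists>z\<in>T. dist x z = s \<and> dist z y = dist x y - s"
      using d xy \<phi>T \<psi>\<phi> by (intro bexI[of _ "\<phi> z"]) auto
  qed (use finite_E len root compact \<phi>T \<psi>\<phi> vertex_in_realization coord_root d in
      \<open>auto simp: l1_dist_def\<close>)
  then show thesis by (rule that)
qed

section \<open>Weak compactness on a disjoint union of compact sets\<close>

text \<open>Up to a factor, the point of the Cantor set with the given digits. Digits \<open>0\<close> and \<open>1\<close> in base three
keep different digit sequences apart quantitatively.\<close>

definition ternary :: "(nat \<Rightarrow> bool) \<Rightarrow> real" where
  "ternary D = (\<Sum>j. of_bool (D j) * (1/3) ^ j)"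

lemma summable_ternary: "summable (\<lambda>j. of_bool (D j) * (1/3::real) ^ j)"
  by (rule summable_comparison_test[of _ "\<lambda>j. (1/3::real) ^ j"])
    (auto intro!: exI[of _ 0] summable_geometric)

lemma ternary_bounds: "0 \<le> ternary D" "ternary D \<le> 3 / 2"
proof -
  show "0 \<le> ternary D" unfolding ternary_def by (intro suminf_nonneg summable_ternary) auto
  have "ternary D \<le> (\<Sum>j. (1/3) ^ j)"
    unfolding ternary_def by (intro suminf_le summable_ternary summable_geometric) auto
  then show "ternary D \<le> 3 / 2" by (simp add: suminf_geometric)
qed

lemma ternary_split:
  "ternary D = (\<Sum>i<n. of_bool (D i) * (1/3) ^ i) + (1/3) ^ n * ternary (\<lambda>i. D (i + n))"
proof -
  have "ternary D = (\<Sum>i. of_bool (D (i + n)) * (1/3) ^ (i + n)) + (\<Sum>i<n. of_bool (D i) * (1/3) ^ i)"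
    unfolding ternary_def by (rule suminf_split_initial_segment[OF summable_ternary])
  also have "(\<Sum>i. of_bool (D (i + n)) * (1/3::real) ^ (i + n)) =
      (\<Sum>i. (1/3) ^ n * (of_bool (D (i + n)) * (1/3) ^ i))"
    by (simp add: power_add mult_ac)
  also have "\<dots> = (1/3) ^ n * ternary (\<lambda>i. D (i + n))"
    unfolding ternary_def by (rule suminf_mult[OF summable_ternary])
  finally show ?thesis by simp
qed

lemma ternary_separates:
  assumes close: "\<bar>ternary D - ternary D'\<bar> < (1/3) ^ J / 2" and j: "j \<le> J"
  shows "D j = D' j"
proof (rule ccontr)
  assume ne: "D j \<noteq> D' j"
  define i where "i = (LEAST i. D i \<noteq> D' i)"
  have i: "D i \<noteq> D' i" unfolding i_def by (rule LeastI[of _ j]) (rule ne)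
  have less: "D k = D' k" if "k < i" for k
    using not_less_Least[of k "\<lambda>i. D i \<noteq> D' i"] that unfolding i_def by auto
  have ij: "i \<le> J" using Least_le[of "\<lambda>i. D i \<noteq> D' i" j] ne j unfolding i_def by auto
  define a b where "a = ternary (\<lambda>k. D (k + Suc i))" and "b = ternary (\<lambda>k. D' (k + Suc i))"
  have ab: "0 \<le> a" "a \<le> 3/2" "0 \<le> b" "b \<le> 3/2"
    unfolding a_def b_def using ternary_bounds by auto
  define p where "p = (\<Sum>k<i. of_bool (D k) * (1/3::real) ^ k)"
  have p: "p = (\<Sum>k<i. of_bool (D' k) * (1/3::real) ^ k)"
    unfolding p_def by (intro sum.cong) (auto simp: less)
  have "ternary D = p + of_bool (D i) * (1/3) ^ i + (1/3) ^ i * (a / 3)"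
    unfolding p_def a_def by (subst ternary_split[of D "Suc i"]) simp
  moreover have "ternary D' = p + of_bool (D' i) * (1/3) ^ i + (1/3) ^ i * (b / 3)"
    unfolding p b_def by (subst ternary_split[of D' "Suc i"]) simp
  ultimately have "ternary D - ternary D' = (1/3) ^ i * (of_bool (D i) - of_bool (D' i) + (a - b) / 3)"
    by (simp add: algebra_simps diff_divide_distrib)
  then have "\<bar>ternary D - ternary D'\<bar> = (1/3) ^ i * \<bar>of_bool (D i) - of_bool (D' i) + (a - b) / 3\<bar>"
    by (simp add: abs_mult)
  also have "\<dots> \<ge> (1/3) ^ i * (1 / 2)"
  proof (rule mult_left_mono)
    show "1 / 2 \<le> \<bar>of_bool (D i) - of_bool (D' i) + (a - b) / 3\<bar>"
      using i ab by (cases "D i"; cases "D' i") (simp_all add: abs_if field_simps)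
  qed simp
  finally have "(1/3) ^ i / 2 \<le> \<bar>ternary D - ternary D'\<bar>" by simp
  moreover have "(1/3::real) ^ J \<le> (1/3) ^ i" using ij by (intro power_decreasing) auto
  ultimately show False using close by simp
qed

text \<open>Enumerate the balls of finite nets of all the sets \<open>K k\<close>; finitely many membership bits then
determine a point of \<open>K k\<close> up to a given error.\<close>

lemma exists_separating_sequence:
  fixes K :: "nat \<Rightarrow> 'b::metric_space set"
  assumes comp: "\<And>k. compact (K k)"
  obtains U :: "nat \<Rightarrow> 'b set" where "\<And>j. open (U j)"
    "\<And>k \<epsilon>. 0 < \<epsilon> \<Longrightarrow> \<exists>J. \<forall>x\<in>K k. \<forall>y\<in>K k. (\<forall>j\<le>J. x \<in> U j \<longleftrightarrow> y \<in> U j) \<longrightarrow> dist x y < \<epsilon>"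
proof -
  have "\<exists>F. finite F \<and> K k \<subseteq> (\<Union>z\<in>F. ball z (1 / Suc n))" for k n
    using comp[of k] unfolding compact_eq_totally_bounded by auto
  then obtain F where F: "\<And>k n. finite (F k n)" "\<And>k n. K k \<subseteq> (\<Union>z\<in>F k n. ball z (1 / Suc n))"
    by metis
  define B where "B = insert UNIV (\<Union>k n. (\<lambda>z. ball z (1 / Suc n)) ` F k n)"
  have B: "countable B" "B \<noteq> {}"
    unfolding B_def
    by (intro countable_insert countable_UN[OF countableI_type] countable_image countable_finite F(1)) simp
  define U where "U = from_nat_into B"
  have U: "range U = B" unfolding U_def using B by (intro range_from_nat_into) auto
  have "open (U j)" for j
  proof -
    have "U j \<in> B" using U by auto
    then show ?thesis by (auto simp: B_def)
  qed
  moreover have "\<exists>J. \<forall>x\<in>K k. \<forall>y\<in>K k. (\<forall>j\<le>J. x \<in> U j \<longleftrightarrow> y \<in> U j) \<longrightarrow> dist x y < \<epsilon>" if "0 < \<epsilon>" for k \<epsilon>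
  proof -
    obtain n where n: "1 / Suc n < \<epsilon> / 2" using nat_approx_posE[OF half_gt_zero[OF \<open>0 < \<epsilon>\<close>]] by blast
    have "\<exists>j. U j = ball z (1 / Suc n)" if "z \<in> F k n" for z
    proof -
      have "ball z (1 / Suc n) \<in> B" using that unfolding B_def by blast
      then show ?thesis using U by (metis imageE)
    qed
    then obtain ix where ix: "\<And>z. z \<in> F k n \<Longrightarrow> U (ix z) = ball z (1 / Suc n)" by metis
    define J where "J = Max (insert 0 (ix ` F k n))"
    have J: "ix z \<le> J" if "z \<in> F k n" for z
      unfolding J_def using that F(1) by (intro Max_ge) auto
    show ?thesis
    proof (intro exI[of _ J] ballI impI)
      fix x y assume x: "x \<in> K k" and y: "y \<in> K k" and *: "\<forall>j\<le>J. x \<in> U j \<longleftrightarrow> y \<in> U j"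
      obtain z where z: "z \<in> F k n" "x \<in> ball z (1 / Suc n)" using F(2) x by blast
      then have "y \<in> ball z (1 / Suc n)" using * J[OF z(1)] ix[OF z(1)] by blast
      then show "dist x y < \<epsilon>" using z n dist_triangle_half_r[of z x \<epsilon> y] by (auto simp: mem_ball)
    qed
  qed
  ultimately show thesis by (rule that)
qed

text \<open>A real code whose inverse is uniformly continuous on each level. The index of the level is carried by
an even integer: the ternary part ranges over an interval of length \<open>3 / 2\<close>, which leaves gaps of
length \<open>1 / 2\<close> between levels.\<close>

lemma exists_real_coding:
  fixes X :: "(nat \<times> 'b::metric_space) set"
  assumes comp: "\<And>k. compact {x\<in>X. fst x = k}"
  obtains c :: "nat \<times> 'b \<Rightarrow> real" where "c \<in> borel_measurable borel"
    "\<And>x. 0 \<le> c x" "\<And>x. c x \<le> 2 * real (fst x) + 2"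
    "\<And>x y. \<bar>c x - c y\<bar> < 1 / 2 \<Longrightarrow> fst y = fst x"
    "\<And>k \<epsilon>. 0 < \<epsilon> \<Longrightarrow> \<exists>\<eta>>0. \<forall>x\<in>X. \<forall>y\<in>X. fst x = k \<longrightarrow> \<bar>c x - c y\<bar> < \<eta> \<longrightarrow>
      fst y = fst x \<and> dist (snd x) (snd y) < \<epsilon>"
proof -
  have comp': "compact (snd ` {x\<in>X. fst x = k})" for k
    by (intro compact_continuous_image comp continuous_intros)
  obtain U :: "nat \<Rightarrow> 'b set" where U: "\<And>j. open (U j)" and sep:
    "\<And>k \<epsilon>. 0 < \<epsilon> \<Longrightarrow> \<exists>J. \<forall>x\<in>snd ` {x\<in>X. fst x = k}. \<forall>y\<in>snd ` {x\<in>X. fst x = k}. (\<forall>j\<le>J. x \<in> U j \<longleftrightarrow> y \<in> U j) \<longrightarrow> dist x y < \<epsilon>"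
  proof (rule exists_separating_sequence[of "\<lambda>k. snd ` {x\<in>X. fst x = k}", OF comp'], goal_cases)
    case 1
    from 1(2-) show ?case by (rule 1(1))
  qed
  define c where "c x = 2 * real (fst x) + ternary (\<lambda>j. snd x \<in> U j)" for x :: "nat \<times> 'b"
  have "(\<lambda>x. ternary (\<lambda>j. snd x \<in> U j)) \<in> borel_measurable (borel :: (nat \<times> 'b) measure)"
  proof -
    have "(\<lambda>x. of_bool (snd x \<in> U j) * (1/3) ^ j :: real) \<in> borel_measurable (borel :: (nat \<times> 'b) measure)" for j
    proof -
      have "open (snd -` U j :: (nat \<times> 'b) set)" by (intro open_vimage U continuous_intros)
      then have "(\<lambda>x. indicator (snd -` U j) x * (1/3) ^ j :: real) \<in> borel_measurable (borel :: (nat \<times> 'b) measure)"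
        by (intro borel_measurable_times borel_measurable_indicator) auto
      then show ?thesis by (simp add: indicator_def of_bool_def)
    qed
    then show ?thesis unfolding ternary_def by (rule borel_measurable_suminf)
  qed
  moreover have "(\<lambda>x. real (fst x)) \<in> borel_measurable (borel :: (nat \<times> 'b) measure)"
    by (intro borel_measurable_continuous_onI continuous_intros)
  ultimately have "c \<in> borel_measurable borel" unfolding c_def by measurable
  moreover have "0 \<le> c x" "c x \<le> 2 * real (fst x) + 2" for x
    using ternary_bounds[of "\<lambda>j. snd x \<in> U j"] by (auto simp: c_def)
  moreover have c_sep: "fst y = fst x" if "\<bar>c x - c y\<bar> < 1 / 2" for x y
  proof -
    have "\<bar>2 * real (fst x) - 2 * real (fst y)\<bar> < 2"
      using that ternary_bounds[of "\<lambda>j. snd x \<in> U j"] ternary_bounds[of "\<lambda>j. snd y \<in> U j"]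
      unfolding c_def by arith
    then show ?thesis by arith
  qed
  moreover have "\<exists>\<eta>>0. \<forall>x\<in>X. \<forall>y\<in>X. fst x = k \<longrightarrow> \<bar>c x - c y\<bar> < \<eta> \<longrightarrow>
      fst y = fst x \<and> dist (snd x) (snd y) < \<epsilon>" if "0 < \<epsilon>" for k \<epsilon>
  proof -
    obtain J where J: "\<forall>x\<in>snd ` {x\<in>X. fst x = k}. \<forall>y\<in>snd ` {x\<in>X. fst x = k}. (\<forall>j\<le>J. x \<in> U j \<longleftrightarrow> y \<in> U j) \<longrightarrow> dist x y < \<epsilon>"
      using sep[OF \<open>0 < \<epsilon>\<close>, of k] by (elim exE)
    define \<eta> where "\<eta> = (1/3::real) ^ J / 2"
    have \<eta>: "0 < \<eta>" "\<eta> \<le> 1 / 2" by (auto simp: \<eta>_def power_le_one)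
    show ?thesis
    proof (intro exI[of _ \<eta>] conjI \<eta> ballI impI)
      fix x y assume x: "x \<in> X" "fst x = k" and y: "y \<in> X" and cl: "\<bar>c x - c y\<bar> < \<eta>"
      show eq: "fst y = fst x" using cl \<eta> by (intro c_sep) simp
      have "\<bar>ternary (\<lambda>j. snd x \<in> U j) - ternary (\<lambda>j. snd y \<in> U j)\<bar> < (1/3) ^ J / 2"
        using cl by (simp add: c_def eq \<eta>_def)
      then have "\<forall>j\<le>J. snd x \<in> U j \<longleftrightarrow> snd y \<in> U j" using ternary_separates by blast
      moreover have "snd x \<in> snd ` {x\<in>X. fst x = k}" "snd y \<in> snd ` {x\<in>X. fst x = k}"
        using x y eq by auto
      ultimately show "dist (snd x) (snd y) < \<epsilon>" using J by blast
    qed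
  qed
  ultimately show thesis using that by blast
qed

text \<open>Prokhorov's theorem for a disjoint union of compact metric spaces. The laws of the codes are tight on
the line, so Helly's theorem gives a limit law there. Since the decoding map extends
continuously to the closure of the set of codes, and the limit law lives on that closure, it can be
pushed back. The levels are open in the union, so continuity of a test function is a condition on each level.\<close>

theorem tight_sequence_on_disjoint_union:
  fixes X :: "(nat \<times> 'b::metric_space) set" and \<nu> :: "nat \<Rightarrow> (nat \<times> 'b) measure"
  assumes comp: "\<And>k. compact {x\<in>X. fst x = k}"
    and prob: "\<And>n. prob_space (\<nu> n)" and sets: "\<And>n. sets (\<nu> n) = sets borel"
    and supp: "\<And>n. AE x in \<nu> n. x \<in> X"
    and tight: "\<And>\<epsilon>. 0 < \<epsilon> \<Longrightarrow> \<exists>m. \<forall>n. measure (\<nu> n) {x. m < fst x} \<le> \<epsilon>"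
  obtains s M where "strict_mono s" "prob_space M" "sets M = sets borel" "AE x in M. x \<in> X"
    "\<And>f B. f \<in> borel_measurable borel \<Longrightarrow> (\<And>k. continuous_on {x\<in>X. fst x = k} f) \<Longrightarrow>
      (\<And>x. x \<in> X \<Longrightarrow> \<bar>f x\<bar> \<le> B) \<Longrightarrow>
      (\<lambda>n. integral\<^sup>L (\<nu> (s n)) f) \<longlonglongrightarrow> (integral\<^sup>L M f :: real)"
proof -
  obtain c :: "nat \<times> 'b \<Rightarrow> real" where c_meas: "c \<in> borel_measurable borel"
    and c0: "\<And>x. 0 \<le> c x" and c1: "\<And>x. c x \<le> 2 * real (fst x) + 2"
    and c_sep: "\<And>x y. \<bar>c x - c y\<bar> < 1 / 2 \<Longrightarrow> fst y = fst x"
    and c: "\<And>k \<epsilon>. 0 < \<epsilon> \<Longrightarrow> \<exists>\<eta>>0. \<forall>x\<in>X. \<forall>y\<in>X. fst x = k \<longrightarrow> \<bar>c x - c y\<bar> < \<eta> \<longrightarrow> fst y = fst x \<and> dist (snd x) (snd y) < \<epsilon>"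
  proof (rule exists_real_coding[OF comp], goal_cases)
    case 1
    from 1(2-) show ?case by (rule 1(1))
  qed
  have c_meas': "c \<in> borel_measurable (\<nu> n)" for n
    using c_meas by (simp add: measurable_cong_sets[OF sets HOL.refl])
  have "\<exists>x. x \<in> X"
  proof (rule ccontr)
    assume "\<not> ?thesis"
    then have "AE x in \<nu> 0. False" using supp[of 0] by auto
    then show False using prob_space.AE_False[OF prob] by blast
  qed
  then obtain x0 where x0: "x0 \<in> X" by blast
  define C where "C = closure (c ` X)"
  \<comment> \<open>\<open>lim y x\<close>: points whose codes tend to \<open>y\<close> converge to \<open>x\<close>, eventually within the level of \<open>x\<close>\<close>
  define lim where "lim y x \<longleftrightarrow> x \<in> X \<and> (\<forall>\<epsilon>>0. \<exists>\<eta>>0. \<forall>x'\<in>X. \<bar>c x' - y\<bar> < \<eta> \<longrightarrow> fst x' = fst x \<and> dist (snd x') (snd x) < \<epsilon>)" for y x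
  have ex_lim: "\<exists>x. lim y x" if y: "y \<in> C" for y
  proof -
    obtain xs where xs: "\<And>n. xs n \<in> X" "(\<lambda>n. c (xs n)) \<longlonglongrightarrow> y"
    proof -
      obtain ys where ys: "\<forall>n. ys n \<in> c ` X" "ys \<longlonglongrightarrow> y"
        using y unfolding C_def closure_sequential by blast
      then have "\<forall>n. \<exists>x. x \<in> X \<and> c x = ys n" by (metis imageE)
      then obtain xs where "\<forall>n. xs n \<in> X \<and> c (xs n) = ys n" by metis
      then show thesis using ys(2) by (intro that[of xs]) auto
    qed
    have near: "\<exists>N. \<forall>n\<ge>N. \<bar>c (xs n) - y\<bar> < \<eta>" if "0 < \<eta>" for \<eta>
      using LIMSEQ_D[OF xs(2) that] by simp
    obtain N0 where N0: "\<And>n. n \<ge> N0 \<Longrightarrow> \<bar>c (xs n) - y\<bar> < 1 / 4" using near[of "1 / 4"] by auto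
    define k where "k = fst (xs N0)"
    have k: "fst (xs n) = k" if "n \<ge> N0" for n
      unfolding k_def using N0[of n] N0[of N0] that by (intro c_sep) arith
    have "Cauchy (\<lambda>n. snd (xs n))"
    proof (rule metric_CauchyI)
      fix \<epsilon> :: real assume "0 < \<epsilon>"
      then obtain \<eta> where \<eta>: "\<eta> > 0" "\<And>x y. x \<in> X \<Longrightarrow> y \<in> X \<Longrightarrow> fst x = k \<Longrightarrow> \<bar>c x - c y\<bar> < \<eta> \<Longrightarrow> dist (snd x) (snd y) < \<epsilon>"
        using c[of \<epsilon> k] by blast
      obtain N where N: "\<And>n. n \<ge> N \<Longrightarrow> \<bar>c (xs n) - y\<bar> < \<eta> / 2" using near[of "\<eta> / 2"] \<eta> by auto
      have "dist (snd (xs m)) (snd (xs n)) < \<epsilon>" if "m \<ge> max N N0" "n \<ge> max N N0" for m n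
      proof (rule \<eta>(2))
        have "\<bar>c (xs m) - y\<bar> < \<eta> / 2" "\<bar>c (xs n) - y\<bar> < \<eta> / 2" using N[of m] N[of n] that by auto
        then show "\<bar>c (xs m) - c (xs n)\<bar> < \<eta>" by arith
      qed (use xs k that in auto)
      then show "\<exists>M. \<forall>m\<ge>M. \<forall>n\<ge>M. dist (snd (xs m)) (snd (xs n)) < \<epsilon>" by blast
    qed
    then have cau: "Cauchy (\<lambda>n. snd (xs (n + N0)))"
      by (rule Cauchy_subseq_Cauchy[unfolded comp_def]) (auto simp: strict_mono_def)
    have mem: "snd (xs (n + N0)) \<in> snd ` {x\<in>X. fst x = k}" for n using xs k by auto
    have "compact (snd ` {x\<in>X. fst x = k})"
      by (intro compact_continuous_image comp continuous_intros)
    then have "\<exists>z\<in>snd ` {x\<in>X. fst x = k}. (\<lambda>n. snd (xs (n + N0))) \<longlonglongrightarrow> z"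
      using cau mem by (intro compact_imp_complete[unfolded complete_def, rule_format] conjI allI)
    then obtain x where x: "x \<in> X" "fst x = k" "(\<lambda>n. snd (xs (n + N0))) \<longlonglongrightarrow> snd x" by auto
    have "lim y x"
      unfolding lim_def
    proof (intro conjI allI impI x(1))
      fix \<epsilon> :: real assume "0 < \<epsilon>"
      then obtain \<eta> where \<eta>: "\<eta> > 0" "\<And>x y. x \<in> X \<Longrightarrow> y \<in> X \<Longrightarrow> fst x = k \<Longrightarrow> \<bar>c x - c y\<bar> < \<eta> \<Longrightarrow>
          fst y = fst x \<and> dist (snd x) (snd y) < \<epsilon> / 2"
        using c[of "\<epsilon> / 2" k] by (metis half_gt_zero)
      obtain N where N: "\<And>n. n \<ge> N \<Longrightarrow> \<bar>c (xs n) - y\<bar> < \<eta> / 2" using near[of "\<eta> / 2"] \<eta> by auto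
      obtain N' where N': "\<And>n. n \<ge> N' \<Longrightarrow> dist (snd (xs (n + N0))) (snd x) < \<epsilon> / 2"
        using x(3) \<open>0 < \<epsilon>\<close> unfolding lim_sequentially by (metis half_gt_zero)
      define n where "n = max N N' + N0"
      have n: "\<bar>c (xs n) - y\<bar> < \<eta> / 2" "dist (snd (xs n)) (snd x) < \<epsilon> / 2" "fst (xs n) = k"
        using N[of n] N'[of "max N N'"] k[of n] by (auto simp: n_def)
      show "\<exists>\<eta>>0. \<forall>x'\<in>X. \<bar>c x' - y\<bar> < \<eta> \<longrightarrow> fst x' = fst x \<and> dist (snd x') (snd x) < \<epsilon>"
      proof (intro exI[of _ "\<eta> / 2"] conjI ballI impI)
        fix x' assume x': "x' \<in> X" "\<bar>c x' - y\<bar> < \<eta> / 2"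
        then have "\<bar>c (xs n) - c x'\<bar> < \<eta>" using n by arith
        then have "fst x' = fst (xs n)" "dist (snd (xs n)) (snd x') < \<epsilon> / 2" using \<eta>(2)[of "xs n" x'] xs x' n by auto
        then show "fst x' = fst x" "dist (snd x') (snd x) < \<epsilon>"
          using n x dist_triangle_half_r[of "snd (xs n)" "snd x'" \<epsilon> "snd x"] by auto
      qed (use \<eta> in auto)
    qed
    then show ?thesis by blast
  qed
  \<comment> \<open>the decoding map, extended by an arbitrary point of \<open>X\<close> off the closed set \<open>C\<close>\<close>
  define h where "h y = (if y \<in> C then SOME x. lim y x else x0)" for y
  have h: "lim y (h y)" if "y \<in> C" for y
    using someI_ex[OF ex_lim[OF that]] that by (simp add: h_def)
  have hX: "h y \<in> X" for y using h[of y] x0 by (cases "y \<in> C") (auto simp: lim_def h_def)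
  have cX: "c x \<in> C" if "x \<in> X" for x using that closure_subset[of "c ` X"] by (auto simp: C_def)
  have hc: "h (c x) = x" if x: "x \<in> X" for x
  proof (rule prod_eqI)
    have near: "fst x = fst (h (c x)) \<and> dist (snd x) (snd (h (c x))) < \<epsilon>" if "0 < \<epsilon>" for \<epsilon>
      using h[OF cX[OF x]] that x unfolding lim_def by force
    from near[of 1] show "fst (h (c x)) = fst x" by simp
    from near show "snd (h (c x)) = snd x" by (metis dist_commute dist_nz order_less_irrefl)
  qed
  have h_cont: "\<exists>\<eta>>0. \<forall>y'\<in>C. \<bar>y' - y\<bar> < \<eta> \<longrightarrow> fst (h y') = fst (h y) \<and> dist (snd (h y')) (snd (h y)) < \<epsilon>"
    if y: "y \<in> C" and \<epsilon>: "0 < \<epsilon>" for y \<epsilon>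
  proof -
    obtain \<eta> where \<eta>: "\<eta> > 0" "\<And>x'. x' \<in> X \<Longrightarrow> \<bar>c x' - y\<bar> < \<eta> \<Longrightarrow> fst x' = fst (h y) \<and> dist (snd x') (snd (h y)) < \<epsilon> / 2"
      using h[OF y] \<epsilon> unfolding lim_def by (metis half_gt_zero)
    have "fst (h y') = fst (h y) \<and> dist (snd (h y')) (snd (h y)) < \<epsilon>" if y': "y' \<in> C" "\<bar>y' - y\<bar> < \<eta> / 2" for y'
    proof -
      obtain \<eta>' where \<eta>': "\<eta>' > 0" "\<And>x'. x' \<in> X \<Longrightarrow> \<bar>c x' - y'\<bar> < \<eta>' \<Longrightarrow> fst x' = fst (h y') \<and> dist (snd x') (snd (h y')) < \<epsilon> / 2"
        using h[OF y'(1)] \<epsilon> unfolding lim_def by (metis half_gt_zero)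
      obtain x' where x': "x' \<in> X" "\<bar>c x' - y'\<bar> < min (\<eta> / 2) \<eta>'"
        using y'(1) \<eta>(1) \<eta>'(1) unfolding C_def closure_approachable
        by (metis dist_real_def half_gt_zero imageE min_less_iff_conj)
      have "\<bar>c x' - y\<bar> < \<eta>" using x'(2) y'(2) by linarith
      then show ?thesis
        using \<eta>(2)[of x'] \<eta>'(2)[of x'] x' dist_triangle_half_r[of "snd x'" "snd (h y')" \<epsilon> "snd (h y)"] by auto
    qed
    then show ?thesis using \<eta>(1) by (intro exI[of _ "\<eta> / 2"]) auto
  qed
  have h_level: "\<exists>A. open A \<and> y \<in> A \<and> (\<forall>y'\<in>C. y' \<in> A \<longrightarrow> fst (h y') = fst (h y) \<and> h y' \<in> B)"
    if y: "y \<in> C" and B: "open B" "h y \<in> B" for y B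
  proof -
    have "open ((\<lambda>w. (fst (h y), w)) -` B)" by (intro open_vimage B(1) continuous_intros)
    then obtain \<epsilon> where \<epsilon>: "0 < \<epsilon>" "\<And>w. dist w (snd (h y)) < \<epsilon> \<Longrightarrow> (fst (h y), w) \<in> B"
      using B(2) unfolding open_dist by force
    obtain \<eta> where \<eta>: "0 < \<eta>" "\<And>y'. y' \<in> C \<Longrightarrow> \<bar>y' - y\<bar> < \<eta> \<Longrightarrow> fst (h y') = fst (h y) \<and> dist (snd (h y')) (snd (h y)) < \<epsilon>"
      using h_cont[OF y \<epsilon>(1)] by blast
    have "fst (h y') = fst (h y) \<and> h y' \<in> B" if "y' \<in> C" "y' \<in> ball y \<eta>" for y'
    proof -
      have 1: "fst (h y') = fst (h y)" "dist (snd (h y')) (snd (h y)) < \<epsilon>"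
        using \<eta>(2)[of y'] that by (auto simp: dist_real_def abs_minus_commute)
      then show ?thesis using \<epsilon>(2)[of "snd (h y')"] by (metis prod.collapse)
    qed
    then show ?thesis using \<eta>(1) by (intro exI[of _ "ball y \<eta>"]) auto
  qed
  have Cclosed: "closed C" by (simp add: C_def)
  have contf: "continuous_on C (\<lambda>y. f (h y))"
    if f: "\<And>k. continuous_on {x\<in>X. fst x = k} f" for f :: "nat \<times> 'b \<Rightarrow> real"
    unfolding continuous_on_topological
  proof (intro ballI allI impI)
    fix y B assume y: "y \<in> C" and B: "open B" "f (h y) \<in> B"
    have "h y \<in> {x\<in>X. fst x = fst (h y)}" using hX by simp
    from f[unfolded continuous_on_topological, rule_format, OF this B] obtain A where
      A: "open A" "h y \<in> A" "\<forall>x\<in>{x\<in>X. fst x = fst (h y)}. x \<in> A \<longrightarrow> f x \<in> B" by auto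
    from h_level[OF y A(1,2)] obtain A' where
      A': "open A'" "y \<in> A'" "\<And>y'. y' \<in> C \<Longrightarrow> y' \<in> A' \<Longrightarrow> fst (h y') = fst (h y) \<and> h y' \<in> A" by auto
    have "f (h y') \<in> B" if y': "y' \<in> C" "y' \<in> A'" for y'
    proof -
      have "h y' \<in> {x\<in>X. fst x = fst (h y)}" "h y' \<in> A" using A'(3)[OF y'] hX[of y'] by auto
      then show ?thesis using A(3) by blast
    qed
    then show "\<exists>A. open A \<and> y \<in> A \<and> (\<forall>y'\<in>C. y' \<in> A \<longrightarrow> f (h y') \<in> B)" using A'(1,2) by blast
  qed
  have ch: "continuous_on C h"
    unfolding continuous_on_topological
  proof (intro ballI allI impI)
    fix y B assume "y \<in> C" "open B" "h y \<in> B"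
    from h_level[OF this] obtain A where
      "open A" "y \<in> A" "\<forall>y'\<in>C. y' \<in> A \<longrightarrow> fst (h y') = fst (h y) \<and> h y' \<in> B" by auto
    then show "\<exists>A. open A \<and> y \<in> A \<and> (\<forall>y'\<in>C. y' \<in> A \<longrightarrow> h y' \<in> B)" by blast
  qed
  have h_meas: "h \<in> borel_measurable borel"
  proof -
    have "(\<lambda>y. if y \<in> C then h y else x0) \<in> borel_measurable borel"
      by (intro borel_measurable_continuous_on_if) (use Cclosed ch in auto)
    moreover have "(\<lambda>y. if y \<in> C then h y else x0) = h" by (auto simp: h_def)
    ultimately show ?thesis by simp
  qed
  define \<mu> where "\<mu> n = distr (\<nu> n) borel c" for n
  have \<mu>: "real_distribution (\<mu> n)" for n
    unfolding \<mu>_def by (rule prob_space.real_distribution_distr[OF prob c_meas'])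
  have "Helly_Selection.tight \<mu>"
    unfolding tight_def
  proof (intro conjI allI impI \<mu>)
    fix \<epsilon> :: real assume "0 < \<epsilon>"
    then obtain m where m: "\<And>n. measure (\<nu> n) {x. m < fst x} \<le> \<epsilon> / 2" using tight[of "\<epsilon> / 2"] by auto
    have "measure (\<mu> n) {-1<..2 * real m + 2} > 1 - \<epsilon>" for n
    proof -
      have "open (fst -` {m<..} :: (nat \<times> 'b) set)" by (intro open_vimage continuous_intros)
      then have ev: "{x. m < fst x} \<in> sets (\<nu> n)" by (simp add: sets vimage_def)
      have sp: "space (\<nu> n) = UNIV" using sets_eq_imp_space_eq[OF sets[of n]] by simp
      have "1 - \<epsilon> / 2 \<le> 1 - measure (\<nu> n) {x. m < fst x}" using m by simp
      also have "\<dots> = measure (\<nu> n) (- {x. m < fst x})"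
        using prob_space.prob_compl[OF prob ev] by (simp add: sp Compl_eq_Diff_UNIV)
      also have "\<dots> \<le> measure (\<nu> n) (c -` {-1<..2 * real m + 2} \<inter> space (\<nu> n))"
      proof (intro finite_measure.finite_measure_mono)
        show "finite_measure (\<nu> n)" using prob by (rule prob_space.finite_measure)
        show "- {x. m < fst x} \<subseteq> c -` {- 1<..2 * real m + 2} \<inter> space (\<nu> n)"
        proof
          fix x :: "nat \<times> 'b" assume "x \<in> - {x. m < fst x}"
          then have "real (fst x) \<le> real m" by simp
          then show "x \<in> c -` {- 1<..2 * real m + 2} \<inter> space (\<nu> n)"
            using c0[of x] c1[of x] sp by simp
        qed
        show "c -` {- 1<..2 * real m + 2} \<inter> space (\<nu> n) \<in> sets (\<nu> n)"
          using c_meas' by (rule measurable_sets) simp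
      qed
      also have "\<dots> = measure (\<mu> n) {-1<..2 * real m + 2}"
        unfolding \<mu>_def by (rule measure_distr[symmetric, OF c_meas']) simp
      finally show ?thesis using \<open>0 < \<epsilon>\<close> by simp
    qed
    then show "\<exists>a b. a < b \<and> (\<forall>n. 1 - \<epsilon> < measure (\<mu> n) {a<..b})"
      by (intro exI[of _ "-1"] exI[of _ "2 * real m + 2"]) auto
  qed
  from tight_imp_convergent_subsubsequence[OF this strict_mono_id] obtain s L where
    s: "strict_mono s" and L: "real_distribution L" and conv: "weak_conv_m (\<mu> \<circ> s) L"
    by auto
  interpret L: real_distribution L by (rule L)
  have conv_int: "(\<lambda>n. integral\<^sup>L (\<nu> (s n)) (\<lambda>x. g (c x))) \<longlonglongrightarrow> integral\<^sup>L L g"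
    if g: "continuous_on UNIV g" "\<And>y. \<bar>g y\<bar> \<le> B" for g :: "real \<Rightarrow> real" and B
  proof -
    have "(\<lambda>n. integral\<^sup>L ((\<mu> \<circ> s) n) g) \<longlonglongrightarrow> integral\<^sup>L L g"
      using g conv \<mu> L
      by (intro weak_conv_imp_integral_bdd_continuous_conv[where B=B])
        (auto simp: continuous_on_eq_continuous_at comp_def)
    moreover have "integral\<^sup>L ((\<mu> \<circ> s) n) g = integral\<^sup>L (\<nu> (s n)) (\<lambda>x. g (c x))" for n
      unfolding \<mu>_def comp_def using g by (intro integral_distr c_meas') (rule borel_measurable_continuous_onI)
    ultimately show ?thesis by simp
  qed
  \<comment> \<open>the limit law charges only \<open>C\<close>: test it with the truncated distance to \<open>C\<close>\<close>
  have inC: "AE y in L. y \<in> C"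
  proof -
    define g where "g y = min 1 (infdist y C)" for y
    have g: "continuous_on UNIV g" unfolding g_def by (intro continuous_intros)
    have g0: "0 \<le> g y" "g y \<le> 1" for y by (auto simp: g_def infdist_nonneg)
    have "integral\<^sup>L (\<nu> (s n)) (\<lambda>x. g (c x)) = 0" for n
    proof -
      have "integral\<^sup>L (\<nu> (s n)) (\<lambda>x. g (c x)) = integral\<^sup>L (\<nu> (s n)) (\<lambda>x. 0)"
      proof (rule integral_cong_AE)
        show "(\<lambda>x. g (c x)) \<in> borel_measurable (\<nu> (s n))"
          by (rule measurable_compose[OF c_meas' borel_measurable_continuous_onI[OF g]])
        show "AE x in \<nu> (s n). g (c x) = 0" using supp[of "s n"]
          by eventually_elim (auto simp: g_def cX)
      qed simp
      then show ?thesis by simp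
    qed
    then have "integral\<^sup>L L g = 0"
      using conv_int[OF g, of 1] g0 by (simp add: LIMSEQ_const_iff)
    moreover have "integrable L g"
      by (rule L.integrable_const_bound[of _ 1]) (use g0 borel_measurable_continuous_onI[OF g] in auto)
    ultimately have "AE y in L. g y = 0"
      using integral_nonneg_eq_0_iff_AE[of L g] g0 by auto
    then show ?thesis
    proof eventually_elim
      case (elim y)
      then have "infdist y C = 0" by (simp add: g_def min_def split: if_splits)
      moreover have "C \<noteq> {}" using cX[OF x0] by blast
      ultimately show ?case using in_closed_iff_infdist_zero[OF Cclosed] by auto
    qed
  qed
  have h_meas': "h \<in> measurable L borel" using h_meas by simp
  define M where "M = distr L borel h"
  show thesis
  proof (rule that[of s M])
    show "prob_space M" unfolding M_def by (rule L.prob_space_distr[OF h_meas'])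
    show "AE x in M. x \<in> X"
    proof -
      have "X = (\<Union>k. {x\<in>X. fst x = k})" by auto
      moreover have "(\<Union>k. {x\<in>X. fst x = k}) \<in> sets borel"
        using comp by (intro sets.countable_UN) (auto intro: borel_compact)
      ultimately have "X \<in> sets borel" by simp
      then show ?thesis unfolding M_def by (subst AE_distr_iff[OF h_meas']) (auto simp: hX)
    qed
    fix f :: "nat \<times> 'b \<Rightarrow> real" and B
    assume f: "f \<in> borel_measurable borel" "\<And>k. continuous_on {x\<in>X. fst x = k} f" "\<And>x. x \<in> X \<Longrightarrow> \<bar>f x\<bar> \<le> B"
    obtain g where g: "continuous_on UNIV g" "\<And>y. y \<in> C \<Longrightarrow> g y = f (h y)" "\<And>y. \<bar>g y\<bar> \<le> B"
    proof (rule Tietze[OF contf[OF f(2)], of UNIV B], goal_cases)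
      case 1
      then show ?case using Cclosed by simp
    next
      case 2
      then show ?case using f(3)[OF x0] by simp
    next
      case (3 y)
      then show ?case using f(3)[OF hX] by simp
    next
      case (4 g)
      have "\<bar>g y\<bar> \<le> B" for y using 4(4)[of y] by simp
      from 4(2,3) this show ?case by (rule 4(1))
    qed
    have "integral\<^sup>L (\<nu> (s n)) f = integral\<^sup>L (\<nu> (s n)) (\<lambda>x. g (c x))" for n
    proof (rule integral_cong_AE)
      show "f \<in> borel_measurable (\<nu> (s n))" using f(1) by (simp add: measurable_cong_sets[OF sets HOL.refl])
      show "(\<lambda>x. g (c x)) \<in> borel_measurable (\<nu> (s n))"
        by (rule measurable_compose[OF c_meas' borel_measurable_continuous_onI[OF g(1)]])
      show "AE x in \<nu> (s n). f x = g (c x)" using supp[of "s n"]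
        by eventually_elim (simp add: g(2) cX hc)
    qed
    moreover have "integral\<^sup>L M f = integral\<^sup>L L g"
    proof -
      have "integral\<^sup>L M f = integral\<^sup>L L (\<lambda>y. f (h y))"
        unfolding M_def by (rule integral_distr[OF h_meas' f(1)])
      also have "\<dots> = integral\<^sup>L L g"
      proof (rule integral_cong_AE)
        show "(\<lambda>y. f (h y)) \<in> borel_measurable L" by (rule measurable_compose[OF h_meas' f(1)])
        show "g \<in> borel_measurable L" using borel_measurable_continuous_onI[OF g(1)] by simp
        show "AE y in L. f (h y) = g y" using inC by eventually_elim (simp add: g(2))
      qed
      finally show ?thesis .
    qed
    ultimately show "(\<lambda>n. integral\<^sup>L (\<nu> (s n)) f) \<longlonglongrightarrow> integral\<^sup>L M f"
      using conv_int[OF g(1,3)] by (simp only:)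
  qed (use s in \<open>auto simp: M_def\<close>)
qed

section \<open>Intensities of random tuples\<close>

text \<open>The measure \<open>A \<mapsto> E |{i < n : p\<^sub>i \<in> A}|\<close>. Writing it as an image of a product with counting measure makes
integration against it an instance of Fubini's theorem (\<open>nn_integral_intensity\<close>).\<close>

definition intensity ::
  "'w measure \<Rightarrow> ('w \<Rightarrow> nat) \<Rightarrow> ('w \<Rightarrow> nat \<Rightarrow> 'b) \<Rightarrow> 'b measure \<Rightarrow> 'b measure" where
  "intensity M n p N =
     distr (density (M \<Otimes>\<^sub>M count_space UNIV) (\<lambda>x. indicator {..<n (fst x)} (snd x))) N
       (\<lambda>x. p (fst x) (snd x))"

lemma sets_intensity [simp]: "sets (intensity M n p N) = sets N"
  by (simp add: intensity_def)

lemma measurable_sum_lessThan_count: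
  fixes g :: "'w \<Rightarrow> nat \<Rightarrow> 'c::{second_countable_topology, topological_comm_monoid_add}"
  assumes n: "n \<in> M \<rightarrow>\<^sub>M count_space UNIV" and g: "\<And>i. (\<lambda>w. g w i) \<in> borel_measurable M"
  shows "(\<lambda>w. \<Sum>i<n w. g w i) \<in> borel_measurable M"
proof (rule measurable_compose_countable[OF _ n])
  fix k show "(\<lambda>w. \<Sum>i<k. g w i) \<in> borel_measurable M" using g by (intro borel_measurable_sum) auto
qed

lemma nn_integral_intensity:
  fixes p :: "'w \<Rightarrow> nat \<Rightarrow> 'b"
  assumes n: "n \<in> M \<rightarrow>\<^sub>M count_space UNIV" and p: "\<And>i. (\<lambda>w. p w i) \<in> M \<rightarrow>\<^sub>M N"
    and g: "g \<in> borel_measurable N"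
  shows "(\<integral>\<^sup>+ b. g b \<partial>intensity M n p N) = (\<integral>\<^sup>+ w. (\<Sum>i<n w. g (p w i)) \<partial>M)"
proof -
  let ?P = "M \<Otimes>\<^sub>M count_space (UNIV :: nat set)"
  have snd: "snd \<in> ?P \<rightarrow>\<^sub>M count_space UNIV" by (rule measurable_snd)
  have p': "(\<lambda>x. p (fst x) (snd x)) \<in> ?P \<rightarrow>\<^sub>M N"
    by (rule measurable_compose_countable[OF _ snd, of "\<lambda>i x. p (fst x) i"])
      (rule measurable_compose[OF measurable_fst p])
  have ind: "(\<lambda>x. indicator {..<n (fst x)} (snd x) :: ennreal) \<in> borel_measurable ?P"
  proof (rule measurable_compose_countable[OF _ snd, of "\<lambda>i x. indicator {..<n (fst x)} i :: ennreal"])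
    fix i
    have "(\<lambda>k. indicator {..<k} i :: ennreal) \<in> borel_measurable (count_space (UNIV :: nat set))" by simp
    from measurable_compose[OF measurable_compose[OF measurable_fst n] this]
    show "(\<lambda>x. indicator {..<n (fst x)} i :: ennreal) \<in> borel_measurable ?P" .
  qed
  have "(\<integral>\<^sup>+ b. g b \<partial>intensity M n p N) =
      (\<integral>\<^sup>+ x. indicator {..<n (fst x)} (snd x) * g (p (fst x) (snd x)) \<partial>?P)"
    unfolding intensity_def using p' ind g
    by (subst nn_integral_distr) (auto intro!: nn_integral_density measurable_compose[OF p' g])
  also have "\<dots> = (\<integral>\<^sup>+ w. \<integral>\<^sup>+ i. indicator {..<n w} i * g (p w i) \<partial>count_space UNIV \<partial>M)"
    using sigma_finite_measure.nn_integral_fst[OF sigma_finite_measure_count_space,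
        of "\<lambda>x. indicator {..<n (fst x)} (snd x) * g (p (fst x) (snd x))" M]
      ind measurable_compose[OF p' g] by simp
  also have "\<dots> = (\<integral>\<^sup>+ w. (\<Sum>i<n w. g (p w i)) \<partial>M)"
  proof (rule nn_integral_cong)
    fix w
    have "(\<integral>\<^sup>+ i. indicator {..<n w} i * g (p w i) \<partial>count_space UNIV) =
        (\<integral>\<^sup>+ i. g (p w i) * indicator {..<n w} i \<partial>count_space UNIV)" by (simp add: mult.commute)
    also have "\<dots> = (\<integral>\<^sup>+ i. g (p w i) \<partial>count_space {..<n w})"
      by (rule nn_integral_count_space_indicator[symmetric]) simp
    also have "\<dots> = (\<Sum>i<n w. g (p w i))" by (rule nn_integral_count_space_finite) simp
    finally show "(\<integral>\<^sup>+ i. indicator {..<n w} i * g (p w i) \<partial>count_space UNIV) = (\<Sum>i<n w. g (p w i))" .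
  qed
  finally show ?thesis .
qed

lemma emeasure_intensity:
  assumes n: "n \<in> M \<rightarrow>\<^sub>M count_space UNIV" and p: "\<And>i. (\<lambda>w. p w i) \<in> M \<rightarrow>\<^sub>M N"
    and A: "A \<in> sets N"
  shows "emeasure (intensity M n p N) A = (\<integral>\<^sup>+ w. (\<Sum>i<n w. indicator A (p w i)) \<partial>M)"
  using nn_integral_intensity[OF n p, of "indicator A"] A by simp

lemma sum_indicator_eq_card:
  fixes n :: nat
  shows "(\<Sum>i<n. indicator A (r i) :: ennreal) = of_nat (card {i\<in>{..<n}. r i \<in> A})"
proof -
  have "of_nat (card {i\<in>{..<n}. r i \<in> A}) = (\<Sum>i\<in>{i\<in>{..<n}. r i \<in> A}. 1 :: ennreal)" by simp
  also have "\<dots> = (\<Sum>i<n. if r i \<in> A then 1 else 0)" by (rule sum.inter_filter) simp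
  finally show ?thesis by (simp add: indicator_def of_bool_def)
qed

lemma nn_integral_mono_setwise:
  assumes sets: "sets \<mu> = sets \<nu>" and le: "\<And>A. A \<in> sets \<mu> \<Longrightarrow> emeasure \<mu> A \<le> emeasure \<nu> A"
  shows "(\<integral>\<^sup>+ x. g x \<partial>\<mu>) \<le> (\<integral>\<^sup>+ x. g x \<partial>\<nu>)"
proof (rule nn_integral_mono_measure[OF sets])
  show "\<mu> \<le> \<nu>" unfolding le_measure[OF sets] le_fun_def
    using le sets by (metis emeasure_notin_sets order_refl)
qed

section \<open>The Borel structure on covers\<close>

lemma covers_space_sets:
  "space (covers_space T) = covers T"
  "A \<subseteq> covers T \<Longrightarrow> (\<And>m. 1 \<le> m \<Longrightarrow> {r. (m, r) \<in> A} \<in>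
        sets (restrict_space (\<Pi>\<^sub>M i\<in>{..<m}. borel) (covers_of_size T m))) \<Longrightarrow> A \<in> sets (covers_space T)"
  unfolding covers_space_def by (auto intro!: space_measure_of simp: sets_measure_of)

text \<open>The generating family of \<open>covers_space\<close> consists of all sets with measurable slices, so a map is
measurable as soon as its slices are.\<close>

lemma measurable_from_covers_space:
  assumes "\<And>m. 1 \<le> m \<Longrightarrow> (\<lambda>r. h (m, r)) \<in> restrict_space (\<Pi>\<^sub>M i\<in>{..<m}. borel) (covers_of_size T m) \<rightarrow>\<^sub>M N"
    and "\<And>x. x \<in> covers T \<Longrightarrow> h x \<in> space N"
  shows "h \<in> covers_space T \<rightarrow>\<^sub>M N"
proof (rule measurableI)
  fix B assume B: "B \<in> sets N"
  show "h -` B \<inter> space (covers_space T) \<in> sets (covers_space T)"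
  proof (rule covers_space_sets(2))
    fix m :: nat assume m: "1 \<le> m"
    have sub: "covers_of_size T m \<subseteq> space (\<Pi>\<^sub>M i\<in>{..<m}. borel)"
      by (auto simp: covers_of_size_def space_PiM)
    have "{r. (m, r) \<in> h -` B \<inter> space (covers_space T)} =
        (\<lambda>r. h (m, r)) -` B \<inter> space (restrict_space (\<Pi>\<^sub>M i\<in>{..<m}. borel) (covers_of_size T m))"
      using m sub by (auto simp: covers_space_sets(1) covers_def space_restrict_space)
    then show "{r. (m, r) \<in> h -` B \<inter> space (covers_space T)} \<in>
        sets (restrict_space (\<Pi>\<^sub>M i\<in>{..<m}. borel) (covers_of_size T m))"
      using measurable_sets[OF assms(1)[OF m] B] by simp
  qed (auto simp: covers_space_sets(1))
qed (use assms in \<open>auto simp: covers_space_sets(1)\<close>)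

lemma measurable_size: "fst \<in> covers_space T \<rightarrow>\<^sub>M count_space UNIV"
  by (rule measurable_from_covers_space) auto

text \<open>The value \<open>0\<close> beyond the length of the tuple is a convention that makes the \<open>i\<close>-th radius a total function.\<close>

lemma measurable_radius:
  "(\<lambda>x. if i < fst x then snd x i else 0 :: real) \<in> borel_measurable (covers_space T)"
proof (rule measurable_from_covers_space)
  fix m :: nat
  show "(\<lambda>r. if i < fst (m, r) then snd (m, r) i else 0) \<in>
    borel_measurable (restrict_space (\<Pi>\<^sub>M i\<in>{..<m}. borel) (covers_of_size T m))"
    by (intro measurable_restrict_space1) (cases "i < m"; simp)
qed simp

lemma measurable_into_covers_space:
  assumes n: "n \<in> M \<rightarrow>\<^sub>M count_space UNIV" and r: "\<And>i. (\<lambda>w. r w i) \<in> borel_measurable M"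
    and cov: "\<And>w. w \<in> space M \<Longrightarrow> (n w, \<lambda>i\<in>{..<n w}. r w i) \<in> covers T"
  shows "(\<lambda>w. (n w, \<lambda>i\<in>{..<n w}. r w i)) \<in> M \<rightarrow>\<^sub>M covers_space T"
  unfolding covers_space_def
proof (rule measurable_sigma_sets)
  let ?G = "{A. A \<subseteq> covers T \<and> (\<forall>m\<ge>1. {r. (m, r) \<in> A} \<in>
        sets (restrict_space (\<Pi>\<^sub>M i\<in>{..<m}. (borel :: real measure)) (covers_of_size T m)))}"
  show "sets (sigma (covers T) ?G) = sigma_sets (covers T) ?G" by (rule sets_measure_of) auto
  show "?G \<subseteq> Pow (covers T)" by auto
  show "(\<lambda>w. (n w, \<lambda>i\<in>{..<n w}. r w i)) \<in> space M \<rightarrow> covers T" using cov by auto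
  fix A assume A: "A \<in> ?G"
  let ?\<Phi> = "\<lambda>w. (n w, \<lambda>i\<in>{..<n w}. r w i)"
  define \<Phi> where "\<Phi> m w = (\<lambda>i\<in>{..<m}. r w i)" for m w
  have "?\<Phi> -` A \<inter> space M = (\<Union>m\<in>{1..}. n -` {m} \<inter> {w\<in>space M. \<Phi> m w \<in> {r. (m, r) \<in> A}})"
    using A cov by (auto simp: \<Phi>_def covers_def)
  also have "\<dots> = (\<Union>m\<in>{1..}. (n -` {m} \<inter> space M) \<inter> {w\<in>space M. \<Phi> m w \<in> {r. (m, r) \<in> A}})" by auto
  also have "\<dots> \<in> sets M"
  proof (rule sets.countable_UN'')
    show "countable {1::nat..}" by simp
  next
    fix m :: nat assume m: "m \<in> {1..}"
    then obtain B where B: "B \<in> sets (\<Pi>\<^sub>M i\<in>{..<m}. (borel :: real measure))"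
      "{r. (m, r) \<in> A} = covers_of_size T m \<inter> B"
      using A by (auto simp: sets_restrict_space)
    have \<Phi>: "\<Phi> m \<in> M \<rightarrow>\<^sub>M (\<Pi>\<^sub>M i\<in>{..<m}. borel)"
      unfolding \<Phi>_def using r by (intro measurable_restrict) auto
    have "(n -` {m} \<inter> space M) \<inter> {w\<in>space M. \<Phi> m w \<in> {r. (m, r) \<in> A}} =
        (n -` {m} \<inter> space M) \<inter> (\<Phi> m -` B \<inter> space M)"
      using B(2) cov by (auto simp: \<Phi>_def covers_def)
    then show "(n -` {m} \<inter> space M) \<inter> {w\<in>space M. \<Phi> m w \<in> {r. (m, r) \<in> A}} \<in> sets M"
      using measurable_sets[OF n, of "{m}"] measurable_sets[OF \<Phi> B(1)] by auto
  qed
  finally show "?\<Phi> -` A \<inter> space M \<in> sets M" .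
qed

section \<open>Random covers of finite nets\<close>

lemma atomic_measure_of_weights:
  fixes p :: "nat \<Rightarrow> 'a::metric_space" and y :: "nat \<Rightarrow> real"
  assumes y: "\<And>i. 0 \<le> y i" and p: "\<And>i. i < n \<Longrightarrow> p i \<in> S"
  obtains \<sigma> where "atomic_measure_on S \<sigma>"
    "\<And>A. A \<in> sets \<sigma> \<Longrightarrow> emeasure \<sigma> A = ennreal (\<Sum>i<n. if p i \<in> A then y i else 0)"
    "sets \<sigma> = sets (borel_on S)"
proof -
  define \<sigma> where "\<sigma> = distr (point_measure {..<n} (\<lambda>i. ennreal (y i))) (borel_on S) p"
  have m: "p \<in> point_measure {..<n} (\<lambda>i. ennreal (y i)) \<rightarrow>\<^sub>M borel_on S"
    using p by (auto simp: measurable_def space_point_measure sets_point_measure space_restrict_space)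
  have sets: "sets \<sigma> = sets (borel_on S)" by (simp add: \<sigma>_def)
  have em: "emeasure \<sigma> A = (\<Sum>i<n. ennreal (y i) * indicator A (p i))" if "A \<in> sets \<sigma>" for A
  proof -
    have "emeasure \<sigma> A = emeasure (point_measure {..<n} (\<lambda>i. ennreal (y i))) (p -` A \<inter> {..<n})"
      using that m unfolding \<sigma>_def by (subst emeasure_distr) (auto simp: space_point_measure)
    also have "\<dots> = (\<Sum>i\<in>p -` A \<inter> {..<n}. ennreal (y i))"
      by (rule emeasure_point_measure_finite2) auto
    also have "\<dots> = (\<Sum>i\<in>{i\<in>{..<n}. p i \<in> A}. ennreal (y i))" by (rule sum.cong) auto
    also have "\<dots> = (\<Sum>i<n. if p i \<in> A then ennreal (y i) else 0)" by (rule sum.inter_filter) simp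
    also have "\<dots> = (\<Sum>i<n. ennreal (y i) * indicator A (p i))"
      by (intro sum.cong) (auto simp: indicator_def)
    finally show ?thesis .
  qed
  have "atomic_measure_on S \<sigma>"
    unfolding atomic_measure_on_def
  proof (intro conjI exI[of _ n] exI[of _ y] exI[of _ p] ballI allI impI)
    fix A assume A: "A \<in> sets \<sigma>"
    then have "emeasure (return (borel_on S) (p i)) A = indicator A (p i)" for i
      by (intro emeasure_return) (simp add: sets)
    then show "emeasure \<sigma> A = (\<Sum>i<n. ennreal (y i) * emeasure (return (borel_on S) (p i)) A)"
      by (simp add: em[OF A])
  qed (use sets y p in auto)
  moreover have "emeasure \<sigma> A = ennreal (\<Sum>i<n. if p i \<in> A then y i else 0)" if "A \<in> sets \<sigma>" for A
  proof -
    have "emeasure \<sigma> A = (\<Sum>i<n. ennreal (if p i \<in> A then y i else 0))"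
      unfolding em[OF that] by (intro sum.cong) auto
    also have "\<dots> = ennreal (\<Sum>i<n. if p i \<in> A then y i else 0)" using y by (intro sum_ennreal) auto
    finally show ?thesis .
  qed
  ultimately show thesis using that[of \<sigma>] sets by blast
qed

lemma enumeration_by_decreasing_key:
  fixes key :: "'a \<Rightarrow> real"
  assumes "finite P"
  obtains p :: "nat \<Rightarrow> 'a" and n where "p ` {..<n} = P" "inj_on p {..<n}"
    "\<And>i k. i < k \<Longrightarrow> k < n \<Longrightarrow> key (p k) \<le> key (p i)"
proof -
  obtain xs where xs: "set xs = P" "distinct xs" using finite_distinct_list[OF assms] by blast
  define ys where "ys = sort_key (\<lambda>x. - key x) xs"
  have ys: "set ys = P" "distinct ys" "sorted (map (\<lambda>x. - key x) ys)" using xs by (auto simp: ys_def)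
  show thesis
  proof (rule that[of "\<lambda>i. ys ! i" "length ys"])
    show "(!) ys ` {..<length ys} = P" using ys(1) by (auto simp: set_conv_nth)
    show "inj_on ((!) ys) {..<length ys}" using ys(2) by (auto simp: inj_on_def nth_eq_iff_index_eq)
    fix i k assume "i < k" "k < length ys"
    then show "key (ys ! k) \<le> key (ys ! i)" using sorted_nth_mono[OF ys(3), of i k] by simp
  qed
qed

lemma nn_integral_finite_range:
  fixes \<tau> :: "'s \<Rightarrow> 't"
  assumes G: "finite G" "\<And>s. s \<in> space \<beta> \<Longrightarrow> \<tau> s \<in> G"
    and meas: "\<And>t. t \<in> G \<Longrightarrow> {s\<in>space \<beta>. \<tau> s = t} \<in> sets \<beta>"
  shows "(\<integral>\<^sup>+ s. g (\<tau> s) \<partial>\<beta>) = (\<Sum>t\<in>G. g t * emeasure \<beta> {s\<in>space \<beta>. \<tau> s = t})"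
proof -
  have "(\<integral>\<^sup>+ s. g (\<tau> s) \<partial>\<beta>) = (\<integral>\<^sup>+ s. (\<Sum>t\<in>G. g t * indicator {s\<in>space \<beta>. \<tau> s = t} s) \<partial>\<beta>)"
  proof (rule nn_integral_cong)
    fix s assume s: "s \<in> space \<beta>"
    have "(\<Sum>t\<in>G. g t * indicator {s\<in>space \<beta>. \<tau> s = t} s) = (\<Sum>t\<in>G. if t = \<tau> s then g t else 0)"
      using s by (intro sum.cong) (auto simp: indicator_def)
    then show "g (\<tau> s) = (\<Sum>t\<in>G. g t * indicator {s\<in>space \<beta>. \<tau> s = t} s)" using G s by simp
  qed
  also have "\<dots> = (\<Sum>t\<in>G. g t * emeasure \<beta> {s\<in>space \<beta>. \<tau> s = t})"
    using meas by (subst nn_integral_sum) (auto simp: nn_integral_cmult_indicator)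
  finally show ?thesis .
qed

context tree_coordinates
begin

definition marked_covers :: "real \<Rightarrow> (nat \<times> (nat \<Rightarrow> 'a \<times> real)) set" where
  "marked_covers B = {(m, w). 1 \<le> m \<and> w \<in> {..<m} \<rightarrow>\<^sub>E T \<times> {0..B} \<and>
     (\<forall>x\<in>T. \<exists>i<m. dist x (fst (w i)) \<le> snd (w i))}"

text \<open>The dual step. The packing provided by \<open>integral_covering_duality\<close> is turned into an atomic measure
\<open>\<sigma>\<close> on the net. It satisfies the packing constraints only for balls with centres in \<open>P\<close> and radii in \<open>G\<close>;
since every centre is \<open>\<delta>\<close>-close to \<open>P\<close> and radii are rounded up by at least \<open>\<delta>\<close>, this
still bounds \<open>M\<^sub>\<sigma>(s)\<close> by \<open>c(\<tau> s)\<close>.\<close>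

lemma cover_cost_le:
  fixes c :: "real \<Rightarrow> real"
  assumes P: "finite P" "P \<subseteq> T" and G: "finite G" "G \<noteq> {}" "\<And>t. t \<in> G \<Longrightarrow> 0 \<le> t"
    and net: "\<And>x. x \<in> T \<Longrightarrow> \<exists>p\<in>P. dist x p < \<delta>"
    and \<tau>: "\<And>s. s \<in> space \<beta> \<Longrightarrow> \<tau> s \<in> G \<and> s + \<delta> \<le> \<tau> s"
      "\<And>t. t \<in> G \<Longrightarrow> {s\<in>space \<beta>. \<tau> s = t} \<in> sets \<beta>"
    and \<beta>: "finite_measure \<beta>"
    and dual: "\<And>\<sigma>. atomic_measure_on T \<sigma> \<Longrightarrow> emeasure \<sigma> T \<le> (\<integral>\<^sup>+ s. max_ball_mass T \<sigma> s \<partial>\<beta>)"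
    and c: "\<And>t. 0 \<le> c t"
  obtains S where "S \<subseteq> P \<times> G" "\<And>q. q \<in> P \<Longrightarrow> \<exists>j\<in>S. dist q (fst j) \<le> snd j"
    "(\<Sum>j\<in>S. c (snd j)) \<le> (\<Sum>t\<in>G. c t * measure \<beta> {s\<in>space \<beta>. \<tau> s = t})"
proof -
  obtain p :: "nat \<Rightarrow> 'a" and n where p: "p ` {..<n} = P" "inj_on p {..<n}"
    "\<And>i k. i < k \<Longrightarrow> k < n \<Longrightarrow> dist (p k) \<rho> \<le> dist (p i) \<rho>"
    using enumeration_by_decreasing_key[OF P(1), of "\<lambda>x. dist x \<rho>"] by metis
  have pP: "p i \<in> P" if "i < n" for i using p(1) that by blast
  have pT: "p i \<in> T" if "i < n" for i using pP[OF that] P(2) by blast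
  define inc where "inc i j \<longleftrightarrow> dist (p i) (fst j) \<le> snd j" for i and j :: "'a \<times> real"
  have fin: "finite (P \<times> G)" using P G by simp
  have ex: "\<exists>j\<in>P \<times> G. inc i j" if "i < n" for i
  proof -
    obtain t where "t \<in> G" using G by blast
    then show ?thesis using pP[OF that] G(3) by (intro bexI[of _ "(p i, t)"]) (auto simp: inc_def)
  qed
  have greedy: "inc k j'" if "i < k" "k < n" "j \<in> P \<times> G" "j' \<in> P \<times> G"
    "snd j - dist (fst j) \<rho> \<le> snd j' - dist (fst j') \<rho>" "inc i j" "inc i j'" "inc k j" for i k j j'
  proof -
    have "fst j \<in> T" "fst j' \<in> T" using that P(2) by auto
    then show ?thesis unfolding inc_def
      using that pT[of i] pT[of k] p(3)[of i k]
      by (intro ball_exchange[of "p i" "p k" "fst j" "fst j'" "snd j" "snd j'"]) (auto simp: inc_def)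
  qed
  obtain y S where y: "\<And>i. 0 \<le> y i" and feas: "\<And>j. j \<in> P \<times> G \<Longrightarrow> (\<Sum>i<n. if inc i j then y i else 0) \<le> c (snd j)"
    and S: "S \<subseteq> P \<times> G" "\<And>i. i < n \<Longrightarrow> \<exists>j\<in>S. inc i j" "(\<Sum>j\<in>S. c (snd j)) \<le> (\<Sum>i<n. y i)"
  proof (rule integral_covering_duality[where J = "P \<times> G" and c = "\<lambda>j. c (snd j)" and n = n and A = inc
        and \<kappa> = "\<lambda>j. snd j - dist (fst j) \<rho>"], goal_cases)
    case (4 i k j j')
    then show ?case by (intro greedy[of i k j j'])
  next
    case (5 y S)
    show ?case by (rule 5(1)[of y S]) (fact 5)+
  qed (use fin c ex in auto)
  obtain \<sigma> where \<sigma>: "atomic_measure_on T \<sigma>" and sets: "sets \<sigma> = sets (borel_on T)" and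
    em: "\<And>A. A \<in> sets \<sigma> \<Longrightarrow> emeasure \<sigma> A = ennreal (\<Sum>i<n. if p i \<in> A then y i else 0)"
    using atomic_measure_of_weights[of y n p T] y pT by metis
  have T_sets: "T \<in> sets \<sigma>" using sets compact_T by (auto simp: sets_restrict_space intro!: image_eqI[of _ _ UNIV])
  have mass: "max_ball_mass T \<sigma> s \<le> ennreal (c (\<tau> s))" if s: "s \<in> space \<beta>" for s
    unfolding max_ball_mass_def
  proof (rule SUP_least)
    fix v assume v: "v \<in> T"
    obtain q where q: "q \<in> P" "dist v q < \<delta>" using net[OF v] by blast
    have "{x. dist x v \<le> s} \<in> sets borel"
      by (intro borel_closed closed_Collect_le continuous_intros)
    then have ball: "tree_ball T v s \<in> sets \<sigma>"
      unfolding sets by (auto simp: sets_restrict_space tree_ball_def intro!: image_eqI[of _ _ "{x. dist x v \<le> s}"])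
    have "emeasure \<sigma> (tree_ball T v s) = ennreal (\<Sum>i<n. if p i \<in> tree_ball T v s then y i else 0)"
      by (rule em[OF ball])
    also have "\<dots> \<le> ennreal (\<Sum>i<n. if inc i (q, \<tau> s) then y i else 0)"
    proof (intro ennreal_leI sum_mono)
      fix i assume "i \<in> {..<n}"
      have "inc i (q, \<tau> s)" if "p i \<in> tree_ball T v s"
        using that q \<tau>(1)[OF s] dist_triangle[of "p i" q v] by (auto simp: inc_def tree_ball_def)
      then show "(if p i \<in> tree_ball T v s then y i else 0) \<le> (if inc i (q, \<tau> s) then y i else 0)"
        using y[of i] by auto
    qed
    also have "\<dots> \<le> ennreal (c (\<tau> s))" using feas[of "(q, \<tau> s)"] q \<tau>(1)[OF s] by (intro ennreal_leI) auto
    finally show "emeasure \<sigma> (tree_ball T v s) \<le> ennreal (c (\<tau> s))" .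
  qed
  have "ennreal (\<Sum>i<n. y i) = emeasure \<sigma> T"
    using pT by (subst em[OF T_sets]) (auto intro!: arg_cong[where f=ennreal] sum.cong)
  also have "\<dots> \<le> (\<integral>\<^sup>+ s. max_ball_mass T \<sigma> s \<partial>\<beta>)" by (rule dual[OF \<sigma>])
  also have "\<dots> \<le> (\<integral>\<^sup>+ s. ennreal (c (\<tau> s)) \<partial>\<beta>)" by (intro nn_integral_mono mass)
  also have "\<dots> = (\<Sum>t\<in>G. ennreal (c t) * emeasure \<beta> {s\<in>space \<beta>. \<tau> s = t})"
    using \<tau> by (intro nn_integral_finite_range G(1)) auto
  also have "\<dots> = (\<Sum>t\<in>G. ennreal (c t * measure \<beta> {s\<in>space \<beta>. \<tau> s = t}))"
    using c by (intro sum.cong) (auto simp: finite_measure.emeasure_eq_measure[OF \<beta>] ennreal_mult)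
  also have "\<dots> = ennreal (\<Sum>t\<in>G. c t * measure \<beta> {s\<in>space \<beta>. \<tau> s = t})"
    using c by (intro sum_ennreal) auto
  finally have "(\<Sum>i<n. y i) \<le> (\<Sum>t\<in>G. c t * measure \<beta> {s\<in>space \<beta>. \<tau> s = t})"
    using c by (subst (asm) ennreal_le_iff) (auto intro!: sum_nonneg)
  moreover have "\<exists>j\<in>S. dist q (fst j) \<le> snd j" if "q \<in> P" for q
    using S(2) p(1) that by (auto simp: inc_def)
  ultimately show thesis using that[OF S(1)] S(3) by fastforce
qed

text \<open>Discard balls until the radii are short, then enlarge by the mesh so that the net cover becomes a cover of
\<open>T\<close>. The number \<open>m\<close> of balls enters the bound on the sum; its mean stays bounded later on. A single ball
escapes the bound by the total length, hence the maximum with \<open>b\<close>.\<close>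

lemma marked_cover_of_net_cover:
  assumes \<delta>: "0 < \<delta>" and P: "finite P" "P \<subseteq> T" "P \<noteq> {}" and net: "\<And>x. x \<in> T \<Longrightarrow> \<exists>p\<in>P. dist x p < \<delta>"
    and S: "finite S" "S \<subseteq> T \<times> {0..b}" "\<And>q. q \<in> P \<Longrightarrow> \<exists>j\<in>S. dist q (fst j) \<le> snd j"
  obtains m w where "(m, w) \<in> marked_covers (b + \<delta>)"
    "(\<Sum>i<m. snd (w i)) \<le> max (\<Sum>e\<in>E. len e) b + real m * \<delta>"
    "\<And>g :: real \<Rightarrow> ennreal. (\<Sum>i<m. g (snd (w i))) \<le> (\<Sum>j\<in>S. g (snd j + \<delta>))"
proof -
  define c where "c j = (if j \<in> S then fst j else \<rho>)" for j :: "'a \<times> real"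
  have "\<exists>J c'. J \<subseteq> S \<and> J \<noteq> {} \<and> (\<forall>i. c' i \<in> T) \<and> (\<forall>p\<in>P. \<exists>i\<in>J. dist p (c' i) \<le> snd i) \<and>
    ((\<Sum>i\<in>J. snd i) \<le> (\<Sum>e\<in>E. len e) \<or> card J = 1)"
  proof (rule short_subcover[of S snd P c], goal_cases)
    case (8 J c')
    then show ?case by blast
  next
    case (6 i)
    then show ?case using S(2) root by (auto simp: c_def)
  next
    case (7 p)
    then show ?case using S(3)[of p] by (auto simp: c_def)
  qed (use S P in auto)
  then obtain J c' where J: "J \<subseteq> S" "J \<noteq> {}" and c': "\<And>i. c' i \<in> T" "\<And>p. p \<in> P \<Longrightarrow> \<exists>i\<in>J. dist p (c' i) \<le> snd i"
    and short: "(\<Sum>i\<in>J. snd i) \<le> (\<Sum>e\<in>E. len e) \<or> card J = 1" by metis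
  have finJ: "finite J" using J S finite_subset by blast
  define m where "m = card J"
  have "\<exists>h. bij_betw h {..<m} J" unfolding m_def using ex_bij_betw_nat_finite[OF finJ] by (simp add: atLeast0LessThan)
  then obtain h where h: "bij_betw h {..<m} J" by blast
  have hJ: "h i \<in> J" if "i < m" for i using h that by (auto simp: bij_betw_def)
  define w where "w = (\<lambda>i\<in>{..<m}. (c' (h i), snd (h i) + \<delta>))"
  have reindex: "(\<Sum>i<m. g (snd (w i))) = (\<Sum>j\<in>J. g (snd j + \<delta>))" for g :: "real \<Rightarrow> 'b::comm_monoid_add"
  proof -
    have "(\<Sum>i<m. g (snd (w i))) = (\<Sum>i<m. g (snd (h i) + \<delta>))" by (intro sum.cong) (auto simp: w_def)
    also have "\<dots> = (\<Sum>j\<in>J. g (snd j + \<delta>))" by (rule sum.reindex_bij_betw[OF h])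
    finally show ?thesis .
  qed
  have b: "0 \<le> snd j \<and> snd j \<le> b" if "j \<in> J" for j using J(1) S(2) that by auto
  have "(m, w) \<in> marked_covers (b + \<delta>)"
    unfolding marked_covers_def mem_Collect_eq case_prod_conv
  proof (intro conjI ballI)
    show "1 \<le> m" unfolding m_def using J(2) finJ by (simp add: Suc_leI card_gt_0_iff)
    show "w \<in> {..<m} \<rightarrow>\<^sub>E T \<times> {0..b + \<delta>}" using c' b[OF hJ] \<delta> by (auto simp: w_def intro: add_nonneg_nonneg)
    fix x assume "x \<in> T"
    then obtain p where p: "p \<in> P" "dist x p < \<delta>" using net by blast
    obtain j where j: "j \<in> J" "dist p (c' j) \<le> snd j" using c'(2)[OF p(1)] by blast
    obtain i where i: "i < m" "h i = j" using h j(1) by (auto simp: bij_betw_def)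
    have "dist x (c' j) \<le> snd j + \<delta>" using dist_triangle[of x "c' j" p] p j by simp
    then show "\<exists>i<m. dist x (fst (w i)) \<le> snd (w i)" using i by (auto simp: w_def)
  qed
  moreover have "(\<Sum>i<m. snd (w i)) \<le> max (\<Sum>e\<in>E. len e) b + real m * \<delta>"
  proof -
    have "(\<Sum>j\<in>J. snd j) \<le> max (\<Sum>e\<in>E. len e) b"
      using short
    proof
      assume "card J = 1"
      then obtain j where "J = {j}" by (auto simp: card_1_singleton_iff)
      then show ?thesis using b[of j] by (simp add: le_max_iff_disj)
    qed simp
    moreover have "(\<Sum>i<m. snd (w i)) = (\<Sum>j\<in>J. snd j) + real m * \<delta>"
      using reindex[of "\<lambda>x. x"] by (simp add: sum.distrib m_def)
    ultimately show ?thesis by simp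
  qed
  moreover have "(\<Sum>i<m. g (snd (w i))) \<le> (\<Sum>j\<in>S. g (snd j + \<delta>))" for g :: "real \<Rightarrow> ennreal"
    unfolding reindex using S(1) J(1) by (intro sum_mono2) auto
  ultimately show thesis by (rule that)
qed

end

lemma measurable_marked_size: "fst \<in> (borel :: (nat \<times> (nat \<Rightarrow> 'b::metric_space)) measure) \<rightarrow>\<^sub>M count_space UNIV"
proof -
  have "fst \<in> borel_measurable (borel :: (nat \<times> (nat \<Rightarrow> 'b)) measure)"
    by (intro borel_measurable_continuous_onI continuous_intros)
  then show ?thesis by (simp add: measurable_cong_sets[OF HOL.refl sets_borel_eq_count_space])
qed

lemma continuous_on_mark: "continuous_on UNIV (\<lambda>\<omega>::nat \<times> (nat \<Rightarrow> 'b::metric_space). snd \<omega> i)"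
  by (rule continuous_on_compose2[OF continuous_on_product_coordinates continuous_on_snd[OF continuous_on_id]]) auto

lemma measurable_mark: "(\<lambda>\<omega>::nat \<times> (nat \<Rightarrow> 'b::metric_space). snd \<omega> i) \<in> borel_measurable borel"
  by (rule borel_measurable_continuous_onI[OF continuous_on_mark])

lemma measurable_mark_radius:
  "(\<lambda>\<omega>::nat \<times> (nat \<Rightarrow> 'b::metric_space \<times> real). snd (snd \<omega> i)) \<in> borel_measurable borel"
  by (intro borel_measurable_continuous_onI continuous_on_snd[OF continuous_on_mark])

lemma finite_random_variable:
  fixes X :: "'s set" and \<omega> :: "'s \<Rightarrow> 'b::t1_space"
  assumes X: "finite X" and \<mu>: "\<And>s. 0 \<le> \<mu> s" "(\<Sum>s\<in>X. \<mu> s) = (1::real)"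
  obtains \<nu> where "prob_space \<nu>" "sets \<nu> = sets borel" "AE x in \<nu>. x \<in> \<omega> ` X"
    "\<And>h. h \<in> borel_measurable borel \<Longrightarrow> (\<integral>\<^sup>+ x. h x \<partial>\<nu>) = (\<Sum>s\<in>X. ennreal (\<mu> s) * h (\<omega> s))"
proof -
  let ?M = "point_measure X (\<lambda>s. ennreal (\<mu> s))"
  define \<nu> where "\<nu> = distr ?M borel \<omega>"
  have m: "\<omega> \<in> ?M \<rightarrow>\<^sub>M borel" by (auto simp: measurable_def space_point_measure sets_point_measure)
  have int: "(\<integral>\<^sup>+ x. h x \<partial>\<nu>) = (\<Sum>s\<in>X. ennreal (\<mu> s) * h (\<omega> s))" if "h \<in> borel_measurable borel" for h
    unfolding \<nu>_def using that
    by (subst nn_integral_distr[OF m]) (auto simp: nn_integral_point_measure_finite[OF X])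
  have sets: "sets \<nu> = sets borel" by (simp add: \<nu>_def)
  have sp: "space \<nu> = UNIV" using sets_eq_imp_space_eq[OF sets] by simp
  have "prob_space \<nu>"
  proof
    have "emeasure \<nu> (space \<nu>) = (\<integral>\<^sup>+ x. 1 \<partial>\<nu>)" by simp
    also have "\<dots> = (\<Sum>s\<in>X. ennreal (\<mu> s))" by (subst int) auto
    also have "\<dots> = 1" using \<mu> by (subst sum_ennreal) auto
    finally show "emeasure \<nu> (space \<nu>) = 1" .
  qed
  moreover have "AE x in \<nu>. x \<in> \<omega> ` X"
  proof (rule AE_I')
    have B: "- \<omega> ` X \<in> sets borel"
      using finite_imp_closed[of "\<omega> ` X"] X by (intro borel_open) auto
    have "emeasure \<nu> (- \<omega> ` X) = (\<integral>\<^sup>+ x. indicator (- \<omega> ` X) x \<partial>\<nu>)"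
      using B sets by (intro nn_integral_indicator[symmetric]) auto
    also have "\<dots> = 0" using B by (subst int) auto
    finally show "- \<omega> ` X \<in> null_sets \<nu>" using B sets by (auto simp: null_sets_def)
  qed auto
  ultimately show thesis using that sets int by blast
qed

context tree_coordinates
begin

definition radius_sum :: "(real \<Rightarrow> 'c::comm_monoid_add) \<Rightarrow> nat \<times> (nat \<Rightarrow> 'a \<times> real) \<Rightarrow> 'c" where
  "radius_sum g \<omega> = (\<Sum>i<fst \<omega>. g (snd (snd \<omega> i)))"

lemma measurable_radius_sum:
  fixes g :: "real \<Rightarrow> 'c::{second_countable_topology, topological_comm_monoid_add}"
  assumes "g \<in> borel_measurable borel"
  shows "radius_sum g \<in> borel_measurable borel"
  unfolding radius_sum_def
  by (intro measurable_sum_lessThan_count measurable_marked_size measurable_compose[OF measurable_mark_radius assms])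

lemma marked_covers_mono: "B \<le> B' \<Longrightarrow> marked_covers B \<subseteq> marked_covers B'"
proof
  fix \<omega> assume B: "B \<le> B'" and \<omega>: "\<omega> \<in> marked_covers B"
  obtain m w where "\<omega> = (m, w)" by (cases \<omega>)
  moreover have "({..<m} \<rightarrow>\<^sub>E T \<times> {0..B}) \<subseteq> ({..<m} \<rightarrow>\<^sub>E T \<times> {0..B'})"
    using B by (intro PiE_mono) auto
  ultimately show "\<omega> \<in> marked_covers B'" using \<omega> unfolding marked_covers_def by blast
qed

text \<open>The grid function \<open>\<tau>\<close> rounds a radius up to a multiple of \<open>\<delta>\<close>, adding between \<open>\<delta>\<close> and \<open>2 \<delta>\<close>;
enlarging to a cover of \<open>T\<close> adds another \<open>\<delta>\<close>, which explains the constant \<open>3\<close>.\<close>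

lemma approximate_random_cover:
  assumes R: "0 \<le> R" "R \<le> (\<Sum>e\<in>E. len e)" and \<delta>: "0 < \<delta>" "\<delta> \<le> 1"
    and \<beta>: "finite_borel_measure_on {0..R} \<beta>"
    and dual: "\<And>\<sigma>. atomic_measure_on T \<sigma> \<Longrightarrow> emeasure \<sigma> T \<le> (\<integral>\<^sup>+ s. max_ball_mass T \<sigma> s \<partial>\<beta>)"
  obtains \<nu> :: "(nat \<times> (nat \<Rightarrow> 'a \<times> real)) measure" where "prob_space \<nu>" "sets \<nu> = sets borel"
    "AE \<omega> in \<nu>. \<omega> \<in> marked_covers (R + 3) \<and> radius_sum (\<lambda>r. r) \<omega> \<le> (\<Sum>e\<in>E. len e) + 2 * \<delta> + real (fst \<omega>) * \<delta>"
    "\<And>g :: real \<Rightarrow> ennreal. g \<in> borel_measurable borel \<Longrightarrow>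
      (\<integral>\<^sup>+ \<omega>. radius_sum g \<omega> \<partial>\<nu>) \<le> (\<integral>\<^sup>+ s. g (\<delta> * (real_of_int \<lfloor>s / \<delta>\<rfloor> + 3)) \<partial>\<beta>)"
proof -
  define \<tau> where "\<tau> s = \<delta> * (real_of_int \<lfloor>s / \<delta>\<rfloor> + 2)" for s
  have \<tau>1: "s + \<delta> \<le> \<tau> s" and \<tau>2: "\<tau> s \<le> s + 2 * \<delta>" for s
  proof -
    have "s / \<delta> - 1 \<le> real_of_int \<lfloor>s / \<delta>\<rfloor>" "real_of_int \<lfloor>s / \<delta>\<rfloor> \<le> s / \<delta>" by linarith+
    then have "\<delta> * (s / \<delta> - 1) \<le> \<delta> * real_of_int \<lfloor>s / \<delta>\<rfloor>" "\<delta> * real_of_int \<lfloor>s / \<delta>\<rfloor> \<le> \<delta> * (s / \<delta>)"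
      using \<delta>(1) by (intro mult_left_mono; simp)+
    then show "s + \<delta> \<le> \<tau> s" "\<tau> s \<le> s + 2 * \<delta>" using \<delta>(1) by (auto simp: \<tau>_def algebra_simps)
  qed
  have sets\<beta>: "sets \<beta> = sets (borel_on {0..R})" and fin\<beta>: "finite_measure \<beta>"
    using \<beta> by (auto simp: finite_borel_measure_on_def)
  have sp\<beta>: "space \<beta> = {0..R}" using sets_eq_imp_space_eq[OF sets\<beta>] by (simp add: space_restrict_space)
  define G where "G = \<tau> ` {0..R}"
  have finG: "finite G"
  proof -
    have "\<lfloor>s / \<delta>\<rfloor> \<in> {0..\<lfloor>R / \<delta>\<rfloor>}" if "s \<in> {0..R}" for s
      using that \<delta> by (auto intro!: floor_mono divide_right_mono)
    then have "G \<subseteq> (\<lambda>k. \<delta> * (real_of_int k + 2)) ` {0..\<lfloor>R / \<delta>\<rfloor>}" by (auto simp: G_def \<tau>_def)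
    then show ?thesis by (rule finite_subset) simp
  qed
  have G_bounds: "0 \<le> t \<and> t \<le> R + 2 * \<delta>" if "t \<in> G" for t
    using that \<tau>1 \<tau>2 \<delta> unfolding G_def by (smt (verit, best) atLeastAtMost_iff imageE)
  have \<tau>_meas: "\<tau> \<in> borel_measurable borel" unfolding \<tau>_def by measurable
  have level: "{s\<in>space \<beta>. \<tau> s = t} \<in> sets \<beta>" for t
  proof -
    have "\<tau> -` {t} \<inter> space borel \<in> sets borel" by (rule measurable_sets[OF \<tau>_meas]) simp
    then show ?thesis unfolding sets\<beta> sp\<beta>
      by (auto simp: sets_restrict_space intro!: image_eqI[of _ _ "\<tau> -` {t}"])
  qed
  obtain P where P: "finite P" "P \<subseteq> T" "P \<noteq> {}" "\<And>x. x \<in> T \<Longrightarrow> \<exists>p\<in>P. dist x p < \<delta>"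
  proof (rule finite_net[OF \<delta>(1)], goal_cases)
    case (1 P)
    from 1(2-) show ?case by (rule 1(1))
  qed
  define X where "X = {S. S \<subseteq> P \<times> G \<and> (\<forall>q\<in>P. \<exists>j\<in>S. dist q (fst j) \<le> snd j)}"
  have finX: "finite X" using P(1) finG by (auto simp: X_def intro: finite_subset[of _ "Pow (P \<times> G)"])
  have finS: "finite S" if "S \<in> X" for S using that P(1) finG by (auto simp: X_def intro: finite_subset)
  define N where "N S t = real (card {j\<in>S. snd j = t})" for S :: "('a \<times> real) set" and t
  define b where "b t = measure \<beta> {s\<in>space \<beta>. \<tau> s = t}" for t
  \<comment> \<open>sort the balls of a cover by their radius\<close>
  have group: "(\<Sum>t\<in>G. c t * N S t) = (\<Sum>j\<in>S. c (snd j))" if "S \<in> X" for S and c :: "real \<Rightarrow> real"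
  proof -
    have "(\<Sum>t\<in>G. c t * N S t) = (\<Sum>t\<in>G. \<Sum>j\<in>{j\<in>S. snd j = t}. c (snd j))"
      by (intro sum.cong) (auto simp: N_def)
    also have "\<dots> = (\<Sum>j\<in>S. c (snd j))"
      using that finS[OF that] finG by (intro sum.group) (auto simp: X_def)
    finally show ?thesis .
  qed
  have test: "\<exists>S\<in>X. (\<Sum>t\<in>G. c t * N S t) \<le> (\<Sum>t\<in>G. c t * b t)" if c: "\<And>t. 0 \<le> c t" for c
  proof (rule cover_cost_le[of P G \<delta> \<beta> \<tau> c], goal_cases)
    case (12 S)
    then have "S \<in> X" by (auto simp: X_def)
    then show ?case using 12(3) group[of S c] by (intro bexI[of _ S]) (auto simp: b_def)
  next
    case (5 t)
    then show ?case using G_bounds by blast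
  next
    case (6 x)
    then show ?case by (rule P(4))
  next
    case (7 s)
    then show ?case using \<tau>1 by (simp add: sp\<beta> G_def)
  next
    case (8 t)
    show ?case by (rule level)
  next
    case (10 \<sigma>)
    then show ?case by (rule dual)
  next
    case (11 t)
    show ?case by (rule c)
  qed (use P finG R fin\<beta> in \<open>auto simp: G_def\<close>)
  have "X \<noteq> {}" using test[of "\<lambda>_. 0"] by auto
  obtain \<mu> where \<mu>: "\<And>S. 0 \<le> \<mu> S" "(\<Sum>S\<in>X. \<mu> S) = 1" "\<And>t. t \<in> G \<Longrightarrow> (\<Sum>S\<in>X. \<mu> S * N S t) \<le> b t"
    using finite_minimax[OF finX \<open>X \<noteq> {}\<close> finG test] by metis
  have "\<exists>\<omega>. \<omega> \<in> marked_covers (R + 3) \<and> radius_sum (\<lambda>r. r) \<omega> \<le> (\<Sum>e\<in>E. len e) + 2 * \<delta> + real (fst \<omega>) * \<delta> \<and>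
     (\<forall>g :: real \<Rightarrow> ennreal. radius_sum g \<omega> \<le> (\<Sum>j\<in>S. g (snd j + \<delta>)))" if S: "S \<in> X" for S
  proof -
    have sub: "S \<subseteq> T \<times> {0..R + 2 * \<delta>}" 
    proof
      fix j assume "j \<in> S"
      then have "fst j \<in> P" "snd j \<in> G" using S by (auto simp: X_def)
      then show "j \<in> T \<times> {0..R + 2 * \<delta>}" using P(2) G_bounds[of "snd j"] by (cases j) auto
    qed
    have cov: "\<exists>j\<in>S. dist q (fst j) \<le> snd j" if "q \<in> P" for q using S that by (auto simp: X_def)
    obtain m w where mw: "(m, w) \<in> marked_covers (R + 2 * \<delta> + \<delta>)"
      "(\<Sum>i<m. snd (w i)) \<le> max (\<Sum>e\<in>E. len e) (R + 2 * \<delta>) + real m * \<delta>"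
      "\<And>g :: real \<Rightarrow> ennreal. (\<Sum>i<m. g (snd (w i))) \<le> (\<Sum>j\<in>S. g (snd j + \<delta>))"
    proof (rule marked_cover_of_net_cover[OF \<delta>(1) P(1,2,3) _ finS[OF S] sub], goal_cases)
      case (1 x)
      from 1(2) show ?case by (rule P(4))
    next
      case (2 q)
      from 2(2) show ?case by (rule cov)
    next
      case (3 m w)
      from 3(2-) show ?case by (rule 3(1))
    qed
    have "(m, w) \<in> marked_covers (R + 3)"
      using marked_covers_mono[of "R + 2 * \<delta> + \<delta>" "R + 3"] mw(1) \<delta> by auto
    moreover have "max (\<Sum>e\<in>E. len e) (R + 2 * \<delta>) \<le> (\<Sum>e\<in>E. len e) + 2 * \<delta>" using R \<delta> by auto
    ultimately show ?thesis using mw(2,3) by (intro exI[of _ "(m, w)"]) (auto simp: radius_sum_def)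
  qed
  then obtain \<omega> where \<omega>: "\<And>S. S \<in> X \<Longrightarrow> \<omega> S \<in> marked_covers (R + 3)"
    "\<And>S. S \<in> X \<Longrightarrow> radius_sum (\<lambda>r. r) (\<omega> S) \<le> (\<Sum>e\<in>E. len e) + 2 * \<delta> + real (fst (\<omega> S)) * \<delta>"
    "\<And>S g. S \<in> X \<Longrightarrow> radius_sum (g :: real \<Rightarrow> ennreal) (\<omega> S) \<le> (\<Sum>j\<in>S. g (snd j + \<delta>))"
    by metis
  obtain \<nu> :: "(nat \<times> (nat \<Rightarrow> 'a \<times> real)) measure" where
    \<nu>: "prob_space \<nu>" "sets \<nu> = sets borel" "AE x in \<nu>. x \<in> \<omega> ` X" and
    int: "\<And>h. h \<in> borel_measurable borel \<Longrightarrow> (\<integral>\<^sup>+ x. h x \<partial>\<nu>) = (\<Sum>S\<in>X. ennreal (\<mu> S) * h (\<omega> S))"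
  proof (rule finite_random_variable[OF finX \<mu>(1,2), of \<omega>], goal_cases)
    case (1 \<nu>)
    from 1(2-) show ?case by (rule 1(1))
  qed
  show thesis
  proof (rule that[OF \<nu>(1,2)])
    show "AE \<omega> in \<nu>. \<omega> \<in> marked_covers (R + 3) \<and> radius_sum (\<lambda>r. r) \<omega> \<le> (\<Sum>e\<in>E. len e) + 2 * \<delta> + real (fst \<omega>) * \<delta>"
      using \<nu>(3) by eventually_elim (use \<omega> in auto)
    fix g :: "real \<Rightarrow> ennreal" assume g: "g \<in> borel_measurable borel"
    have "(\<integral>\<^sup>+ x. radius_sum g x \<partial>\<nu>) = (\<Sum>S\<in>X. ennreal (\<mu> S) * radius_sum g (\<omega> S))"
      by (rule int[OF measurable_radius_sum[OF g]])
    also have "\<dots> \<le> (\<Sum>S\<in>X. ennreal (\<mu> S) * (\<Sum>t\<in>G. g (t + \<delta>) * ennreal (N S t)))"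
    proof (intro sum_mono mult_left_mono)
      fix S assume S: "S \<in> X"
      have "(\<Sum>j\<in>S. g (snd j + \<delta>)) = (\<Sum>t\<in>G. \<Sum>j\<in>{j\<in>S. snd j = t}. g (snd j + \<delta>))"
        using S finS[OF S] finG by (intro sum.group[symmetric]) (auto simp: X_def)
      also have "\<dots> = (\<Sum>t\<in>G. g (t + \<delta>) * ennreal (N S t))"
        by (intro sum.cong) (auto simp: N_def ennreal_of_nat_eq_real_of_nat mult.commute)
      finally show "radius_sum g (\<omega> S) \<le> (\<Sum>t\<in>G. g (t + \<delta>) * ennreal (N S t))" using \<omega>(3)[OF S, of g] by simp
    qed simp
    also have "\<dots> = (\<Sum>t\<in>G. g (t + \<delta>) * (\<Sum>S\<in>X. ennreal (\<mu> S) * ennreal (N S t)))"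
      unfolding sum_distrib_left by (subst sum.swap) (simp add: mult_ac)
    also have "\<dots> = (\<Sum>t\<in>G. g (t + \<delta>) * ennreal (\<Sum>S\<in>X. \<mu> S * N S t))"
      using \<mu>(1) by (simp add: ennreal_mult[symmetric] sum_ennreal N_def)
    also have "\<dots> \<le> (\<Sum>t\<in>G. g (t + \<delta>) * emeasure \<beta> {s\<in>space \<beta>. \<tau> s = t})"
      using \<mu>(3) by (intro sum_mono mult_left_mono)
        (auto simp: b_def finite_measure.emeasure_eq_measure[OF fin\<beta>] intro!: ennreal_leI)
    also have "\<dots> = (\<integral>\<^sup>+ s. g (\<tau> s + \<delta>) \<partial>\<beta>)"
      using level finG by (intro nn_integral_finite_range[symmetric]) (auto simp: G_def sp\<beta>)
    also have "\<dots> = (\<integral>\<^sup>+ s. g (\<delta> * (real_of_int \<lfloor>s / \<delta>\<rfloor> + 3)) \<partial>\<beta>)"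
      by (simp add: \<tau>_def algebra_simps)
    finally show "(\<integral>\<^sup>+ x. radius_sum g x \<partial>\<nu>) \<le> (\<integral>\<^sup>+ s. g (\<delta> * (real_of_int \<lfloor>s / \<delta>\<rfloor> + 3)) \<partial>\<beta>)" .
  qed
qed

text \<open>For a fixed number of balls the marked tuples form a compact product, and covering \<open>T\<close> is a closed condition:
for each \<open>x\<close> it is a finite union of weak inequalities.\<close>

lemma compact_marked_covers: "compact {\<omega> \<in> marked_covers B. fst \<omega> = k}"
proof (cases "1 \<le> k")
  case False
  then have "{\<omega> \<in> marked_covers B. fst \<omega> = k} = {}" by (auto simp: marked_covers_def)
  then show ?thesis by (simp only: compact_empty)
next
  case True
  define I where "I i = (if i < k then T \<times> {0..B} else {undefined})" for i :: nat
  have "compactin (product_topology (\<lambda>_. euclidean) UNIV) (PiE UNIV I)"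
    by (subst compactin_PiE) (auto simp: I_def compact_T compact_Times)
  then have 1: "compact (PiE UNIV I)" by (simp add: euclidean_product_topology)
  have coord: "continuous_on UNIV (\<lambda>w::nat \<Rightarrow> 'a \<times> real. w i)" for i by (rule continuous_on_product_coordinates)
  have "closed {w::nat \<Rightarrow> 'a \<times> real. dist x (fst (w i)) \<le> snd (w i)}" for x i
    by (intro closed_Collect_le continuous_on_dist continuous_on_const continuous_on_fst continuous_on_snd coord)
  then have "closed (\<Inter>x\<in>T. \<Union>i\<in>{..<k}. {w::nat \<Rightarrow> 'a \<times> real. dist x (fst (w i)) \<le> snd (w i)})"
    by (intro closed_INT closed_UN ballI) auto
  with 1 have "compact (PiE UNIV I \<inter> (\<Inter>x\<in>T. \<Union>i\<in>{..<k}. {w. dist x (fst (w i)) \<le> snd (w i)}))"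
    by (rule compact_Int_closed)
  moreover have "PiE UNIV I = ({..<k} \<rightarrow>\<^sub>E T \<times> {0..B})"
    by (auto simp: PiE_def Pi_def I_def extensional_def split: if_splits)
  ultimately have "compact ({k} \<times> (({..<k} \<rightarrow>\<^sub>E T \<times> {0..B}) \<inter> (\<Inter>x\<in>T. \<Union>i\<in>{..<k}. {w. dist x (fst (w i)) \<le> snd (w i)})))"
    by (intro compact_Times) auto
  also have "{k} \<times> (({..<k} \<rightarrow>\<^sub>E T \<times> {0..B}) \<inter> (\<Inter>x\<in>T. \<Union>i\<in>{..<k}. {w. dist x (fst (w i)) \<le> snd (w i)})) =
      {\<omega> \<in> marked_covers B. fst \<omega> = k}"
  proof (rule set_eqI)
    fix \<omega> :: "nat \<times> (nat \<Rightarrow> 'a \<times> real)"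
    obtain m w where \<omega>: "\<omega> = (m, w)" by (cases \<omega>)
    show "\<omega> \<in> {k} \<times> (({..<k} \<rightarrow>\<^sub>E T \<times> {0..B}) \<inter> (\<Inter>x\<in>T. \<Union>i\<in>{..<k}. {w. dist x (fst (w i)) \<le> snd (w i)})) \<longleftrightarrow>
        \<omega> \<in> {\<omega> \<in> marked_covers B. fst \<omega> = k}"
      unfolding \<omega> marked_covers_def using True by (simp del: PiE_iff) blast
  qed
  finally show ?thesis .
qed

end

section \<open>Passage to the limit\<close>

lemma AE_le_zero_if_integral_le_zero:
  fixes f :: "'b \<Rightarrow> real"
  assumes "integrable M f" "\<And>x. 0 \<le> f x" "integral\<^sup>L M f \<le> 0"
  shows "AE x in M. f x = 0"
  using integral_nonneg_eq_0_iff_AE[of M f] assms by (auto simp: antisym integral_nonneg)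

lemma ennreal_eq_SUP_min: "0 \<le> x \<Longrightarrow> ennreal x = (SUP K::nat. ennreal (min (real K) x))"
proof (rule antisym)
  assume x: "0 \<le> x"
  have "x \<le> real (nat \<lceil>x\<rceil>)" by linarith
  then have "min (real (nat \<lceil>x\<rceil>)) x = x" by simp
  then show "ennreal x \<le> (SUP K::nat. ennreal (min (real K) x))"
    by (intro SUP_upper2[of "nat \<lceil>x\<rceil>"]) auto
  show "(SUP K::nat. ennreal (min (real K) x)) \<le> ennreal x"
    by (intro SUP_least ennreal_leI) auto
qed

context tree_coordinates
begin

lemma continuous_radius_sum:
  fixes \<phi> :: "real \<Rightarrow> real"
  assumes \<phi>: "continuous_on UNIV \<phi>"
  shows "continuous_on {\<omega>\<in>A. fst \<omega> = k} (radius_sum \<phi>)"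
proof (rule continuous_on_eq)
  have "continuous_on UNIV (\<lambda>\<omega>::nat \<times> (nat \<Rightarrow> 'a \<times> real). \<phi> (snd (snd \<omega> i)))" for i
    by (rule continuous_on_compose2[OF \<phi> continuous_on_snd[OF continuous_on_mark]]) auto
  then have "continuous_on UNIV (\<lambda>\<omega>::nat \<times> (nat \<Rightarrow> 'a \<times> real). \<Sum>i<k. \<phi> (snd (snd \<omega> i)))"
    by (intro continuous_on_sum)
  then show "continuous_on {\<omega>\<in>A. fst \<omega> = k} (\<lambda>\<omega>. \<Sum>i<k. \<phi> (snd (snd \<omega> i)))"
    by (rule continuous_on_subset) auto
qed (auto simp: radius_sum_def)

lemma ennreal_radius_sum:
  assumes "\<And>r. 0 \<le> \<phi> r"
  shows "ennreal (radius_sum \<phi> \<omega>) = radius_sum (\<lambda>r. ennreal (\<phi> r)) \<omega>"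
  unfolding radius_sum_def using assms by (simp add: sum_ennreal)

text \<open>Take meshes \<open>1 / (n + 1)\<close> and a limit law \<open>M\<close>. The bound on the radius sum passes to the limit because
its error has mean at most \<open>(2 + b) \<delta>\<close>, where \<open>b\<close> is the mass of \<open>\<beta>\<close> and bounds the mean number of balls.
The intensity bound passes to the limit for truncated sums of continuous functions, is extended to
closed sets by approximating their indicators from above, and to Borel sets by inner regularity.\<close>

theorem exact_random_cover:
  assumes R: "0 \<le> R" "R \<le> (\<Sum>e\<in>E. len e)"
    and \<beta>: "finite_borel_measure_on {0..R} \<beta>"
    and dual: "\<And>\<sigma>. atomic_measure_on T \<sigma> \<Longrightarrow> emeasure \<sigma> T \<le> (\<integral>\<^sup>+ s. max_ball_mass T \<sigma> s \<partial>\<beta>)"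
  obtains \<nu> :: "(nat \<times> (nat \<Rightarrow> 'a \<times> real)) measure" where "prob_space \<nu>" "sets \<nu> = sets borel"
    "AE \<omega> in \<nu>. \<omega> \<in> marked_covers (R + 3) \<and> radius_sum (\<lambda>r. r) \<omega> \<le> (\<Sum>e\<in>E. len e)"
    "\<And>A. A \<in> sets borel \<Longrightarrow> (\<integral>\<^sup>+ \<omega>. radius_sum (indicator A) \<omega> \<partial>\<nu>) \<le> emeasure (distr \<beta> borel (\<lambda>s. s)) A"
proof -
  define L where "L = (\<Sum>e\<in>E. len e)"
  let ?X = "marked_covers (R + 3)"
  define \<delta> where "\<delta> n = 1 / real (Suc n)" for n
  have \<delta>: "0 < \<delta> n" "\<delta> n \<le> 1" for n by (auto simp: \<delta>_def)
  have \<delta>_lim: "\<delta> \<longlonglongrightarrow> 0" unfolding \<delta>_def using LIMSEQ_inverse_real_of_nat by (simp add: inverse_eq_divide)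
  define \<tau> where "\<tau> n s = \<delta> n * (real_of_int \<lfloor>s / \<delta> n\<rfloor> + 3)" for n s
  have sets\<beta>: "sets \<beta> = sets (borel_on {0..R})" and fin\<beta>: "finite_measure \<beta>"
    using \<beta> by (auto simp: finite_borel_measure_on_def)
  interpret \<beta>: finite_measure \<beta> by (rule fin\<beta>)
  have id_meas: "(\<lambda>s. s) \<in> borel_measurable \<beta>"
    unfolding measurable_cong_sets[OF sets\<beta> HOL.refl] by (rule measurable_restrict_space1) simp
  have into\<beta>: "g \<in> borel_measurable \<beta>" if "g \<in> borel_measurable borel" for g :: "real \<Rightarrow> real"
    using measurable_compose[OF id_meas that] by simp
  define b where "b = measure \<beta> (space \<beta>)"
  define P where "P n \<nu> \<longleftrightarrow> prob_space \<nu> \<and> sets \<nu> = sets borel \<and>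
    (AE \<omega> in \<nu>. \<omega> \<in> ?X \<and> radius_sum (\<lambda>r. r) \<omega> \<le> L + 2 * \<delta> n + real (fst \<omega>) * \<delta> n) \<and>
    (\<forall>g::real \<Rightarrow> ennreal. g \<in> borel_measurable borel \<longrightarrow>
      (\<integral>\<^sup>+ \<omega>. radius_sum g \<omega> \<partial>\<nu>) \<le> (\<integral>\<^sup>+ s. g (\<tau> n s) \<partial>\<beta>))" for n and \<nu> :: "(nat \<times> (nat \<Rightarrow> 'a \<times> real)) measure"
  have "\<exists>\<nu>. P n \<nu>" for n
  proof (rule approximate_random_cover[OF R \<delta> \<beta>, of n], goal_cases)
    case (1 \<sigma>)
    then show ?case by (rule dual)
  next
    case (2 \<nu>)
    then show ?case unfolding P_def L_def \<tau>_def by blast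
  qed
  then obtain \<nu> where P: "\<And>n. P n (\<nu> n)" by metis
  have prob: "prob_space (\<nu> n)" and sets: "sets (\<nu> n) = sets borel"
    and supp: "AE \<omega> in \<nu> n. \<omega> \<in> ?X \<and> radius_sum (\<lambda>r. r) \<omega> \<le> L + 2 * \<delta> n + real (fst \<omega>) * \<delta> n" for n
    using P[of n] by (auto simp: P_def)
  have int: "(\<integral>\<^sup>+ \<omega>. radius_sum g \<omega> \<partial>\<nu> n) \<le> (\<integral>\<^sup>+ s. g (\<tau> n s) \<partial>\<beta>)"
    if "g \<in> borel_measurable borel" for g :: "real \<Rightarrow> ennreal" and n
    using P[of n] that by (auto simp: P_def)
  have count: "radius_sum (\<lambda>_. 1) \<omega> = ennreal (real (fst \<omega>))" for \<omega> :: "nat \<times> (nat \<Rightarrow> 'a \<times> real)"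
    by (simp add: radius_sum_def ennreal_of_nat_eq_real_of_nat)
  have mean_count: "(\<integral>\<^sup>+ \<omega>. ennreal (real (fst \<omega>)) \<partial>\<nu> n) \<le> ennreal b" for n
    using int[of "\<lambda>_. 1" n] by (simp add: count b_def \<beta>.emeasure_eq_measure)
  have meas_count: "(\<lambda>\<omega>. real (fst \<omega>)) \<in> borel_measurable (borel :: (nat \<times> (nat \<Rightarrow> 'a \<times> real)) measure)"
    by (rule measurable_compose[OF measurable_marked_size]) simp
  have into\<nu>: "h \<in> measurable (\<nu> n) N \<longleftrightarrow> h \<in> measurable borel N" for h N n
    by (simp add: measurable_cong_sets[OF sets HOL.refl])
  \<comment> \<open>Markov's inequality for the number of balls\<close>
  have tight: "\<exists>m. \<forall>n. measure (\<nu> n) {\<omega>. m < fst \<omega>} \<le> \<epsilon>" if \<epsilon>: "0 < \<epsilon>" for \<epsilon>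
  proof -
    obtain m :: nat where m: "b / \<epsilon> \<le> real m" using real_arch_simple by blast
    have "measure (\<nu> n) {\<omega>. m < fst \<omega>} \<le> \<epsilon>" for n
    proof -
      interpret \<nu>: prob_space "\<nu> n" by (rule prob)
      have ev: "{\<omega>. m < fst \<omega>} \<in> sets (\<nu> n)"
        using measurable_sets[OF measurable_marked_size, of "{m<..}"] by (simp add: sets vimage_def)
      have "ennreal (real (Suc m) * measure (\<nu> n) {\<omega>. m < fst \<omega>}) =
          (\<integral>\<^sup>+ \<omega>. ennreal (real (Suc m)) * indicator {\<omega>. m < fst \<omega>} \<omega> \<partial>\<nu> n)"
        using ev by (subst nn_integral_cmult_indicator) (auto simp: \<nu>.emeasure_eq_measure ennreal_mult)
      also have "\<dots> \<le> (\<integral>\<^sup>+ \<omega>. ennreal (real (fst \<omega>)) \<partial>\<nu> n)"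
        by (intro nn_integral_mono) (auto simp: indicator_def simp del: of_nat_Suc intro!: ennreal_leI)
      also have "\<dots> \<le> ennreal b" by (rule mean_count)
      finally have "real (Suc m) * measure (\<nu> n) {\<omega>. m < fst \<omega>} \<le> b"
        by (subst (asm) ennreal_le_iff) (auto simp: b_def)
      also have "b \<le> real (Suc m) * \<epsilon>" using m \<epsilon> by (simp add: field_simps)
      finally show ?thesis by (simp del: of_nat_Suc)
    qed
    then show ?thesis by blast
  qed
  obtain s and M :: "(nat \<times> (nat \<Rightarrow> 'a \<times> real)) measure" where s: "strict_mono s" and M: "prob_space M" "sets M = sets borel" "AE \<omega> in M. \<omega> \<in> ?X"
    and conv: "\<And>f B. f \<in> borel_measurable borel \<Longrightarrow> (\<And>k. continuous_on {\<omega>\<in>?X. fst \<omega> = k} f) \<Longrightarrow>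
      (\<And>\<omega>. \<omega> \<in> ?X \<Longrightarrow> \<bar>f \<omega>\<bar> \<le> B) \<Longrightarrow>
      (\<lambda>n. integral\<^sup>L (\<nu> (s n)) f) \<longlonglongrightarrow> (integral\<^sup>L M f :: real)"
  proof (rule tight_sequence_on_disjoint_union[where X = ?X and \<nu> = \<nu>], goal_cases)
    case (1 k)
    show ?case by (rule compact_marked_covers)
  next
    case (2 n)
    show ?case by (rule prob)
  next
    case (3 n)
    show ?case by (rule sets)
  next
    case (4 n)
    show ?case using supp[of n] by eventually_elim simp
  next
    case (5 \<epsilon>)
    from 5(2) show ?case by (rule tight)
  next
    case (6 s M)
    from 6(2-) show ?case by (rule 6(1))
  qed
  interpret M: prob_space M by (rule M(1))
  have intoM: "h \<in> measurable M N \<longleftrightarrow> h \<in> measurable borel N" for h N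
    by (simp add: measurable_cong_sets[OF M(2) HOL.refl])
  have \<delta>s: "(\<lambda>n. \<delta> (s n)) \<longlonglongrightarrow> 0"
    using LIMSEQ_subseq_LIMSEQ[OF \<delta>_lim s] by (simp add: comp_def)
  have total: "AE \<omega> in M. radius_sum (\<lambda>r. r) \<omega> \<le> L"
  proof -
    define f where "f \<omega> = min 1 (max 0 (radius_sum (\<lambda>r. r) \<omega> - L))" for \<omega> :: "nat \<times> (nat \<Rightarrow> 'a \<times> real)"
    have f_meas: "f \<in> borel_measurable borel"
      unfolding f_def using measurable_radius_sum[of "\<lambda>r. r"] by measurable
    have f01: "0 \<le> f \<omega>" "f \<omega> \<le> 1" for \<omega> by (auto simp: f_def)
    have lim: "(\<lambda>n. integral\<^sup>L (\<nu> (s n)) f) \<longlonglongrightarrow> integral\<^sup>L M f"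
    proof (rule conv[OF f_meas, of 1])
      show "continuous_on {\<omega>\<in>?X. fst \<omega> = k} f" for k
        unfolding f_def by (intro continuous_intros continuous_radius_sum)
    qed (use f01 in auto)
    have bound: "integral\<^sup>L (\<nu> n) f \<le> (2 + b) * \<delta> n" for n
    proof -
      have "integral\<^sup>L (\<nu> n) f = enn2real (\<integral>\<^sup>+ \<omega>. ennreal (f \<omega>) \<partial>\<nu> n)"
        using f_meas f01 by (intro integral_eq_nn_integral) (auto simp: into\<nu>)
      also have "\<dots> \<le> (2 + b) * \<delta> n"
      proof (rule enn2real_leI)
        have "(\<integral>\<^sup>+ \<omega>. ennreal (f \<omega>) \<partial>\<nu> n) \<le>
            (\<integral>\<^sup>+ \<omega>. ennreal (2 * \<delta> n) + ennreal (\<delta> n) * ennreal (real (fst \<omega>)) \<partial>\<nu> n)"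
        proof (rule nn_integral_mono_AE)
          show "AE \<omega> in \<nu> n. ennreal (f \<omega>) \<le> ennreal (2 * \<delta> n) + ennreal (\<delta> n) * ennreal (real (fst \<omega>))"
            using supp[of n]
          proof eventually_elim
            case (elim \<omega>)
            have "0 \<le> 2 * \<delta> n + \<delta> n * real (fst \<omega>)" using \<delta>[of n] by (intro add_nonneg_nonneg mult_nonneg_nonneg) auto
            then have "f \<omega> \<le> 2 * \<delta> n + \<delta> n * real (fst \<omega>)" using elim by (auto simp: f_def mult.commute)
            then have "ennreal (f \<omega>) \<le> ennreal (2 * \<delta> n + \<delta> n * real (fst \<omega>))" by (rule ennreal_leI)
            also have "\<dots> = ennreal (2 * \<delta> n) + ennreal (\<delta> n) * ennreal (real (fst \<omega>))"
              using \<delta>[of n] by (subst ennreal_plus) (auto simp: ennreal_mult less_imp_le)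
            finally show ?case .
          qed
        qed
        also have "\<dots> = ennreal (2 * \<delta> n) + ennreal (\<delta> n) * (\<integral>\<^sup>+ \<omega>. ennreal (real (fst \<omega>)) \<partial>\<nu> n)"
          using meas_count prob_space.emeasure_space_1[OF prob[of n]]
          by (subst nn_integral_add) (auto simp: into\<nu> nn_integral_cmult)
        also have "\<dots> \<le> ennreal (2 * \<delta> n) + ennreal (\<delta> n) * ennreal b"
          by (intro add_left_mono mult_left_mono mean_count) auto
        also have "\<dots> = ennreal ((2 + b) * \<delta> n)"
          using \<delta>[of n] by (simp add: ennreal_mult[symmetric] ennreal_plus[symmetric] b_def algebra_simps del: ennreal_plus)
        finally show "(\<integral>\<^sup>+ \<omega>. ennreal (f \<omega>) \<partial>\<nu> n) \<le> ennreal ((2 + b) * \<delta> n)" .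
      qed (use \<delta>[of n] in \<open>auto simp: b_def\<close>)
      finally show ?thesis .
    qed
    have "(\<lambda>n. (2 + b) * \<delta> (s n)) \<longlonglongrightarrow> (2 + b) * 0" by (intro tendsto_intros \<delta>s)
    then have "integral\<^sup>L M f \<le> 0" using LIMSEQ_le[OF lim] bound by auto
    moreover have "integrable M f"
      using f_meas f01 by (intro M.integrable_const_bound[of _ 1]) (auto simp: intoM)
    ultimately have "AE \<omega> in M. f \<omega> = 0" using f01 by (intro AE_le_zero_if_integral_le_zero)
    then show ?thesis by eventually_elim (auto simp: f_def min_def max_def split: if_splits)
  qed
  have \<tau>_lim: "(\<lambda>n. \<tau> (s n) r) \<longlonglongrightarrow> r" for r
  proof (rule tendsto_sandwich[where f = "\<lambda>n. r + 2 * \<delta> (s n)" and h = "\<lambda>n. r + 3 * \<delta> (s n)"])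
    have *: "r + 2 * \<delta> n \<le> \<tau> n r \<and> \<tau> n r \<le> r + 3 * \<delta> n" for n
    proof -
      have "r / \<delta> n - 1 \<le> real_of_int \<lfloor>r / \<delta> n\<rfloor>" "real_of_int \<lfloor>r / \<delta> n\<rfloor> \<le> r / \<delta> n" by linarith+
      then have "\<delta> n * (r / \<delta> n - 1) \<le> \<delta> n * real_of_int \<lfloor>r / \<delta> n\<rfloor>"
        "\<delta> n * real_of_int \<lfloor>r / \<delta> n\<rfloor> \<le> \<delta> n * (r / \<delta> n)"
        using \<delta>(1)[of n] by (intro mult_left_mono; simp)+
      then show ?thesis using \<delta>(1)[of n] by (auto simp: \<tau>_def algebra_simps)
    qed
    then show "\<forall>\<^sub>F n in sequentially. r + 2 * \<delta> (s n) \<le> \<tau> (s n) r"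
      "\<forall>\<^sub>F n in sequentially. \<tau> (s n) r \<le> r + 3 * \<delta> (s n)" by auto
    have "(\<lambda>n. r + 2 * \<delta> (s n)) \<longlonglongrightarrow> r + 2 * 0" by (intro tendsto_intros \<delta>s)
    then show "(\<lambda>n. r + 2 * \<delta> (s n)) \<longlonglongrightarrow> r" by simp
    have "(\<lambda>n. r + 3 * \<delta> (s n)) \<longlonglongrightarrow> r + 3 * 0" by (intro tendsto_intros \<delta>s)
    then show "(\<lambda>n. r + 3 * \<delta> (s n)) \<longlonglongrightarrow> r" by simp
  qed
  have \<tau>_meas: "\<tau> n \<in> borel_measurable borel" for n unfolding \<tau>_def by measurable
  \<comment> \<open>sums over the tuple are unbounded, hence the truncation at \<open>K\<close> before passing to the limit\<close>
  have smooth: "(\<integral>\<^sup>+ \<omega>. radius_sum (\<lambda>r. ennreal (\<phi> r)) \<omega> \<partial>M) \<le> ennreal (integral\<^sup>L \<beta> \<phi>)"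
    if \<phi>: "continuous_on UNIV \<phi>" "\<And>r. 0 \<le> \<phi> r" "\<And>r. \<phi> r \<le> 1" for \<phi> :: "real \<Rightarrow> real"
  proof -
    have \<phi>_meas: "\<phi> \<in> borel_measurable borel" by (rule borel_measurable_continuous_onI[OF \<phi>(1)])
    have comp_meas: "(\<lambda>r. \<phi> (\<tau> n r)) \<in> borel_measurable \<beta>" for n
      by (rule into\<beta>[OF measurable_compose[OF \<tau>_meas \<phi>_meas]])
    have lim\<beta>: "(\<lambda>n. integral\<^sup>L \<beta> (\<lambda>r. \<phi> (\<tau> (s n) r))) \<longlonglongrightarrow> integral\<^sup>L \<beta> \<phi>"
    proof (rule integral_dominated_convergence[where w = "\<lambda>_. 1"])
      show "AE r in \<beta>. (\<lambda>n. \<phi> (\<tau> (s n) r)) \<longlonglongrightarrow> \<phi> r"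
        using continuous_on_tendsto_compose[OF \<phi>(1) \<tau>_lim] by simp
    qed (use comp_meas into\<beta>[OF \<phi>_meas] \<phi> in auto)
    have rs0: "0 \<le> radius_sum \<phi> \<omega>" for \<omega> :: "nat \<times> (nat \<Rightarrow> 'a \<times> real)"
      unfolding radius_sum_def using \<phi>(2) by (intro sum_nonneg) auto
    have cut: "(\<integral>\<^sup>+ \<omega>. ennreal (min (real K) (radius_sum \<phi> \<omega>)) \<partial>M) \<le> ennreal (integral\<^sup>L \<beta> \<phi>)" for K
    proof -
      define f where "f \<omega> = min (real K) (radius_sum \<phi> \<omega>)" for \<omega> :: "nat \<times> (nat \<Rightarrow> 'a \<times> real)"
      have f_meas: "f \<in> borel_measurable borel"
        unfolding f_def using measurable_radius_sum[OF \<phi>_meas] by measurable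
      have f0: "0 \<le> f \<omega>" "f \<omega> \<le> real K" for \<omega> using rs0[of \<omega>] by (auto simp: f_def)
      have lim: "(\<lambda>n. integral\<^sup>L (\<nu> (s n)) f) \<longlonglongrightarrow> integral\<^sup>L M f"
      proof (rule conv[OF f_meas, of "real K"])
        show "continuous_on {\<omega>\<in>?X. fst \<omega> = k} f" for k
          unfolding f_def by (intro continuous_intros continuous_radius_sum \<phi>(1))
      qed (use f0 in auto)
      have "integral\<^sup>L (\<nu> n) f \<le> integral\<^sup>L \<beta> (\<lambda>r. \<phi> (\<tau> n r))" for n
      proof -
        have "integral\<^sup>L (\<nu> n) f = enn2real (\<integral>\<^sup>+ \<omega>. ennreal (f \<omega>) \<partial>\<nu> n)"
          using f_meas f0 by (intro integral_eq_nn_integral) (auto simp: into\<nu>)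
        also have "\<dots> \<le> integral\<^sup>L \<beta> (\<lambda>r. \<phi> (\<tau> n r))"
        proof (rule enn2real_leI)
          have "(\<integral>\<^sup>+ \<omega>. ennreal (f \<omega>) \<partial>\<nu> n) \<le> (\<integral>\<^sup>+ \<omega>. radius_sum (\<lambda>r. ennreal (\<phi> r)) \<omega> \<partial>\<nu> n)"
            using \<phi>(2) by (intro nn_integral_mono) (auto simp: f_def ennreal_radius_sum[symmetric] intro!: ennreal_leI)
          also have "\<dots> \<le> (\<integral>\<^sup>+ r. ennreal (\<phi> (\<tau> n r)) \<partial>\<beta>)"
            using \<phi>_meas by (intro int) measurable
          also have "\<dots> = ennreal (integral\<^sup>L \<beta> (\<lambda>r. \<phi> (\<tau> n r)))"
            using comp_meas \<phi> by (intro nn_integral_eq_integral \<beta>.integrable_const_bound[of _ 1]) auto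
          finally show "(\<integral>\<^sup>+ \<omega>. ennreal (f \<omega>) \<partial>\<nu> n) \<le> ennreal (integral\<^sup>L \<beta> (\<lambda>r. \<phi> (\<tau> n r)))" .
        qed (use \<phi>(2) in auto)
        finally show ?thesis .
      qed
      then have "integral\<^sup>L M f \<le> integral\<^sup>L \<beta> \<phi>" using LIMSEQ_le[OF lim lim\<beta>] by auto
      moreover have "(\<integral>\<^sup>+ \<omega>. ennreal (f \<omega>) \<partial>M) = ennreal (integral\<^sup>L M f)"
        using f_meas f0 by (intro nn_integral_eq_integral M.integrable_const_bound[of _ "real K"]) (auto simp: intoM)
      ultimately show ?thesis unfolding f_def by (simp add: ennreal_leI)
    qed
    have "(\<integral>\<^sup>+ \<omega>. radius_sum (\<lambda>r. ennreal (\<phi> r)) \<omega> \<partial>M) =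
        (\<integral>\<^sup>+ \<omega>. (SUP K. ennreal (min (real K) (radius_sum \<phi> \<omega>))) \<partial>M)"
      using ennreal_eq_SUP_min[OF rs0] \<phi>(2) by (simp add: ennreal_radius_sum[symmetric])
    also have "\<dots> = (SUP K. \<integral>\<^sup>+ \<omega>. ennreal (min (real K) (radius_sum \<phi> \<omega>)) \<partial>M)"
    proof (rule nn_integral_monotone_convergence_SUP)
      show "incseq (\<lambda>K \<omega>. ennreal (min (real K) (radius_sum \<phi> \<omega>)))"
        by (auto simp: incseq_def le_fun_def min_def intro!: ennreal_leI)
      have "radius_sum \<phi> \<in> borel_measurable M" using measurable_radius_sum[OF \<phi>_meas] by (simp add: intoM)
      then show "(\<lambda>\<omega>. ennreal (min (real K) (radius_sum \<phi> \<omega>))) \<in> borel_measurable M" for K by measurable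
    qed
    also have "\<dots> \<le> ennreal (integral\<^sup>L \<beta> \<phi>)" by (intro SUP_least cut)
    finally show ?thesis .
  qed
  let ?b = "distr \<beta> borel (\<lambda>s. s)"
  have b_em: "emeasure ?b A = ennreal (integral\<^sup>L \<beta> (indicator A))" if A: "A \<in> sets borel" for A :: "real set"
  proof -
    have "emeasure ?b A = (\<integral>\<^sup>+ r. indicator A r \<partial>?b)" using A by simp
    also have "\<dots> = (\<integral>\<^sup>+ r. ennreal (indicator A r) \<partial>\<beta>)"
      using A by (subst nn_integral_distr[OF id_meas]) (auto intro!: nn_integral_cong simp: indicator_def)
    also have "\<dots> = ennreal (integral\<^sup>L \<beta> (indicator A))"
      using A by (intro nn_integral_eq_integral \<beta>.integrable_const_bound[of _ 1] into\<beta>) (auto simp: indicator_def)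
    finally show ?thesis .
  qed
  have closed: "(\<integral>\<^sup>+ \<omega>. radius_sum (indicator F) \<omega> \<partial>M) \<le> emeasure ?b F" if F: "closed F" for F :: "real set"
  proof (cases "F = {}")
    case True
    then show ?thesis by (simp add: radius_sum_def)
  next
    case ne: False
    define \<phi> where "\<phi> k x = max 0 (1 - real k * infdist x F)" for k x
    have \<phi>: "continuous_on UNIV (\<phi> k)" "0 \<le> \<phi> k x" "\<phi> k x \<le> 1" for k x
      unfolding \<phi>_def by (auto intro!: continuous_intros simp: infdist_nonneg)
    have F_sets: "F \<in> sets borel" using F by simp
    have "(\<lambda>k. integral\<^sup>L \<beta> (\<phi> k)) \<longlonglongrightarrow> integral\<^sup>L \<beta> (indicator F)"
    proof (rule integral_dominated_convergence[where w = "\<lambda>_. 1"])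
      have "(\<lambda>k. \<phi> k x) \<longlonglongrightarrow> indicator F x" for x
      proof (cases "x \<in> F")
        case True
        then show ?thesis by (simp add: \<phi>_def)
      next
        case False
        then have pos: "0 < infdist x F"
          using in_closed_iff_infdist_zero[OF F ne, of x] infdist_nonneg[of x F] by simp
        obtain k0 :: nat where k0: "1 / infdist x F \<le> real k0" using real_arch_simple by blast
        have "\<phi> k x = 0" if "k0 \<le> k" for k
        proof -
          have "1 \<le> real k0 * infdist x F" using k0 pos by (simp add: field_simps)
          also have "\<dots> \<le> real k * infdist x F" using that pos by (intro mult_right_mono) auto
          finally show ?thesis by (simp add: \<phi>_def)
        qed
        then have "\<forall>\<^sub>F k in sequentially. \<phi> k x = indicator F x"
          using False by (auto simp: eventually_sequentially)
        then show ?thesis by (rule tendsto_eventually)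
      qed
      then show "AE x in \<beta>. (\<lambda>k. \<phi> k x) \<longlonglongrightarrow> indicator F x" by simp
      show "\<phi> k \<in> borel_measurable \<beta>" for k by (rule into\<beta>[OF borel_measurable_continuous_onI[OF \<phi>(1)]])
      show "(indicator F :: real \<Rightarrow> real) \<in> borel_measurable \<beta>" using F_sets by (intro into\<beta>) simp
    qed (use \<phi> in auto)
    then have lim: "(\<lambda>k. ennreal (integral\<^sup>L \<beta> (\<phi> k))) \<longlonglongrightarrow> emeasure ?b F"
      unfolding b_em[OF F_sets] by (rule tendsto_ennrealI)
    have "(\<integral>\<^sup>+ \<omega>. radius_sum (indicator F) \<omega> \<partial>M) \<le> ennreal (integral\<^sup>L \<beta> (\<phi> k))" for k
    proof -
      have "indicator F r \<le> ennreal (\<phi> k r)" for r by (auto simp: indicator_def \<phi>_def)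
      then have "(\<integral>\<^sup>+ \<omega>. radius_sum (indicator F) \<omega> \<partial>M) \<le> (\<integral>\<^sup>+ \<omega>. radius_sum (\<lambda>r. ennreal (\<phi> k r)) \<omega> \<partial>M)"
        unfolding radius_sum_def by (intro nn_integral_mono sum_mono)
      also have "\<dots> \<le> ennreal (integral\<^sup>L \<beta> (\<phi> k))" by (rule smooth) (rule \<phi>)+
      finally show ?thesis .
    qed
    then show ?thesis by (intro LIMSEQ_le_const[OF lim]) auto
  qed
  define \<kappa> where "\<kappa> = intensity M fst (\<lambda>\<omega> i. snd (snd \<omega> i)) (borel :: real measure)"
  have \<kappa>: "emeasure \<kappa> A = (\<integral>\<^sup>+ \<omega>. radius_sum (indicator A) \<omega> \<partial>M)" if "A \<in> sets borel" for A
    unfolding \<kappa>_def radius_sum_def using that measurable_mark_radius measurable_marked_size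
    by (intro emeasure_intensity) (auto simp: intoM)
  have \<kappa>_sets: "sets \<kappa> = sets borel" by (simp add: \<kappa>_def)
  have "emeasure \<kappa> UNIV \<le> emeasure ?b UNIV" using closed[of UNIV] \<kappa>[of UNIV] by simp
  also have "\<dots> < \<infinity>" by (simp add: b_em)
  finally have \<kappa>_fin: "emeasure \<kappa> (space \<kappa>) \<noteq> \<infinity>"
    using sets_eq_imp_space_eq[OF \<kappa>_sets] by simp
  have "(\<integral>\<^sup>+ \<omega>. radius_sum (indicator A) \<omega> \<partial>M) \<le> emeasure ?b A" if A: "A \<in> sets borel" for A
  proof -
    have "emeasure \<kappa> A = (SUP K\<in>{K. K \<subseteq> A \<and> compact K}. emeasure \<kappa> K)"
      by (rule inner_regular[OF \<kappa>_sets \<kappa>_fin A])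
    also have "\<dots> \<le> emeasure ?b A"
    proof (rule SUP_least)
      fix K assume "K \<in> {K. K \<subseteq> A \<and> compact K}"
      then have K: "K \<subseteq> A" "closed K" by (auto intro: compact_imp_closed)
      have "emeasure \<kappa> K \<le> emeasure ?b K" using closed[OF K(2)] \<kappa>[of K] K(2) by simp
      also have "\<dots> \<le> emeasure ?b A" using K(1) A by (intro emeasure_mono) auto
      finally show "emeasure \<kappa> K \<le> emeasure ?b A" .
    qed
    finally show ?thesis using \<kappa>[OF A] by simp
  qed
  moreover have "AE \<omega> in M. \<omega> \<in> ?X \<and> radius_sum (\<lambda>r. r) \<omega> \<le> (\<Sum>e\<in>E. len e)"
    using M(3) total by eventually_elim (simp add: L_def)
  ultimately show thesis using that[OF M(1,2)] by blast
qed

end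

section \<open>The three conditions\<close>

lemma sets_borel_onD: "S \<in> sets borel \<Longrightarrow> A \<in> sets (borel_on S) \<Longrightarrow> A \<in> sets borel \<and> A \<subseteq> S"
  by (auto simp: sets_restrict_space_iff)

lemma sets_borel_on_Int: "B \<in> sets borel \<Longrightarrow> S \<inter> B \<in> sets (borel_on S)"
  by (auto simp: sets_restrict_space)

context
  fixes T :: "'a::metric_space set" and \<sigma> :: "'a measure"
  assumes \<sigma>: "finite_borel_measure_on T \<sigma>"
begin

lemma sets_sigma: "sets \<sigma> = sets (borel_on T)"
  and finite_sigma: "finite_measure \<sigma>"
  using \<sigma> by (auto simp: finite_borel_measure_on_def)

lemma space_sigma: "space \<sigma> = T"
  using sets_eq_imp_space_eq[OF sets_sigma] by (simp add: space_restrict_space)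

lemma tree_ball_sets: "tree_ball T v s \<in> sets \<sigma>"
proof -
  have "{x. dist x v \<le> s} \<in> sets borel" by (intro borel_closed closed_Collect_le continuous_intros)
  from sets_borel_on_Int[OF this, of T] show ?thesis
    unfolding sets_sigma tree_ball_def by (simp add: Int_def)
qed

text \<open>The function is monotone in the radius.\<close>

lemma max_ball_mass_measurable: "max_ball_mass T \<sigma> \<in> borel_measurable borel"
proof -
  interpret finite_measure \<sigma> by (rule finite_sigma)
  have mono: "max_ball_mass T \<sigma> s \<le> max_ball_mass T \<sigma> t" if "s \<le> t" for s t
    unfolding max_ball_mass_def using that tree_ball_sets
    by (intro SUP_mono' emeasure_mono) (auto simp: tree_ball_def)
  have "max_ball_mass T \<sigma> s \<le> emeasure \<sigma> (space \<sigma>)" for s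
    unfolding max_ball_mass_def by (intro SUP_least emeasure_space)
  then have fin: "max_ball_mass T \<sigma> s < \<top>" for s
    using emeasure_finite[of "space \<sigma>"] by (metis less_top neq_top_trans)
  have "mono (\<lambda>s. enn2real (max_ball_mass T \<sigma> s))"
    using mono fin by (auto simp: mono_def intro!: enn2real_mono)
  then have "(\<lambda>s. enn2real (max_ball_mass T \<sigma> s)) \<in> borel_measurable borel" by (rule borel_measurable_mono)
  then have "(\<lambda>s. ennreal (enn2real (max_ball_mass T \<sigma> s))) \<in> borel_measurable borel" by measurable
  then show ?thesis using fin by (simp add: ennreal_enn2real)
qed

lemma mass_le_of_cover:
  assumes "r \<in> covers_of_size T m"
  shows "emeasure \<sigma> T \<le> (\<Sum>i<m. max_ball_mass T \<sigma> (r i))"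
proof -
  obtain v where v: "\<And>i. i < m \<Longrightarrow> v i \<in> T" "T \<subseteq> (\<Union>i<m. tree_ball T (v i) (r i))"
    using assms by (auto simp: covers_of_size_def Pi_def)
  have "emeasure \<sigma> T \<le> emeasure \<sigma> (\<Union>i<m. tree_ball T (v i) (r i))"
    using v(2) tree_ball_sets by (intro emeasure_mono) auto
  also have "\<dots> \<le> (\<Sum>i<m. emeasure \<sigma> (tree_ball T (v i) (r i)))"
    using tree_ball_sets by (intro emeasure_subadditive_finite) auto
  also have "\<dots> \<le> (\<Sum>i<m. max_ball_mass T \<sigma> (r i))"
    unfolding max_ball_mass_def using v(1) by (intro sum_mono SUP_upper) auto
  finally show ?thesis .
qed

lemma mass_le_of_random_cover:
  assumes \<beta>: "finite_borel_measure_on {0..R} \<beta>"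
    and \<nu>: "prob_space \<nu>" "sets \<nu> = sets (restrict_space (covers_space T) (bounded_covers T l))"
    and le: "\<And>A. A \<in> sets (borel_on {0..}) \<Longrightarrow> radius_intensity \<nu> A \<le> emeasure (zero_extension \<beta>) A"
  shows "emeasure \<sigma> T \<le> (\<integral>\<^sup>+ s. max_ball_mass T \<sigma> s \<partial>\<beta>)"
proof -
  interpret \<nu>: prob_space \<nu> by (rule \<nu>(1))
  have sets\<beta>: "sets \<beta> = sets (borel_on {0..R})" using \<beta> by (simp add: finite_borel_measure_on_def)
  have space_cov: "\<omega> \<in> covers T" if "\<omega> \<in> space \<nu>" for \<omega>
    using that sets_eq_imp_space_eq[OF \<nu>(2)] by (simp add: space_restrict_space covers_space_sets(1))
  have into: "h \<in> \<nu> \<rightarrow>\<^sub>M N" if "h \<in> covers_space T \<rightarrow>\<^sub>M N" for h :: "_ \<Rightarrow> 'n" and N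
    using measurable_restrict_space1[OF that] by (simp add: measurable_cong_sets[OF \<nu>(2) HOL.refl])
  define r where "r \<omega> i = (if i < fst \<omega> then snd \<omega> i else 0)" for \<omega> :: "nat \<times> (nat \<Rightarrow> real)" and i
  have n: "fst \<in> \<nu> \<rightarrow>\<^sub>M count_space UNIV" by (rule into[OF measurable_size])
  have r0: "0 \<le> r \<omega> i" if "\<omega> \<in> space \<nu>" for \<omega> i
    using space_cov[OF that] by (fastforce simp: r_def covers_def covers_of_size_def PiE_def Pi_def)
  have r: "(\<lambda>\<omega>. r \<omega> i) \<in> \<nu> \<rightarrow>\<^sub>M borel_on {0..}" for i
    using into[OF measurable_radius, of i] r0 unfolding r_def
    by (intro measurable_restrict_space2) auto
  define \<kappa> where "\<kappa> = intensity \<nu> fst r (borel_on {0..})"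
  have zsets: "sets (zero_extension \<beta>) = sets (borel_on {0..})" by (simp add: zero_extension_def)
  have g: "max_ball_mass T \<sigma> \<in> borel_measurable (borel_on {0..})"
    by (rule measurable_restrict_space1[OF max_ball_mass_measurable])
  have "emeasure \<sigma> T = (\<integral>\<^sup>+ \<omega>. emeasure \<sigma> T \<partial>\<nu>)" by (simp add: \<nu>.emeasure_space_1)
  also have "\<dots> \<le> (\<integral>\<^sup>+ \<omega>. (\<Sum>i<fst \<omega>. max_ball_mass T \<sigma> (r \<omega> i)) \<partial>\<nu>)"
  proof (rule nn_integral_mono)
    fix \<omega> assume "\<omega> \<in> space \<nu>"
    then have "snd \<omega> \<in> covers_of_size T (fst \<omega>)" using space_cov by (auto simp: covers_def)
    from mass_le_of_cover[OF this]
    show "emeasure \<sigma> T \<le> (\<Sum>i<fst \<omega>. max_ball_mass T \<sigma> (r \<omega> i))" by (simp add: r_def)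
  qed
  also have "\<dots> = (\<integral>\<^sup>+ s. max_ball_mass T \<sigma> s \<partial>\<kappa>)"
    unfolding \<kappa>_def by (rule nn_integral_intensity[OF n r g, symmetric])
  also have "\<dots> \<le> (\<integral>\<^sup>+ s. max_ball_mass T \<sigma> s \<partial>zero_extension \<beta>)"
  proof (rule nn_integral_mono_setwise)
    fix A assume "A \<in> sets \<kappa>"
    then have A: "A \<in> sets (borel_on {0..})" by (simp add: \<kappa>_def)
    have "emeasure \<kappa> A = (\<integral>\<^sup>+ \<omega>. (\<Sum>i<fst \<omega>. indicator A (r \<omega> i)) \<partial>\<nu>)"
      unfolding \<kappa>_def by (rule emeasure_intensity[OF n r A])
    also have "\<dots> = radius_intensity \<nu> A"
      unfolding radius_intensity_def sum_indicator_eq_card case_prod_unfold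
      by (intro nn_integral_cong arg_cong[where f=of_nat] arg_cong[where f=card]) (auto simp: r_def)
    also have "\<dots> \<le> emeasure (zero_extension \<beta>) A" by (rule le[OF A])
    finally show "emeasure \<kappa> A \<le> emeasure (zero_extension \<beta>) A" .
  qed (simp add: \<kappa>_def zsets)
  also have "\<dots> = (\<integral>\<^sup>+ s. max_ball_mass T \<sigma> s \<partial>\<beta>)"
  proof -
    have "(\<lambda>s. s) \<in> \<beta> \<rightarrow>\<^sub>M borel_on {0..}"
      unfolding measurable_cong_sets[OF sets\<beta> HOL.refl]
      by (intro measurable_restrict_space2 measurable_restrict_space1) (auto simp: space_restrict_space)
    then show ?thesis unfolding zero_extension_def by (rule nn_integral_distr) (use g in simp)
  qed
  finally show ?thesis .
qed

lemma mass_le_of_fractional_cover: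
  assumes T: "compact T" and \<beta>: "finite_borel_measure_on {0..R} \<beta>"
    and \<xi>: "fractional_marked_ball_cover T R \<xi>"
    and le: "\<And>A. A \<in> sets (borel_on {0..R}) \<Longrightarrow> emeasure (radius_measure R \<xi>) A \<le> emeasure \<beta> A"
  shows "emeasure \<sigma> T \<le> (\<integral>\<^sup>+ s. max_ball_mass T \<sigma> s \<partial>\<beta>)"
proof -
  have sets\<beta>: "sets \<beta> = sets (borel_on {0..R})" using \<beta> by (simp add: finite_borel_measure_on_def)
  have sets\<xi>: "sets \<xi> = sets (borel_on (T \<times> {0..R}))" and fin\<xi>: "finite_measure \<xi>"
    and cov: "\<And>x. x \<in> T \<Longrightarrow> 1 \<le> emeasure \<xi> {(v, s) \<in> T \<times> {0..R}. dist x v \<le> s}"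
    using \<xi> by (auto simp: fractional_marked_ball_cover_def finite_borel_measure_on_def)
  have sp\<xi>: "space \<xi> = T \<times> {0..R}" using sets_eq_imp_space_eq[OF sets\<xi>] by (simp add: space_restrict_space)
  interpret \<sigma>: finite_measure \<sigma> by (rule finite_sigma)
  interpret \<xi>: finite_measure \<xi> by (rule fin\<xi>)
  interpret P: pair_sigma_finite \<sigma> \<xi> ..
  have slice: "{j \<in> T \<times> {0..R}. dist x (fst j) \<le> snd j + c} \<in> sets \<xi>" for x c
  proof -
    have "{j :: 'a \<times> real. dist x (fst j) \<le> snd j + c} \<in> sets borel"
      by (intro borel_closed closed_Collect_le continuous_intros)
    from sets_borel_on_Int[OF this, of "T \<times> {0..R}"] show ?thesis unfolding sets\<xi> by (simp add: Int_def)
  qed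
  define D where "D = {(x, j). x \<in> T \<and> j \<in> T \<times> {0..R} \<and> dist x (fst j) \<le> snd j}"
  have "\<exists>F. finite F \<and> F \<subseteq> T \<and> T \<subseteq> (\<Union>q\<in>F. ball q (1 / Suc n))" for n
  proof -
    have "0 < 1 / real (Suc n)" by simp
    then show ?thesis using seq_compact_imp_totally_bounded[OF compact_imp_seq_compact[OF T]] by blast
  qed
  then obtain F where F: "\<And>n. finite (F n)" "\<And>n. F n \<subseteq> T" "\<And>n. T \<subseteq> (\<Union>q\<in>F n. ball q (1 / Suc n))"
    by metis
  \<comment> \<open>closed subsets of the product lie in the product \<open>\<sigma>\<close>-algebra because \<open>T\<close> is separable\<close>
  have D_eq: "D = (\<Inter>n. \<Union>q\<in>F n. (T \<inter> ball q (1 / Suc n)) \<times> {j \<in> T \<times> {0..R}. dist q (fst j) \<le> snd j + 1 / Suc n})"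
    (is "_ = ?R")
  proof (intro set_eqI iffI)
    fix z assume "z \<in> D"
    then obtain x v s where z: "z = (x, (v, s))" "x \<in> T" "v \<in> T" "s \<in> {0..R}" "dist x v \<le> s" by (auto simp: D_def)
    show "z \<in> ?R"
    proof
      fix n
      obtain q where q: "q \<in> F n" "x \<in> ball q (1 / Suc n)" using F(3)[of n] z(2) by blast
      then have "dist q v \<le> s + 1 / Suc n" using z(5) dist_triangle[of q v x] by simp
      then show "z \<in> (\<Union>q\<in>F n. (T \<inter> ball q (1 / Suc n)) \<times> {j \<in> T \<times> {0..R}. dist q (fst j) \<le> snd j + 1 / Suc n})"
        using q z by auto
    qed
  next
    fix z assume z: "z \<in> ?R"
    obtain x v s where z': "z = (x, (v, s))" by (cases z) auto
    have *: "x \<in> T \<and> v \<in> T \<and> s \<in> {0..R} \<and> dist x v \<le> s + 2 * (1 / Suc n)" for n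
    proof -
      obtain q where "x \<in> T" "dist q x < 1 / Suc n" "v \<in> T" "s \<in> {0..R}" "dist q v \<le> s + 1 / Suc n"
        using z unfolding z' by fastforce
      then show ?thesis using dist_triangle2[of x v q] by (simp add: dist_commute)
    qed
    have "(\<lambda>n. s + 2 * (1 / Suc n)) \<longlonglongrightarrow> s + 2 * 0"
      using LIMSEQ_inverse_real_of_nat by (intro tendsto_intros) (simp add: inverse_eq_divide)
    then have "dist x v \<le> s" using * by (intro LIMSEQ_le_const[of _ s]) auto
    then show "z \<in> D" using *[of 0] by (simp add: D_def z')
  qed
  have D: "D \<in> sets (\<sigma> \<Otimes>\<^sub>M \<xi>)"
    unfolding D_eq
  proof (intro sets.countable_INT subsetI, elim imageE, simp only:)
    fix n
    have "T \<inter> ball q (1 / Suc n) \<in> sets \<sigma>" for q unfolding sets_sigma by (intro sets_borel_on_Int) auto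
    then show "(\<Union>q\<in>F n. (T \<inter> ball q (1 / Suc n)) \<times> {j \<in> T \<times> {0..R}. dist q (fst j) \<le> snd j + 1 / Suc n}) \<in> sets (\<sigma> \<Otimes>\<^sub>M \<xi>)"
      using slice F(1) by (intro sets.finite_UN pair_measureI) auto
  qed simp
  have "emeasure \<sigma> T = (\<integral>\<^sup>+ x. 1 \<partial>\<sigma>)" by (simp add: space_sigma)
  also have "\<dots> \<le> (\<integral>\<^sup>+ x. (\<integral>\<^sup>+ j. indicator D (x, j) \<partial>\<xi>) \<partial>\<sigma>)"
  proof (rule nn_integral_mono)
    fix x assume "x \<in> space \<sigma>"
    then have x: "x \<in> T" by (simp add: space_sigma)
    have eq: "{(v, s) \<in> T \<times> {0..R}. dist x v \<le> s} = {j \<in> T \<times> {0..R}. dist x (fst j) \<le> snd j}" by auto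
    have "(\<integral>\<^sup>+ j. indicator D (x, j) \<partial>\<xi>) = (\<integral>\<^sup>+ j. indicator {j \<in> T \<times> {0..R}. dist x (fst j) \<le> snd j} j \<partial>\<xi>)"
      using x by (intro nn_integral_cong) (auto simp: D_def indicator_def)
    also have "\<dots> = emeasure \<xi> {j \<in> T \<times> {0..R}. dist x (fst j) \<le> snd j}"
      using slice[of x 0] by simp
    finally show "1 \<le> (\<integral>\<^sup>+ j. indicator D (x, j) \<partial>\<xi>)" using cov[OF x] unfolding eq by simp
  qed
  also have "\<dots> = (\<integral>\<^sup>+ j. (\<integral>\<^sup>+ x. indicator D (x, j) \<partial>\<sigma>) \<partial>\<xi>)"
    by (rule P.Fubini'[symmetric]) (use D in simp)
  also have "\<dots> \<le> (\<integral>\<^sup>+ j. max_ball_mass T \<sigma> (snd j) \<partial>\<xi>)"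
  proof (rule nn_integral_mono)
    fix j assume "j \<in> space \<xi>"
    then have j: "fst j \<in> T" "j \<in> T \<times> {0..R}" by (auto simp: sp\<xi>)
    have "(\<integral>\<^sup>+ x. indicator D (x, j) \<partial>\<sigma>) = (\<integral>\<^sup>+ x. indicator (tree_ball T (fst j) (snd j)) x \<partial>\<sigma>)"
      using j by (intro nn_integral_cong) (auto simp: D_def tree_ball_def indicator_def)
    also have "\<dots> = emeasure \<sigma> (tree_ball T (fst j) (snd j))" using tree_ball_sets by simp
    also have "\<dots> \<le> max_ball_mass T \<sigma> (snd j)" unfolding max_ball_mass_def using j by (intro SUP_upper)
    finally show "(\<integral>\<^sup>+ x. indicator D (x, j) \<partial>\<sigma>) \<le> max_ball_mass T \<sigma> (snd j)" .
  qed
  also have "\<dots> = (\<integral>\<^sup>+ s. max_ball_mass T \<sigma> s \<partial>radius_measure R \<xi>)"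
    unfolding radius_measure_def
  proof (rule nn_integral_distr[symmetric])
    have "snd \<in> borel_measurable (borel :: ('a \<times> real) measure)"
      by (intro borel_measurable_continuous_onI continuous_intros)
    then show "snd \<in> \<xi> \<rightarrow>\<^sub>M borel_on {0..R}"
      unfolding measurable_cong_sets[OF sets\<xi> HOL.refl]
      by (intro measurable_restrict_space2 measurable_restrict_space1) (auto simp: space_restrict_space)
    show "max_ball_mass T \<sigma> \<in> borel_measurable (distr \<xi> (borel_on {0..R}) snd)"
      using measurable_restrict_space1[OF max_ball_mass_measurable] by simp
  qed
  also have "\<dots> \<le> (\<integral>\<^sup>+ s. max_ball_mass T \<sigma> s \<partial>\<beta>)"
    by (rule nn_integral_mono_setwise) (use le in \<open>auto simp: radius_measure_def sets\<beta>\<close>)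
  finally show ?thesis .
qed

end

lemma atomic_measure_finite_borel:
  assumes "atomic_measure_on S \<sigma>"
  shows "finite_borel_measure_on S \<sigma>"
proof -
  obtain n :: nat and a :: "nat \<Rightarrow> real" and x :: "nat \<Rightarrow> 'a" where
    "sets \<sigma> = sets (borel_on S)" and *: "\<And>i. i < n \<Longrightarrow> 0 \<le> a i \<and> x i \<in> S" and em:
    "\<And>A. A \<in> sets \<sigma> \<Longrightarrow> emeasure \<sigma> A = (\<Sum>i<n. ennreal (a i) * emeasure (return (borel_on S) (x i)) A)"
    using assms unfolding atomic_measure_on_def by blast
  have fin: "emeasure (return (borel_on S) (x i)) A \<noteq> \<top>" for i A
    by (cases "A \<in> sets (borel_on S)") (auto simp: emeasure_return indicator_def emeasure_notin_sets)
  then have "emeasure \<sigma> (space \<sigma>) \<noteq> \<infinity>"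
    by (subst em) (auto simp: ennreal_mult_eq_top_iff fin)
  then show ?thesis
    using \<open>sets \<sigma> = _\<close> by (simp add: finite_borel_measure_on_def finite_measureI)
qed

context tree_coordinates
begin

lemma marked_cover_is_cover:
  assumes "(m, w) \<in> marked_covers B"
  shows "(m, \<lambda>i\<in>{..<m}. snd (w i)) \<in> covers T"
proof -
  have m: "1 \<le> m" and w: "w \<in> {..<m} \<rightarrow>\<^sub>E T \<times> {0..B}" and cov: "\<And>x. x \<in> T \<Longrightarrow> \<exists>i<m. dist x (fst (w i)) \<le> snd (w i)"
    using assms by (auto simp: marked_covers_def)
  have wi: "fst (w i) \<in> T \<and> 0 \<le> snd (w i)" if "i < m" for i
    using PiE_mem[OF w, of i] that by (auto simp: mem_Times_iff)
  have "(\<lambda>i\<in>{..<m}. snd (w i)) \<in> covers_of_size T m"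
    unfolding covers_of_size_def
  proof (intro CollectI conjI bexI[of _ "\<lambda>i. fst (w i)"])
    show "(\<lambda>i\<in>{..<m}. snd (w i)) \<in> {..<m} \<rightarrow>\<^sub>E {0..}" using wi by (simp add: PiE_iff)
    show "(\<lambda>i. fst (w i)) \<in> {..<m} \<rightarrow> T" using wi by simp
    show "T \<subseteq> (\<Union>i<m. tree_ball T (fst (w i)) ((\<lambda>i\<in>{..<m}. snd (w i)) i))"
    proof
      fix x assume x: "x \<in> T"
      then obtain i where "i < m" "dist x (fst (w i)) \<le> snd (w i)" using cov by blast
      then show "x \<in> (\<Union>i<m. tree_ball T (fst (w i)) ((\<lambda>i\<in>{..<m}. snd (w i)) i))"
        using x by (intro UN_I[of i]) (auto simp: tree_ball_def)
    qed
  qed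
  then show ?thesis using m by (simp add: covers_def)
qed

text \<open>Both measures are read off from the random marked cover of \<open>exact_random_cover\<close>: the law of
its radii, restricted to the event of probability one on which it is a short cover, and its intensity.
The radii of the marked cover were only confined to \<open>[0, R + 3]\<close>; as \<open>\<beta>\<close> lives on \<open>[0, R]\<close>, the intensity
bound forces them into \<open>[0, R]\<close> almost surely.\<close>

lemma random_cover_exists:
  assumes R: "0 \<le> R" "R \<le> (\<Sum>e\<in>E. len e)"
    and \<beta>: "finite_borel_measure_on {0..R} \<beta>"
    and dual: "\<And>\<sigma>. atomic_measure_on T \<sigma> \<Longrightarrow> emeasure \<sigma> T \<le> (\<integral>\<^sup>+ s. max_ball_mass T \<sigma> s \<partial>\<beta>)"
  shows "(\<exists>\<nu>. prob_space \<nu> \<and>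
       sets \<nu> = sets (restrict_space (covers_space T) (bounded_covers T (\<Sum>e\<in>E. len e))) \<and>
       (\<forall>A\<in>sets (borel_on {0..}). radius_intensity \<nu> A \<le> emeasure (zero_extension \<beta>) A))"
    and "(\<exists>\<xi>. fractional_marked_ball_cover T R \<xi> \<and>
       (\<forall>A\<in>sets (borel_on {0..R}). emeasure (radius_measure R \<xi>) A \<le> emeasure \<beta> A))"
proof -
  define L where "L = (\<Sum>e\<in>E. len e)"
  obtain \<nu> :: "(nat \<times> (nat \<Rightarrow> 'a \<times> real)) measure" where prob: "prob_space \<nu>" and sets: "sets \<nu> = sets borel"
    and supp: "AE \<omega> in \<nu>. \<omega> \<in> marked_covers (R + 3) \<and> radius_sum (\<lambda>r. r) \<omega> \<le> L"
    and le: "\<And>A. A \<in> sets borel \<Longrightarrow> (\<integral>\<^sup>+ \<omega>. radius_sum (indicator A) \<omega> \<partial>\<nu>) \<le> emeasure (distr \<beta> borel (\<lambda>s. s)) A"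
  proof (rule exact_random_cover[OF R \<beta>], goal_cases)
    case (1 \<sigma>)
    from 1(2) show ?case by (rule dual)
  next
    case (2 \<nu>)
    from 2(2-) show ?case unfolding L_def[symmetric] by (rule 2(1))
  qed
  interpret \<nu>: prob_space \<nu> by (rule prob)
  have into\<nu>: "h \<in> measurable \<nu> N \<longleftrightarrow> h \<in> measurable borel N" for h :: "_ \<Rightarrow> 'n" and N
    by (simp add: measurable_cong_sets[OF sets HOL.refl])
  have sp\<nu>: "space \<nu> = UNIV" using sets_eq_imp_space_eq[OF sets] by simp
  have sets\<beta>: "sets \<beta> = sets (borel_on {0..R})" and fin\<beta>: "finite_measure \<beta>"
    using \<beta> by (auto simp: finite_borel_measure_on_def)
  have sp\<beta>: "space \<beta> = {0..R}" using sets_eq_imp_space_eq[OF sets\<beta>] by (simp add: space_restrict_space)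
  have id_meas: "(\<lambda>s. s) \<in> borel_measurable \<beta>"
    unfolding measurable_cong_sets[OF sets\<beta> HOL.refl] by (rule measurable_restrict_space1) simp
  have em\<beta>: "emeasure (distr \<beta> borel (\<lambda>s. s)) A = emeasure \<beta> (A \<inter> {0..R})" if "A \<in> sets borel" for A
    using that by (subst emeasure_distr[OF id_meas]) (auto simp: sp\<beta>)
  have Xk: "marked_covers B \<in> sets borel" for B
  proof -
    have "(\<Union>k. {\<omega>\<in>marked_covers B. fst \<omega> = k}) \<in> sets borel"
      using compact_marked_covers by (intro sets.countable_UN) (auto intro: borel_compact)
    also have "(\<Union>k. {\<omega>\<in>marked_covers B. fst \<omega> = k}) = marked_covers B" by auto
    finally show ?thesis .
  qed
  show "\<exists>\<nu>. prob_space \<nu> \<and>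
       sets \<nu> = sets (restrict_space (covers_space T) (bounded_covers T (\<Sum>e\<in>E. len e))) \<and>
       (\<forall>A\<in>sets (borel_on {0..}). radius_intensity \<nu> A \<le> emeasure (zero_extension \<beta>) A)"
  proof -
    define G where "G = marked_covers (R + 3) \<inter> {\<omega>. radius_sum (\<lambda>r. r) \<omega> \<le> L}"
    have "{\<omega> \<in> space borel. radius_sum (\<lambda>r. r) \<omega> \<le> L} \<in> sets borel"
      using measurable_radius_sum[of "\<lambda>r. r"] by measurable
    then have G: "G \<in> sets \<nu>" using Xk unfolding G_def sets by auto
    have AE_G: "AE \<omega> in \<nu>. \<omega> \<in> G" using supp by (simp add: G_def)
    define \<nu>1 where "\<nu>1 = restrict_space \<nu> G"
    have sp1: "space \<nu>1 = G" by (simp add: \<nu>1_def space_restrict_space sp\<nu>)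
    have "emeasure \<nu>1 (space \<nu>1) = emeasure \<nu> G"
      unfolding sp1 unfolding \<nu>1_def using G by (subst emeasure_restrict_space) (auto simp: sp\<nu>)
    also have "\<dots> = 1" using \<nu>.emeasure_eq_1_AE[OF G AE_G] .
    finally have prob1: "prob_space \<nu>1" by (rule prob_spaceI)
    have into1: "h \<in> \<nu>1 \<rightarrow>\<^sub>M N" if "h \<in> borel \<rightarrow>\<^sub>M N" for h :: "_ \<Rightarrow> 'n" and N
      using measurable_restrict_space1[of h \<nu> N G] that by (simp add: \<nu>1_def into\<nu>)
    define \<Phi> where "\<Phi> \<omega> = (fst \<omega>, \<lambda>i\<in>{..<fst \<omega>}. snd (snd \<omega> i))" for \<omega> :: "nat \<times> (nat \<Rightarrow> 'a \<times> real)"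
    have \<Phi>_cov: "\<Phi> \<omega> \<in> covers T" if "\<omega> \<in> G" for \<omega>
      using marked_cover_is_cover[of "fst \<omega>" "snd \<omega>" "R + 3"] that by (simp add: \<Phi>_def G_def)
    have \<Phi>_bounded: "\<Phi> \<omega> \<in> bounded_covers T L" if "\<omega> \<in> G" for \<omega>
      using \<Phi>_cov[OF that] that by (simp add: bounded_covers_def \<Phi>_def G_def radius_sum_def)
    let ?C = "restrict_space (covers_space T) (bounded_covers T L)"
    have "\<Phi> \<in> \<nu>1 \<rightarrow>\<^sub>M covers_space T"
      unfolding \<Phi>_def using \<Phi>_cov
      by (intro measurable_into_covers_space into1[OF measurable_marked_size] into1[OF measurable_mark_radius])
        (simp add: sp1 \<Phi>_def)
    then have \<Phi>: "\<Phi> \<in> \<nu>1 \<rightarrow>\<^sub>M ?C"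
      using \<Phi>_bounded by (intro measurable_restrict_space2) (auto simp: sp1)
    define \<mu> where "\<mu> = distr \<nu>1 ?C \<Phi>"
    have "radius_intensity \<mu> A \<le> emeasure (zero_extension \<beta>) A" if A: "A \<in> sets (borel_on {0..})" for A
    proof -
      have A': "A \<in> sets borel" "A \<subseteq> {0..}" using sets_borel_onD[OF _ A] by auto
      define h where "h x = (\<Sum>i<fst x. indicator A (if i < fst x then snd x i else 0) :: ennreal)"
        for x :: "nat \<times> (nat \<Rightarrow> real)"
      have h: "h \<in> borel_measurable (covers_space T)"
        unfolding h_def using A'(1)
        by (intro measurable_sum_lessThan_count measurable_size measurable_compose[OF measurable_radius]) auto
      have h_card: "h x = of_nat (card {i\<in>{..<fst x}. snd x i \<in> A})" for x
        unfolding sum_indicator_eq_card[symmetric] h_def by (intro sum.cong) auto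
      have "radius_intensity \<mu> A = (\<integral>\<^sup>+ x. h x \<partial>\<mu>)"
        unfolding radius_intensity_def case_prod_unfold h_card ..
      also have "\<dots> = (\<integral>\<^sup>+ \<omega>. h (\<Phi> \<omega>) \<partial>\<nu>1)"
        unfolding \<mu>_def using measurable_restrict_space1[OF h] by (intro nn_integral_distr[OF \<Phi>]) simp
      also have "\<dots> = (\<integral>\<^sup>+ \<omega>. radius_sum (indicator A) \<omega> \<partial>\<nu>1)"
        by (intro nn_integral_cong) (simp add: h_def \<Phi>_def radius_sum_def)
      also have "\<dots> = (\<integral>\<^sup>+ \<omega>. radius_sum (indicator A) \<omega> * indicator G \<omega> \<partial>\<nu>)"
        unfolding \<nu>1_def using G by (intro nn_integral_restrict_space) (simp add: sp\<nu>)
      also have "\<dots> \<le> (\<integral>\<^sup>+ \<omega>. radius_sum (indicator A) \<omega> \<partial>\<nu>)"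
        by (intro nn_integral_mono) (auto simp: indicator_def)
      also have "\<dots> \<le> emeasure \<beta> (A \<inter> {0..R})" using le[OF A'(1)] em\<beta>[OF A'(1)] by simp
      also have "\<dots> = emeasure (zero_extension \<beta>) A"
      proof -
        have "(\<lambda>s. s) \<in> \<beta> \<rightarrow>\<^sub>M borel_on {0..}"
          using id_meas by (intro measurable_restrict_space2) (auto simp: sp\<beta>)
        then show ?thesis unfolding zero_extension_def using A by (subst emeasure_distr) (auto simp: sp\<beta>)
      qed
      finally show ?thesis .
    qed
    moreover have "prob_space \<mu>" unfolding \<mu>_def by (rule prob_space.prob_space_distr[OF prob1 \<Phi>])
    ultimately show ?thesis unfolding L_def[symmetric] by (intro exI[of _ \<mu>]) (auto simp: \<mu>_def)
  qed
  have small: "AE \<omega> in \<nu>. \<forall>i<fst \<omega>. snd (snd \<omega> i) \<in> {0..R}"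
  proof -
    have "- {0..R} \<in> sets borel" by simp
    then have rs: "radius_sum (indicator (- {0..R}) :: real \<Rightarrow> ennreal) \<in> borel_measurable \<nu>"
      using measurable_radius_sum[of "indicator (- {0..R}) :: real \<Rightarrow> ennreal"] by (simp add: into\<nu>)
    have "(\<integral>\<^sup>+ \<omega>. radius_sum (indicator (- {0..R})) \<omega> \<partial>\<nu>) \<le> 0"
      using le[of "- {0..R}"] em\<beta>[of "- {0..R}"] by simp
    then have "AE \<omega> in \<nu>. radius_sum (indicator (- {0..R})) \<omega> = (0::ennreal)"
      using nn_integral_0_iff_AE[OF rs] by simp
    then show ?thesis
      by eventually_elim (auto simp: radius_sum_def indicator_def split: if_splits)
  qed
  show "\<exists>\<xi>. fractional_marked_ball_cover T R \<xi> \<and>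
       (\<forall>A\<in>sets (borel_on {0..R}). emeasure (radius_measure R \<xi>) A \<le> emeasure \<beta> A)"
  proof -
    let ?S = "T \<times> {0..R}"
    have S: "?S \<in> sets borel" using compact_T by (intro borel_compact compact_Times) auto
    define \<kappa> where "\<kappa> = intensity \<nu> fst snd (borel :: ('a \<times> real) measure)"
    have \<kappa>: "emeasure \<kappa> A = (\<integral>\<^sup>+ \<omega>. (\<Sum>i<fst \<omega>. indicator A (snd \<omega> i)) \<partial>\<nu>)" if "A \<in> sets borel" for A
      unfolding \<kappa>_def using that measurable_marked_size measurable_mark
      by (intro emeasure_intensity) (auto simp: into\<nu>)
    have \<kappa>_sets: "sets \<kappa> = sets borel" by (simp add: \<kappa>_def)
    have \<kappa>_le: "emeasure \<kappa> A \<le> emeasure (distr \<beta> borel (\<lambda>s. s)) B"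
      if "A \<in> sets borel" "B \<in> sets borel" "\<And>j. j \<in> A \<Longrightarrow> snd j \<in> B" for A B
    proof -
      have "emeasure \<kappa> A \<le> (\<integral>\<^sup>+ \<omega>. radius_sum (indicator B) \<omega> \<partial>\<nu>)"
        unfolding \<kappa>[OF that(1)] radius_sum_def
        by (intro nn_integral_mono sum_mono) (use that(3) in \<open>auto simp: indicator_def\<close>)
      then show ?thesis using le[OF that(2)] by simp
    qed
    define \<xi> where "\<xi> = restrict_space \<kappa> ?S"
    have sets\<xi>: "sets \<xi> = sets (borel_on ?S)" by (simp add: \<xi>_def sets_restrict_space \<kappa>_sets)
    have sp\<xi>: "space \<xi> = ?S" using sets_eq_imp_space_eq[OF sets\<xi>] by (simp add: space_restrict_space)
    have em\<xi>: "emeasure \<xi> A = emeasure \<kappa> A" if "A \<subseteq> ?S" for A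
      unfolding \<xi>_def using S that sets_eq_imp_space_eq[OF \<kappa>_sets]
      by (intro emeasure_restrict_space) (auto simp: \<kappa>_sets)
    have "emeasure \<xi> (space \<xi>) \<le> emeasure (distr \<beta> borel (\<lambda>s. s)) UNIV"
      unfolding sp\<xi> em\<xi>[OF order_refl] by (intro \<kappa>_le S) auto
    also have "\<dots> < \<infinity>" using finite_measure.emeasure_finite[OF fin\<beta>] by (simp add: em\<beta> less_top)
    finally have "finite_measure \<xi>" by (intro finite_measureI) simp
    moreover have "1 \<le> emeasure \<xi> {(v, s) \<in> ?S. dist x v \<le> s}" if x: "x \<in> T" for x
    proof -
      let ?A = "{(v, s) \<in> ?S. dist x v \<le> s}"
      have "{j :: 'a \<times> real. dist x (fst j) \<le> snd j} \<in> sets borel"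
        by (intro borel_closed closed_Collect_le continuous_intros)
      then have "?S \<inter> {j. dist x (fst j) \<le> snd j} \<in> sets borel" using S by (rule sets.Int[rotated])
      also have "?S \<inter> {j. dist x (fst j) \<le> snd j} = ?A" by auto
      finally have A: "?A \<in> sets borel" .
      have "1 = (\<integral>\<^sup>+ \<omega>. 1 \<partial>\<nu>)" by (simp add: \<nu>.emeasure_space_1)
      also have "\<dots> \<le> (\<integral>\<^sup>+ \<omega>. (\<Sum>i<fst \<omega>. indicator ?A (snd \<omega> i)) \<partial>\<nu>)"
      proof (rule nn_integral_mono_AE)
        show "AE \<omega> in \<nu>. 1 \<le> (\<Sum>i<fst \<omega>. indicator ?A (snd \<omega> i) :: ennreal)"
          using supp small
        proof eventually_elim
          case (elim \<omega>)
          obtain m w where \<omega>: "\<omega> = (m, w)" by (cases \<omega>)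
          obtain i where i: "i < m" "dist x (fst (w i)) \<le> snd (w i)" and w: "w \<in> {..<m} \<rightarrow>\<^sub>E T \<times> {0..R + 3}"
            using elim(1) x unfolding \<omega> marked_covers_def by auto
          have "fst (w i) \<in> T" using w i(1) by (auto simp: PiE_def Pi_def)
          moreover have "snd (w i) \<in> {0..R}" using elim(2) i(1) unfolding \<omega> by auto
          ultimately have "w i \<in> ?A" using i(2) by (cases "w i") auto
          then have "1 = (\<Sum>k\<in>{i}. indicator ?A (w k) :: ennreal)" by simp
          also have "\<dots> \<le> (\<Sum>k<m. indicator ?A (w k))" using i(1) by (intro sum_mono2) auto
          finally show ?case unfolding \<omega> by simp
        qed
      qed
      also have "\<dots> = emeasure \<kappa> ?A" by (rule \<kappa>[OF A, symmetric])
      also have "\<dots> = emeasure \<xi> ?A" by (rule em\<xi>[symmetric]) auto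
      finally show ?thesis .
    qed
    ultimately have "fractional_marked_ball_cover T R \<xi>"
      using sets\<xi> by (simp add: fractional_marked_ball_cover_def finite_borel_measure_on_def)
    moreover have "emeasure (radius_measure R \<xi>) A \<le> emeasure \<beta> A" if A: "A \<in> sets (borel_on {0..R})" for A
    proof -
      have A': "A \<in> sets borel" "A \<subseteq> {0..R}" using sets_borel_onD[OF _ A] by auto
      have snd: "snd \<in> borel_measurable (borel :: ('a \<times> real) measure)"
        by (intro borel_measurable_continuous_onI continuous_intros)
      have "snd \<in> \<xi> \<rightarrow>\<^sub>M borel_on {0..R}"
        unfolding measurable_cong_sets[OF sets\<xi> HOL.refl]
        by (intro measurable_restrict_space2 measurable_restrict_space1 snd) (auto simp: space_restrict_space)
      then have "emeasure (radius_measure R \<xi>) A = emeasure \<xi> (snd -` A \<inter> ?S)"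
        unfolding radius_measure_def using A by (subst emeasure_distr) (auto simp: sp\<xi>)
      also have "\<dots> = emeasure \<kappa> (snd -` A \<inter> ?S)" by (rule em\<xi>) auto
      also have "\<dots> \<le> emeasure (distr \<beta> borel (\<lambda>s. s)) A"
        using measurable_sets[OF snd A'(1)] S A'(1) by (intro \<kappa>_le) auto
      also have "\<dots> = emeasure \<beta> A" using em\<beta>[OF A'(1)] A'(2) by (simp add: Int_absorb2)
      finally show ?thesis .
    qed
    ultimately show ?thesis by blast
  qed
qed

end

theorem theorem4p7:
  fixes V :: "'v set" and E :: "'v set set" and len :: "'v set \<Rightarrow> real"
    and T :: "'a::metric_space set" and R :: real and \<beta> :: "real measure"
  assumes tree: "finite_metric_tree V E len T"
    and nontrivial: "nontrivial T"
    and R: "0 < R" "R \<le> total_length E len"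
    and \<beta>: "finite_borel_measure_on {0..R} \<beta>"
  defines "i \<equiv>
    (\<exists>\<nu>. prob_space \<nu> \<and>
       sets \<nu> = sets (restrict_space (covers_space T) (bounded_covers T (total_length E len))) \<and>
       (\<forall>A\<in>sets (borel_on {0..}). radius_intensity \<nu> A \<le> emeasure (zero_extension \<beta>) A))"
    and "ii \<equiv>
    (\<exists>\<xi>. fractional_marked_ball_cover T R \<xi> \<and>
       (\<forall>A\<in>sets (borel_on {0..R}). emeasure (radius_measure R \<xi>) A \<le> emeasure \<beta> A))"
    and "iii \<equiv>
    (\<forall>\<sigma>. finite_borel_measure_on T \<sigma> \<longrightarrow>
       emeasure \<sigma> T \<le> (\<integral>\<^sup>+ s. max_ball_mass T \<sigma> s \<partial>\<beta>))"
    and "iii_atomic \<equiv>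
    (\<forall>\<sigma>. atomic_measure_on T \<sigma> \<longrightarrow>
       emeasure \<sigma> T \<le> (\<integral>\<^sup>+ s. max_ball_mass T \<sigma> s \<partial>\<beta>))"
  shows "(i \<longleftrightarrow> ii) \<and> (ii \<longleftrightarrow> iii) \<and> (iii \<longleftrightarrow> iii_atomic)"
proof -
  obtain f \<rho> where "tree_coordinates T E len f \<rho>"
    using finite_metric_tree_coordinates[OF tree] .
  then interpret tree_coordinates T E len f \<rho> .
  have "i \<Longrightarrow> iii" unfolding i_def iii_def using mass_le_of_random_cover[OF _ \<beta>] by blast
  moreover have "ii \<Longrightarrow> iii"
    unfolding ii_def iii_def using mass_le_of_fractional_cover[OF _ compact_T \<beta>] by blast
  moreover have "iii \<Longrightarrow> iii_atomic"
    unfolding iii_def iii_atomic_def using atomic_measure_finite_borel by blast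
  moreover have "i \<and> ii" if iii_atomic
    using random_cover_exists[of R \<beta>] R \<beta> that unfolding i_def ii_def iii_atomic_def total_length_def by simp
  ultimately show ?thesis by blast
qed

end
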